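(* If $\epsilon>0$, $\beta=0$ and $\mu\ge0$, then the planar system $$\dot x=y,\qquad \dot y=(\mu+x^2-x^4)y+\beta x-\epsilon x^3$$ has a unique stable limit cycle.
   Context: Here $x,y$ are real state variables and $\mu,\beta,\epsilon$ are real parameters. *)

theory Defs
  imports "HOL-Analysis.Analysis"
begin

definition system_field :: "real \<Rightarrow> real \<Rightarrow> real \<Rightarrow> real \<times> real \<Rightarrow> real \<times> real" where
  "system_field \<mu> \<beta> \<epsilon> = (\<lambda>(x, y). (y, (\<mu> + x^2 - x^4) * y + \<beta> * x - \<epsilon> * x^3))"

definition solution_on ::
  "(real \<times> real \<Rightarrow> real \<times> real) \<Rightarrow> real set \<Rightarrow> (real \<Rightarrow> real \<times> real) \<Rightarrow> bool" where
  "solution_on f I X \<longleftrightarrow> (\<forall>t\<in>I. (X has_vector_derivative f (X t)) (at t within I))"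

text \<open>Orbits are point sets. Equilibria are not counted as periodic orbits, and
  \<open>T\<close> need not be the minimal period.\<close>

definition periodic_orbit ::
  "(real \<times> real \<Rightarrow> real \<times> real) \<Rightarrow> (real \<times> real) set \<Rightarrow> bool" where
  "periodic_orbit f \<Gamma> \<longleftrightarrow>
     (\<exists>X T. solution_on f UNIV X \<and> T > 0 \<and> (\<forall>t. X (t + T) = X t) \<and>
            (\<exists>t. X t \<noteq> X 0) \<and> \<Gamma> = range X)"

text \<open>A limit cycle is a periodic orbit isolated in the set of all periodic orbits.\<close>

definition limit_cycle ::
  "(real \<times> real \<Rightarrow> real \<times> real) \<Rightarrow> (real \<times> real) set \<Rightarrow> bool" where
  "limit_cycle f \<Gamma> \<longleftrightarrow>
     periodic_orbit f \<Gamma> \<and>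
     (\<exists>U. open U \<and> \<Gamma> \<subseteq> U \<and> (\<forall>\<Delta>. periodic_orbit f \<Delta> \<and> \<Delta> \<subseteq> U \<longrightarrow> \<Delta> = \<Gamma>))"

text \<open>Asymptotic orbital stability: Lyapunov stability of \<open>\<Gamma>\<close> as a set, and attraction of all
  solutions starting near \<open>\<Gamma>\<close>. Existence of these solutions for all forward time is demanded
  explicitly, so that neither condition can hold vacuously.\<close>

definition orbitally_stable ::
  "(real \<times> real \<Rightarrow> real \<times> real) \<Rightarrow> (real \<times> real) set \<Rightarrow> bool" where
  "orbitally_stable f \<Gamma> \<longleftrightarrow>
     (\<forall>e>0. \<exists>d>0. \<forall>X. solution_on f {0..} X \<and> infdist (X 0) \<Gamma> < d \<longrightarrow>
        (\<forall>t\<ge>0. infdist (X t) \<Gamma> < e))"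

definition orbitally_attracting ::
  "(real \<times> real \<Rightarrow> real \<times> real) \<Rightarrow> (real \<times> real) set \<Rightarrow> bool" where
  "orbitally_attracting f \<Gamma> \<longleftrightarrow>
     (\<exists>d>0. \<forall>p. infdist p \<Gamma> < d \<longrightarrow>
        (\<exists>X. solution_on f {0..} X \<and> X 0 = p) \<and>
        (\<forall>X. solution_on f {0..} X \<and> X 0 = p \<longrightarrow> ((\<lambda>t. infdist (X t) \<Gamma>) \<longlongrightarrow> 0) at_top))"

definition stable_limit_cycle ::
  "(real \<times> real \<Rightarrow> real \<times> real) \<Rightarrow> (real \<times> real) set \<Rightarrow> bool" where
  "stable_limit_cycle f \<Gamma> \<longleftrightarrow>
     limit_cycle f \<Gamma> \<and> orbitally_stable f \<Gamma> \<and> orbitally_attracting f \<Gamma>"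

end

theory Submission imports Defs begin

text \<open>In the Lienard variable \<open>z = y + F x\<close>, \<open>F x = x\<^sup>5 / 5 - x\<^sup>3 / 3 - \<mu> x\<close>, the system reads
  \<open>x' = z - F x\<close>, \<open>z' = - \<epsilon> x\<^sup>3\<close> and is invariant under \<open>(x, z) \<mapsto> (- x, - z)\<close>. Every
  nontrivial solution keeps returning to the line \<open>x = 0\<close>, so everything is governed by the half-return
  map \<open>P\<close>, which sends \<open>(0, z)\<close> to \<open>(0, - P z)\<close> through the right half plane. For \<open>\<mu> \<ge> 0\<close> the
  function \<open>F\<close> is negative on \<open>(0, a)\<close> and increasing on \<open>[a, \<infinity>)\<close>, where \<open>a\<close> is its positive root.
  Along solutions the energy \<open>E = z\<^sup>2 / 2 + \<epsilon> x\<^sup>4 / 4\<close> satisfies \<open>E' = - \<epsilon> x\<^sup>3 F x\<close>. Hence an arc that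
  stays in \<open>x \<le> a\<close> gains energy, so \<open>P z > z\<close>. Of two arcs that pass beyond \<open>a\<close>, the outer one gains less
  in the strip \<open>x \<le> a\<close> (compare at equal \<open>x\<close>) and loses more beyond it (compare at equal \<open>z\<close>), so
  \<open>(P z)\<^sup>2 - z\<^sup>2\<close> is strictly decreasing there. Thus \<open>P\<close> has exactly one fixed point, which is
  globally attracting and spans the cycle.\<close>

section \<open>Existence and uniqueness for Lipschitz fields\<close>

text \<open>Two features rule out the usual shortcuts. The Jacobian at the origin has eigenvalues 0
  and \<open>\<mu>\<close>, so neither the turning of nearby orbits nor their repulsion can be read
  off a linearisation; the return to \<open>x = 0\<close> and \<open>P z > z\<close> for small
  \<open>z\<close> need arguments of their own. And the field is only locally Lipschitz, so global
  existence rests on a trapping function for a truncated field. It is obtained for forward time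
  only; statements about the past take the form of uniqueness backwards along two given forward
  solutions.

  The change of parameter in mid-arc is forced as well. In the \<open>(x, z)\<close> plane an arc
  has a vertical tangent where \<open>y = 0\<close>, so \<open>x\<close> parametrises only its two
  limbs, whereas \<open>z\<close> decreases along all of it. Conversely, comparing two arcs at equal
  \<open>z\<close> needs \<open>F\<close> increasing, which fails in the strip
  \<open>0 < x < a\<close>; comparing at equal \<open>x\<close> needs only the sign of
  \<open>F\<close>.\<close>

lemma gronwall_uniqueness:
  fixes f :: "'a::real_inner \<Rightarrow> 'a"
  assumes lip: "L-lipschitz_on K f"
    and X: "\<And>t. t \<in> {0..T} \<Longrightarrow> (X has_vector_derivative f (X t)) (at t within {0..T})" "X ` {0..T} \<subseteq> K"
    and Y: "\<And>t. t \<in> {0..T} \<Longrightarrow> (Y has_vector_derivative f (Y t)) (at t within {0..T})" "Y ` {0..T} \<subseteq> K"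
    and t: "0 \<le> t" "t \<le> T"
  shows "dist (X t) (Y t) \<le> exp (L * t) * dist (X 0) (Y 0)"
proof -
  \<comment> \<open>The squared distance discounted at rate \<open>2 * L\<close> is nonincreasing,
    by Cauchy-Schwarz and the Lipschitz bound. Squaring keeps it differentiable even where the
    curves meet.\<close>
  define D where "D = (\<lambda>s. ((X s - Y s) \<bullet> (X s - Y s)) * exp (- 2 * L * s))"
  define D' where "D' = (\<lambda>s. (2 * ((X s - Y s) \<bullet> (f (X s) - f (Y s))) - 2 * L * ((X s - Y s) \<bullet> (X s - Y s))) * exp (- 2 * L * s))"
  have der: "(D has_real_derivative D' s) (at s within {0..T})" if "s \<in> {0..T}" for s
  proof -
    have "((\<lambda>s. X s - Y s) has_vector_derivative (f (X s) - f (Y s))) (at s within {0..T})"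
      by (intro derivative_intros X Y that)
    then have 1: "((\<lambda>s. (X s - Y s) \<bullet> (X s - Y s)) has_real_derivative 
        2 * ((X s - Y s) \<bullet> (f (X s) - f (Y s)))) (at s within {0..T})"
      using bounded_bilinear.has_vector_derivative[OF bounded_bilinear_inner, of _ _ s "{0..T}"]
      by (fastforce simp: has_real_derivative_iff_has_vector_derivative inner_commute)
    have "((\<lambda>s. exp (- 2 * L * s)) has_real_derivative (- 2 * L) * exp (- 2 * L * s)) (at s within {0..T})"
      by (auto intro!: derivative_eq_intros)
    from DERIV_mult[OF 1 this] have "(D has_real_derivative (2 * ((X s - Y s) \<bullet> (f (X s) - f (Y s)))) * exp (- 2 * L * s) +
       ((- 2 * L) * exp (- 2 * L * s)) * ((X s - Y s) \<bullet> (X s - Y s))) (at s within {0..T})"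
      unfolding D_def .
    then show ?thesis unfolding D'_def by (simp add: algebra_simps)
  qed
  have neg: "D' s \<le> 0" if "s \<in> {0..T}" for s
  proof -
    have "(X s - Y s) \<bullet> (f (X s) - f (Y s)) \<le> norm (X s - Y s) * norm (f (X s) - f (Y s))"
      by (rule norm_cauchy_schwarz)
    also have "\<dots> \<le> norm (X s - Y s) * (L * norm (X s - Y s))"
      using lipschitz_onD[OF lip, of "X s" "Y s"] X(2) Y(2) that
      by (intro mult_left_mono) (auto simp: dist_norm image_subset_iff)
    also have "\<dots> = L * ((X s - Y s) \<bullet> (X s - Y s))"
      by (simp add: power2_norm_eq_inner[symmetric] power2_eq_square)
    finally show ?thesis unfolding D'_def
      by (intro mult_nonpos_nonneg) auto
  qed
  have "D t \<le> D 0"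
  proof (rule DERIV_nonpos_imp_decreasing_open[OF t(1)])
    fix x assume "0 < x" "x < t"
    then have "x \<in> {0<..<T}" using t by auto
    then have "(D has_real_derivative D' x) (at x)"
      using der[of x] by (simp add: at_within_Icc_at)
    then show "\<exists>y. DERIV D x :> y \<and> y \<le> 0" using neg[of x] \<open>x \<in> {0<..<T}\<close> by auto
  next
    have "continuous_on {0..T} D"
      using der by (meson DERIV_continuous continuous_on_eq_continuous_within)
    then show "continuous_on {0..t} D" by (rule continuous_on_subset) (use t in auto)
  qed
  then have "(norm (X t - Y t))\<^sup>2 * exp (- (2 * L * t)) \<le> (norm (X 0 - Y 0))\<^sup>2"
    by (simp add: D_def power2_norm_eq_inner)
  then have "(norm (X t - Y t))\<^sup>2 \<le> (exp (L * t) * norm (X 0 - Y 0))\<^sup>2"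
    by (simp add: power_mult_distrib exp_double[symmetric] exp_minus field_simps)
  then show ?thesis
    by (simp add: dist_norm power2_le_iff_abs_le)
qed

text \<open>Banach's fixed point theorem in the weighted norm \<open>sup exp (- 2 M \<bar>t\<bar>) \<bar>X t\<bar>\<close>; the
  even extension \<open>X \<bar>t\<bar>\<close> lets the forward solution live in the bounded continuous functions
  on the whole line.\<close>

lemma lipschitz_global_solution:
  fixes f :: "'a::euclidean_space \<Rightarrow> 'a"
  assumes "L-lipschitz_on UNIV f"
  shows "\<exists>X. X 0 = x0 \<and> (\<forall>t\<ge>0. (X has_vector_derivative f (X t)) (at t within {0..}))"
proof -
  \<comment> \<open>Positive even if \<open>L = 0\<close>; the estimates below divide by
    \<open>M\<close>.\<close>
  define M where "M = L + 1"
  have lip: "M-lipschitz_on UNIV f"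
    using assms by (rule lipschitz_on_mono) (auto simp: M_def)
  have M: "M > 0" using lipschitz_on_nonneg[OF assms] by (simp add: M_def)
  have contf: "continuous_on UNIV f" using lip by (rule lipschitz_on_continuous_on)
  define w where "w = (\<lambda>t::real. exp (2 * M * \<bar>t\<bar>))"
  have wpos: "w t > 0" for t by (simp add: w_def)
  have contw: "continuous_on S w" for S by (auto simp: w_def intro!: continuous_intros)
  \<comment> \<open>An element \<open>u\<close> of the function space stands for the curve
    \<open>w t *\<^sub>R u t\<close>, so that bounded \<open>u\<close> admits exponential growth at
    rate \<open>2 * M\<close>.\<close>
  define rhs where "rhs = (\<lambda>(u::real \<Rightarrow>\<^sub>C 'a) t. f (w t *\<^sub>R u t))"
  have contrhs: "continuous_on UNIV (rhs u)" for u
    unfolding rhs_def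
    by (intro continuous_on_compose2[OF contf] continuous_intros contw) auto
  have "\<exists>H. H 0 = 0 \<and> (\<forall>t. (H has_vector_derivative rhs u t) (at t))" for u
  proof -
    have "\<exists>F. \<forall>x::real. -\<infinity> < ereal x \<longrightarrow> ereal x < \<infinity> \<longrightarrow> (F has_vector_derivative rhs u x) (at x)"
      by (rule einterval_antiderivative)
        (use contrhs in \<open>auto simp: continuous_on_eq_continuous_at\<close>)
    then obtain F where F: "\<And>x::real. (F has_vector_derivative rhs u x) (at x)" by auto
    have "((\<lambda>t. F t - F 0) has_vector_derivative rhs u t) (at t)" for t
      using has_vector_derivative_diff[OF F has_vector_derivative_const] by simp
    then show ?thesis by (intro exI[of _ "\<lambda>t. F t - F 0"]) simp
  qed
  then obtain H where H0: "\<And>u. H u 0 = 0"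
    and H: "\<And>u t. (H u has_vector_derivative rhs u t) (at t)"
    by metis
  have contH: "continuous_on S (H u)" for S u
    by (rule continuous_at_imp_continuous_on) (use H has_vector_derivative_continuous in blast)
  \<comment> \<open>Integrating a bound \<open>c * w\<close> gains a division by
    \<open>2 * M\<close>. With \<open>c = norm (f 0) + M * B\<close> this bounds the image of
    \<open>u\<close>; with \<open>c = M * dist u v\<close> it yields the contraction factor 1/2,
    which is why the weight has exponent \<open>2 * M\<close>.\<close>
  have Hbound: "norm (h t) \<le> c * (w t - 1) / (2 * M)"
    if h: "\<And>s. (h has_vector_derivative h' s) (at s)" "h 0 = 0" "\<And>s. 0 \<le> s \<Longrightarrow> norm (h' s) \<le> c * w s" and t: "0 \<le> t"
    for h h' :: "real \<Rightarrow> 'a" and c t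
  proof (cases "t = 0")
    case False
    define \<phi> where "\<phi> = (\<lambda>s. c * exp (2 * M * s) / (2 * M))"
    have "norm (h t - h 0) \<le> \<phi> t - \<phi> 0"
    proof (rule differentiable_bound_general)
      show "0 < t" using False t by simp
      show "continuous_on {0..t} h"
        by (rule continuous_at_imp_continuous_on) (use h(1) has_vector_derivative_continuous in blast)
      show "continuous_on {0..t} \<phi>" unfolding \<phi>_def using M by (auto intro!: continuous_intros)
      fix s assume s: "0 < s" "s < t"
      show "(h has_vector_derivative h' s) (at s)" by (rule h)
      have "(\<phi> has_real_derivative c * exp (2 * M * s)) (at s)"
        unfolding \<phi>_def using M by (auto intro!: derivative_eq_intros simp: field_simps)
      then show "(\<phi> has_vector_derivative c * exp (2 * M * s)) (at s)"
        by (simp add: has_real_derivative_iff_has_vector_derivative)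
      show "norm (h' s) \<le> c * exp (2 * M * s)" using h(3)[of s] s by (simp add: w_def)
    qed
    then show ?thesis using h(2) t by (simp add: \<phi>_def w_def right_diff_distrib diff_divide_distrib)
  qed (use that in \<open>simp add: w_def\<close>)
  define op where "op = (\<lambda>u t. (x0 + H u \<bar>t\<bar>) /\<^sub>R w t)"
  have op_b: "op u \<in> bcontfun" for u
  proof -
    obtain B where B: "\<And>t. norm (u t) \<le> B"
      using bounded_apply_bcontfun[of u] unfolding bounded_iff by auto
    define c where "c = norm (f 0) + M * B"
    have B0: "B \<ge> 0" using B[of 0] norm_ge_zero order_trans by blast
    then have c0: "c \<ge> 0" using M by (simp add: c_def)
    have "norm (rhs u s) \<le> c * w s" if "0 \<le> s" for s
    proof -
      have "norm (rhs u s) \<le> norm (f 0) + dist (f (w s *\<^sub>R u s)) (f 0)"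
        unfolding rhs_def by norm
      also have "\<dots> \<le> norm (f 0) + M * dist (w s *\<^sub>R u s) 0"
        using lipschitz_onD[OF lip, of "w s *\<^sub>R u s" 0] by simp
      also have "\<dots> \<le> norm (f 0) * w s + M * (w s * B)"
        using M B wpos[of s] that B0 by (intro add_mono mult_left_mono) (auto simp: w_def mult_le_cancel_left1)
      finally show ?thesis by (simp add: c_def algebra_simps)
    qed
    then have Hb: "norm (H u t) \<le> c * (w t - 1) / (2 * M)" if "0 \<le> t" for t
      using Hbound[OF H H0 _ that] by blast
    have "norm (op u t) \<le> norm x0 + c / (2 * M)" for t
    proof -
      have w1: "1 \<le> w t" using M by (simp add: w_def)
      have "norm (x0 + H u \<bar>t\<bar>) \<le> norm x0 + c * (w t - 1) / (2 * M)"
        using Hb[of "\<bar>t\<bar>"] norm_triangle_ineq[of x0 "H u \<bar>t\<bar>"] by (auto simp: w_def)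
      also have "\<dots> \<le> norm x0 * w t + c * w t / (2 * M)"
        using w1 c0 M by (intro add_mono divide_right_mono mult_left_mono) (auto simp: mult_left_le mult_le_cancel_left1)
      finally have "norm (x0 + H u \<bar>t\<bar>) / w t \<le> norm x0 + c / (2 * M)"
        using wpos[of t] by (simp add: pos_divide_le_eq distrib_right)
      moreover have "norm (op u t) = norm (x0 + H u \<bar>t\<bar>) / w t"
        unfolding op_def norm_scaleR using wpos[of t] by (simp only: abs_inverse abs_of_pos divide_inverse_commute)
      ultimately show ?thesis by simp
    qed
    then have "bounded (range (op u))" unfolding bounded_iff by auto
    moreover have "continuous_on UNIV (op u)"
      unfolding op_def
      by (intro continuous_intros contw continuous_on_compose2[OF contH[of UNIV]]) (use wpos in \<open>auto simp: less_le\<close>)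
    ultimately show ?thesis by (simp add: bcontfun_def)
  qed
  define \<Phi> where "\<Phi> = (\<lambda>u. Bcontfun (op u))"
  have \<Phi>: "apply_bcontfun (\<Phi> u) = op u" for u
    using op_b by (simp add: \<Phi>_def Bcontfun_inverse)
  have "\<exists>!u. \<Phi> u = u"
  proof (rule banach_fix_type[of "1/2"])
    show "\<forall>u v. dist (\<Phi> u) (\<Phi> v) \<le> 1 / 2 * dist u v"
    proof (intro allI dist_bound)
      fix u v :: "real \<Rightarrow>\<^sub>C 'a" and t :: real
      have "norm (rhs u s - rhs v s) \<le> (M * dist u v) * w s" if "0 \<le> s" for s
      proof -
        have "norm (rhs u s - rhs v s) \<le> M * dist (w s *\<^sub>R u s) (w s *\<^sub>R v s)"
          using lipschitz_onD[OF lip] by (auto simp: rhs_def dist_norm)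
        also have "dist (w s *\<^sub>R u s) (w s *\<^sub>R v s) = w s * dist (u s) (v s)"
          using wpos[of s] by (simp add: dist_norm scaleR_right_diff_distrib[symmetric])
        also have "M * \<dots> \<le> M * (w s * dist u v)"
          using M wpos[of s] dist_bounded[of u s v] by (intro mult_left_mono) auto
        finally show ?thesis by (simp add: algebra_simps)
      qed
      then have "norm (H u \<bar>t\<bar> - H v \<bar>t\<bar>) \<le> (M * dist u v) * (w \<bar>t\<bar> - 1) / (2 * M)"
        by (intro Hbound[where h = "\<lambda>s. H u s - H v s" and h' = "\<lambda>s. rhs u s - rhs v s"])
          (use H0 H in \<open>simp_all add: has_vector_derivative_diff\<close>)
      also have "\<dots> \<le> 1/2 * dist u v * w t"
        using M by (simp add: w_def field_simps)
      finally have "norm (H u \<bar>t\<bar> - H v \<bar>t\<bar>) / w t \<le> 1/2 * dist u v"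
        using wpos[of t] by (simp add: field_simps)
      moreover have "\<Phi> u t - \<Phi> v t = (H u \<bar>t\<bar> - H v \<bar>t\<bar>) /\<^sub>R w t"
        unfolding \<Phi> op_def scaleR_right_diff_distrib[symmetric] by simp
      then have "dist (\<Phi> u t) (\<Phi> v t) = norm (H u \<bar>t\<bar> - H v \<bar>t\<bar>) / w t"
        using wpos[of t] unfolding dist_norm by (simp add: divide_inverse_commute)
      ultimately show "dist (\<Phi> u t) (\<Phi> v t) \<le> 1 / 2 * dist u v" by simp
    qed
  qed auto
  then obtain u where u: "\<Phi> u = u" by (elim ex1E)
  define X where "X = (\<lambda>t. x0 + H u t)"
  have Xu: "X t = w t *\<^sub>R u t" if "0 \<le> t" for t
  proof -
    have "u t = op u t" using \<Phi>[of u] unfolding u by (rule fun_cong)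
    then show ?thesis using that wpos[of t] by (simp add: X_def op_def)
  qed
  have "(X has_vector_derivative f (X t)) (at t within {0..})" if "0 \<le> t" for t
  proof -
    have "(X has_vector_derivative rhs u t) (at t)"
      unfolding X_def using has_vector_derivative_add[OF has_vector_derivative_const[of x0] H[of u t]] by simp
    then have "(X has_vector_derivative f (X t)) (at t)" using Xu[OF that] by (simp add: rhs_def)
    then show ?thesis by (rule has_vector_derivative_at_within)
  qed
  moreover have "X 0 = x0" by (simp add: X_def H0)
  ultimately show ?thesis by (intro exI[of _ X]) simp
qed

section \<open>Global forward solutions of the system\<close>

lemma power2_sum3_le: "((a::real) - b - c)\<^sup>2 \<le> 3 * (a\<^sup>2 + b\<^sup>2 + c\<^sup>2)"
proof -
  have "0 \<le> (a + b)\<^sup>2 + (a + c)\<^sup>2 + (b - c)\<^sup>2" by simp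
  then show ?thesis by (simp add: power2_eq_square algebra_simps)
qed

text \<open>At the last time before a violation at which the value is at most \<open>c\<close>, it
  equals \<open>c\<close>, and the negative right derivative pushes it below \<open>c\<close> again
  just afterwards. The derivative is asked for only where the level is attained, so nothing has to
  be known about the dynamics above it.\<close>

lemma stays_below_level:
  fixes \<phi> :: "real \<Rightarrow> real"
  assumes cont: "continuous_on {0..} \<phi>" and init: "\<phi> 0 \<le> c"
    and der: "\<And>t. 0 \<le> t \<Longrightarrow> \<phi> t = c \<Longrightarrow> \<exists>l<0. (\<phi> has_real_derivative l) (at t within {0..})"
    and t: "0 \<le> t"
  shows "\<phi> t \<le> c"
proof (rule ccontr)
  assume "\<not> \<phi> t \<le> c"
  define A where "A = {s \<in> {0..t}. \<phi> s \<le> c}"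
  have "closed A"
    unfolding A_def
    by (intro closed_Collect_le continuous_closed_preimage_constant continuous_on_closed_Collect_le
        continuous_intros continuous_on_subset[OF cont]) auto
  moreover have "0 \<in> A" using init t by (simp add: A_def)
  moreover have "bdd_above A" by (auto simp: A_def intro!: bdd_aboveI[of _ t])
  ultimately have s: "Sup A \<in> A" by (intro closed_contains_Sup) auto
  define s where "s = Sup A"
  have sA: "0 \<le> s" "s < t" "\<phi> s \<le> c"
    using s \<open>\<not> \<phi> t \<le> c\<close> by (auto simp: A_def s_def less_le)
  have above: "\<phi> r > c" if "s < r" "r \<le> t" for r
    using that sA cSup_upper[OF _ \<open>bdd_above A\<close>, of r] by (force simp: A_def s_def)
  have "\<phi> s = c"
  proof (rule ccontr)
    assume "\<phi> s \<noteq> c"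
    then have "\<phi> s < c" using sA by simp
    have "continuous_on {s..t} \<phi>" by (rule continuous_on_subset[OF cont]) (use sA in auto)
    then obtain r where "s \<le> r" "r \<le> t" "\<phi> r = c"
      using IVT'[of \<phi> s c t] \<open>\<phi> s < c\<close> \<open>\<not> \<phi> t \<le> c\<close> sA by auto
    then show False using above[of r] \<open>\<phi> s < c\<close> by (cases "r = s") auto
  qed
  then obtain l where "l < 0" "(\<phi> has_real_derivative l) (at s within {0..})"
    using der sA by blast
  then obtain d where d: "d > 0" "\<And>h. h > 0 \<Longrightarrow> s + h \<in> {0..} \<Longrightarrow> h < d \<Longrightarrow> \<phi> s > \<phi> (s + h)"
    using has_real_derivative_neg_dec_right by blast
  define h where "h = min (d / 2) (t - s)"
  have "h > 0" "h < d" "s + h \<le> t" using d(1) sA by (auto simp: h_def)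
  then show False using d(2)[of h] above[of "s + h"] sA \<open>\<phi> s = c\<close> by auto
qed

locale lienard =
  fixes \<mu> \<epsilon> :: real
  assumes eps: "\<epsilon> > 0" and mu: "\<mu> \<ge> 0"
begin

abbreviation field :: "real \<times> real \<Rightarrow> real \<times> real" where
  "field \<equiv> system_field \<mu> 0 \<epsilon>"

definition F :: "real \<Rightarrow> real" where
  "F x = x^5 / 5 - x^3 / 3 - \<mu> * x"

definition lz :: "real \<times> real \<Rightarrow> real" where
  "lz q = snd q + F (fst q)"

lemma field_eq: "field q = (snd q, (\<mu> + (fst q)^2 - (fst q)^4) * snd q - \<epsilon> * (fst q)^3)"
  by (simp add: system_field_def case_prod_beta)

lemma field_minus: "field (- q) = - field q"
  by (simp add: field_eq algebra_simps)

lemma F_0 [simp]: "F 0 = 0"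
  by (simp add: F_def)

lemma has_real_derivative_F:
  "(F has_real_derivative x^4 - x^2 - \<mu>) (at x within S)"
  unfolding F_def by (auto intro!: derivative_eq_intros simp: field_simps)

lemma continuous_F: "continuous_on S F"
  unfolding F_def by (intro continuous_intros) auto

lemma field_components:
  assumes "(X has_vector_derivative field (X t)) (at t within S)"
  shows "((\<lambda>s. fst (X s)) has_real_derivative snd (X t)) (at t within S)"
    and "((\<lambda>s. snd (X s)) has_real_derivative
       (\<mu> + (fst (X t))^2 - (fst (X t))^4) * snd (X t) - \<epsilon> * (fst (X t))^3) (at t within S)"
    and "((\<lambda>s. lz (X s)) has_real_derivative - \<epsilon> * (fst (X t))^3) (at t within S)"
proof -
  have "((\<lambda>s. fst (X s)) has_vector_derivative fst (field (X t))) (at t within S)"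
    using bounded_linear.has_vector_derivative[OF bounded_linear_fst assms] .
  then show 1: "((\<lambda>s. fst (X s)) has_real_derivative snd (X t)) (at t within S)"
    by (simp add: field_eq has_real_derivative_iff_has_vector_derivative)
  have "((\<lambda>s. snd (X s)) has_vector_derivative snd (field (X t))) (at t within S)"
    using bounded_linear.has_vector_derivative[OF bounded_linear_snd assms] .
  then show 2: "((\<lambda>s. snd (X s)) has_real_derivative
       (\<mu> + (fst (X t))^2 - (fst (X t))^4) * snd (X t) - \<epsilon> * (fst (X t))^3) (at t within S)"
    by (simp add: field_eq has_real_derivative_iff_has_vector_derivative)
  show "((\<lambda>s. lz (X s)) has_real_derivative - \<epsilon> * (fst (X t))^3) (at t within S)"
    unfolding lz_def
    by (rule DERIV_cong[OF DERIV_add[OF 2 DERIV_chain2[OF has_real_derivative_F 1]]])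
      (simp add: algebra_simps)
qed

lemma lipschitz_field_cball: "\<exists>L. L-lipschitz_on (cball 0 R) field"
proof (cases "R \<ge> 0")
  case True
  define D where "D = (\<lambda>(q::real\<times>real) (h::real\<times>real). (snd h,
     (\<mu> + (fst q)^2 - (fst q)^4) * snd h + (2 * fst q - 4 * (fst q)^3) * fst h * snd q - 3 * \<epsilon> * (fst q)^2 * fst h))"
  \<comment> \<open>Bounds the Jacobian \<open>D q\<close> entry by entry from
    \<open>\<bar>x\<bar> \<le> R\<close> and \<open>\<bar>y\<bar> \<le> R\<close>; the mean value
    inequality on the convex ball turns it into a Lipschitz constant.\<close>
  define B where "B = 1 + (\<mu> + R^2 + R^4) + (2 * R + 4 * R^3) * R + 3 * \<epsilon> * R^2"
  have B: "B \<ge> 0" using True eps mu by (simp add: B_def)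
  have der: "(field has_derivative D q) (at q within cball 0 R)" for q
  proof -
    have "((\<lambda>q. (snd q, (\<mu> + (fst q)^2 - (fst q)^4) * snd q - \<epsilon> * (fst q)^3)) has_derivative D q) (at q within cball 0 R)"
      unfolding D_def
      by (rule has_derivative_eq_rhs, (rule derivative_intros)+) (simp add: fun_eq_iff field_simps)
    then show ?thesis unfolding field_eq[abs_def] .
  qed
  have on: "onorm (D q) \<le> B" if "q \<in> cball 0 R" for q
  proof (rule onorm_bound[OF B])
    fix h :: "real \<times> real"
    have q: "\<bar>fst q\<bar> \<le> R" "\<bar>snd q\<bar> \<le> R"
      using that norm_fst_le[of "fst q" "snd q"] norm_snd_le[of "snd q" "fst q"] by auto
    have h: "\<bar>fst h\<bar> \<le> norm h" "\<bar>snd h\<bar> \<le> norm h"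
      using norm_fst_le[of "fst h" "snd h"] norm_snd_le[of "snd h" "fst h"] by auto
    have pw: "\<bar>fst q\<bar>^n \<le> R^n" for n using q by (intro power_mono) auto
    have 1: "\<bar>\<mu> + (fst q)^2 - (fst q)^4\<bar> \<le> \<mu> + R^2 + R^4"
    proof -
      have "(fst q)^2 \<le> R^2" "(fst q)^4 \<le> R^4" "0 \<le> (fst q)^2" "0 \<le> (fst q)^4" "0 \<le> R^2" "0 \<le> R^4"
        using pw[of 2] pw[of 4] by simp_all
      then show ?thesis using mu unfolding abs_le_iff by linarith
    qed
    have 2: "\<bar>2 * fst q - 4 * (fst q)^3\<bar> \<le> 2 * R + 4 * R^3"
      using pw[of 3] q(1) unfolding power_abs[symmetric] by linarith
    have "norm (D q h) \<le> \<bar>snd h\<bar> + \<bar>(\<mu> + (fst q)^2 - (fst q)^4) * snd h + (2 * fst q - 4 * (fst q)^3) * fst h * snd q - 3 * \<epsilon> * (fst q)^2 * fst h\<bar>"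
      unfolding D_def by (rule order_trans[OF norm_Pair_le]) simp
    also have "\<dots> \<le> \<bar>snd h\<bar> + (\<bar>\<mu> + (fst q)^2 - (fst q)^4\<bar> * \<bar>snd h\<bar> + \<bar>2 * fst q - 4 * (fst q)^3\<bar> * \<bar>snd q\<bar> * \<bar>fst h\<bar> + 3 * \<epsilon> * \<bar>fst q\<bar>^2 * \<bar>fst h\<bar>)"
    proof -
      have tri: "\<bar>a + b - c\<bar> \<le> \<bar>a\<bar> + \<bar>b\<bar> + \<bar>c\<bar>" for a b c :: real by linarith
      show ?thesis
        using tri[of "(\<mu> + (fst q)^2 - (fst q)^4) * snd h" "(2 * fst q - 4 * (fst q)^3) * fst h * snd q" "3 * \<epsilon> * (fst q)^2 * fst h"]
          eps by (simp add: abs_mult mult_ac)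
    qed
    also have "\<dots> \<le> norm h + ((\<mu> + R^2 + R^4) * norm h + (2 * R + 4 * R^3) * R * norm h + 3 * \<epsilon> * R^2 * norm h)"
      using h q 1 2 pw[of 2] eps mu True by (intro add_mono mult_mono) auto
    also have "\<dots> = B * norm h" by (simp add: B_def algebra_simps)
    finally show "norm (D q h) \<le> B * norm h" .
  qed
  have "B-lipschitz_on (cball 0 R) field"
    using differentiable_bound[OF convex_cball der on] B
    by (intro lipschitz_onI) (auto simp: dist_norm)
  then show ?thesis by (intro exI)
next
  case False
  then have "0-lipschitz_on (cball 0 R) field" by (intro lipschitz_onI) auto
  then show ?thesis by (intro exI)
qed

text \<open>The cross term makes the derivative of the energy \<open>z\<^sup>2 / 2 + \<epsilon> x\<^sup>4 / 4\<close>
  negative also far out along the line \<open>x = 0\<close>, where the energy alone is stationary.\<close>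

definition V :: "real \<times> real \<Rightarrow> real" where
  "V q = (lz q)\<^sup>2 / 2 + \<epsilon> * (fst q)^4 / 4 - \<epsilon> * arctan (fst q) * lz q"

definition V' :: "real \<times> real \<Rightarrow> real" where
  "V' q = - \<epsilon> * (fst q)^3 * F (fst q) - \<epsilon> * snd q * lz q / (1 + (fst q)\<^sup>2)
      + \<epsilon>\<^sup>2 * arctan (fst q) * (fst q)^3"

lemma has_real_derivative_V:
  assumes "(X has_vector_derivative field (X t)) (at t within S)"
  shows "((\<lambda>s. V (X s)) has_real_derivative V' (X t)) (at t within S)"
proof -
  note c = field_components[OF assms]
  have p: "1 + (fst (X t))\<^sup>2 \<noteq> 0" by (metis add_pos_nonneg less_numeral_extra(1) order_less_irrefl zero_le_power2)
  have "((\<lambda>s. V (X s)) has_real_derivative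
     (lz (X t) * (- \<epsilon> * (fst (X t))^3) + \<epsilon> * (fst (X t))^3 * snd (X t)
      - \<epsilon> * (inverse (1 + (fst (X t))\<^sup>2) * snd (X t) * lz (X t) + arctan (fst (X t)) * (- \<epsilon> * (fst (X t))^3)))) (at t within S)"
    unfolding V_def
    by (auto intro!: derivative_eq_intros c simp: algebra_simps)
  moreover have "snd (X t) = lz (X t) - F (fst (X t))" by (simp add: lz_def)
  ultimately show ?thesis
    unfolding V'_def
    unfolding \<open>snd (X t) = _\<close>
    by (elim DERIV_cong) (simp add: algebra_simps power2_eq_square power3_eq_cube divide_inverse)
qed

text \<open>With \<open>y = z - F x\<close>, the cross term yields \<open>- z^2 / 2\<close> at the
  price of \<open>(F x)^2 / 2\<close>, both divided by \<open>1 + x^2\<close>. Writing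
  \<open>F x = x * k\<close>, that price is at most \<open>k^2 / 2\<close>, whose eighth-order part
  is smaller than that of \<open>x^3 * F x\<close>. Since \<open>arctan\<close> is bounded, the last
  term of \<open>V'\<close> stays of order \<open>x^4\<close>.\<close>

lemma V'_bound: "V' q \<le> \<epsilon> * (- (lz q)\<^sup>2 / (2 * (1 + (fst q)\<^sup>2)) - (fst q)^8 / 20 + (3 * \<mu>\<^sup>2 / 2 + 2 * \<epsilon> + 25 * (1 + \<mu> + 2 * \<epsilon>)^2 * 4))"
proof -
  define x z s k where "x = fst q" "z = lz q" "s = x\<^sup>2" "k = s\<^sup>2 / 5 - s / 3 - \<mu>"
  have s0: "s \<ge> 0" by (simp add: x_z_s_k_def)
  have y: "snd q = z - F x" by (simp add: x_z_s_k_def lz_def)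
  have Fk: "F x = x * k" by (simp add: x_z_s_k_def F_def algebra_simps power2_eq_square power3_eq_cube numeral_eq_Suc)
  have "- (snd q * z) \<le> (F x)\<^sup>2 / 2 - z\<^sup>2 / 2"
  proof -
    have "0 \<le> (z - F x)\<^sup>2" by simp
    then show ?thesis by (simp add: y power2_eq_square algebra_simps)
  qed
  then have "- (snd q * z) / (1 + s) \<le> ((F x)\<^sup>2 / 2 - z\<^sup>2 / 2) / (1 + s)"
    using s0 by (intro divide_right_mono) auto
  also have "\<dots> = (F x)\<^sup>2 / (2 * (1 + s)) - z\<^sup>2 / (2 * (1 + s))"
    by (simp add: diff_divide_distrib)
  also have "(F x)\<^sup>2 / (2 * (1 + s)) \<le> k\<^sup>2 / 2"
  proof -
    have "(F x)\<^sup>2 = s * k\<^sup>2" unfolding Fk power_mult_distrib by (simp add: x_z_s_k_def(3))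
    also have "\<dots> \<le> (1 + s) * k\<^sup>2" by (simp add: distrib_right)
    finally show ?thesis using s0 by (simp add: field_simps)
  qed
  finally have a: "- (snd q * z) / (1 + s) \<le> k\<^sup>2 / 2 - z\<^sup>2 / (2 * (1 + s))" by simp
  have b: "x^3 * F x = s\<^sup>2 * k" unfolding Fk x_z_s_k_def(3) by (simp add: power2_eq_square power3_eq_cube)
  have c: "arctan x * x^3 \<le> 2 * (1 + s\<^sup>2)"
  proof -
    have "\<bar>arctan x\<bar> \<le> 2" using arctan_bounded[of x] pi_less_4 by (auto simp: abs_le_iff)
    moreover have "\<bar>x^3\<bar> \<le> 1 + s\<^sup>2"
    proof (cases "\<bar>x\<bar> \<le> 1")
      case True
      then show ?thesis using power_le_one[of "\<bar>x\<bar>" 3] by (simp add: power_abs add_increasing2)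
    next
      case False
      then have "\<bar>x\<bar>^3 \<le> \<bar>x\<bar>^4" by (intro power_increasing) auto
      then show ?thesis by (simp add: x_z_s_k_def power_abs)
    qed
    ultimately have "\<bar>arctan x\<bar> * \<bar>x^3\<bar> \<le> 2 * (1 + s\<^sup>2)" by (intro mult_mono) auto
    then show ?thesis by (metis abs_ge_self abs_mult order_trans)
  qed
  \<comment> \<open>Of the leading \<open>s^4 / 5\<close>, the estimates below use up
    \<open>3/50 + 1/50 + 1/100\<close>, which leaves more than the claimed \<open>s^4 / 20\<close>.
    The lower powers of \<open>s\<close> are absorbed by completing squares, at the cost of the
    constant.\<close>
  have d: "k\<^sup>2 / 2 - s\<^sup>2 * k + \<epsilon> * (2 * (1 + s\<^sup>2)) \<le> - (s^4) / 20 + (3 * \<mu>\<^sup>2 / 2 + 2 * \<epsilon> + 25 * (1 + \<mu> + 2 * \<epsilon>)^2 * 4)"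
  proof -
    have "k\<^sup>2 \<le> 3 * ((s\<^sup>2 / 5)\<^sup>2 + (s / 3)\<^sup>2 + \<mu>\<^sup>2)"
      unfolding x_z_s_k_def(4) by (rule power2_sum3_le)
    then have k2: "k\<^sup>2 / 2 \<le> 3 / 50 * s^4 + s\<^sup>2 / 6 + 3 * \<mu>\<^sup>2 / 2"
      by (simp add: power_divide power2_eq_square algebra_simps numeral_eq_Suc)
    have sk: "s\<^sup>2 * k = s^4 / 5 - s^3 / 3 - \<mu> * s\<^sup>2"
      by (simp add: x_z_s_k_def(4) algebra_simps power2_eq_square power3_eq_cube numeral_eq_Suc)
    have "0 \<le> s\<^sup>2 * (3 * s - 25)\<^sup>2" by simp
    then have s3: "s^3 / 3 \<le> s^4 / 50 + 25 / 18 * s\<^sup>2"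
      by (simp add: algebra_simps power2_eq_square power3_eq_cube numeral_eq_Suc)
    define m where "m = 2 * (1 + \<mu> + 2 * \<epsilon>)"
    have "(1 / 6 + \<mu> + 2 * \<epsilon> + 25 / 18) * s\<^sup>2 \<le> m * s\<^sup>2"
      using mu eps by (intro mult_right_mono) (auto simp: m_def)
    also have "m * s\<^sup>2 \<le> s^4 / 100 + 25 * m\<^sup>2"
    proof -
      have "0 \<le> (s\<^sup>2 - 50 * m)\<^sup>2" by simp
      then show ?thesis by (simp add: algebra_simps power2_eq_square numeral_eq_Suc)
    qed
    finally have "(1 / 6 + \<mu> + 2 * \<epsilon> + 25 / 18) * s\<^sup>2 \<le> s^4 / 100 + 25 * (1 + \<mu> + 2 * \<epsilon>)\<^sup>2 * 4"
      unfolding m_def power_mult_distrib by simp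
    moreover have "0 \<le> s^4" by simp
    moreover have "(1 / 6 + \<mu> + 2 * \<epsilon> + 25 / 18) * s\<^sup>2 = s\<^sup>2 / 6 + \<mu> * s\<^sup>2 + 2 * (\<epsilon> * s\<^sup>2) + 25 / 18 * s\<^sup>2"
      "\<epsilon> * (2 * (1 + s\<^sup>2)) = 2 * \<epsilon> + 2 * (\<epsilon> * s\<^sup>2)"
      by (simp_all add: algebra_simps)
    ultimately show ?thesis using k2 s3 unfolding sk minus_divide_left[symmetric] by linarith
  qed
  have "V' q = \<epsilon> * (- (snd q * z) / (1 + s) - x^3 * F x + \<epsilon> * (arctan x * x^3))"
    by (simp add: V'_def x_z_s_k_def power2_eq_square algebra_simps)
  also have "\<dots> \<le> \<epsilon> * ((k\<^sup>2 / 2 - z\<^sup>2 / (2 * (1 + s))) - s\<^sup>2 * k + \<epsilon> * (2 * (1 + s\<^sup>2)))"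
    using a c eps unfolding b by (intro mult_left_mono add_mono diff_mono) auto
  also have "\<dots> \<le> \<epsilon> * (- z\<^sup>2 / (2 * (1 + s)) - s^4 / 20 + (3 * \<mu>\<^sup>2 / 2 + 2 * \<epsilon> + 25 * (1 + \<mu> + 2 * \<epsilon>)^2 * 4))"
    using d eps by (intro mult_left_mono) auto
  finally show ?thesis
    by (simp add: x_z_s_k_def power_mult[symmetric])
qed

text \<open>By contraposition: \<open>V' q \<ge> 0\<close> first caps \<open>x\<close> through
  \<open>x^8 \<le> 20 * c\<close>, and then \<open>z\<close>, because the weight
  \<open>1 / (1 + x^2)\<close> is now bounded below. On the resulting set \<open>V\<close> is
  bounded.\<close>

lemma V'_neg: "\<exists>C. \<forall>q. V q \<ge> C \<longrightarrow> V' q < 0"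
proof -
  define c where "c = 3 * \<mu>\<^sup>2 / 2 + 2 * \<epsilon> + 25 * (1 + \<mu> + 2 * \<epsilon>)^2 * 4"
  have "2 * \<epsilon> > 0" "3 * \<mu>\<^sup>2 / 2 \<ge> 0" "25 * (1 + \<mu> + 2 * \<epsilon>)^2 * 4 \<ge> 0" using eps by auto
  then have c0: "c > 0" unfolding c_def by linarith
  define S where "S = 20 * c + 1"
  define Z where "Z = 2 * (1 + S) * c"
  have S1: "S \<ge> 1" using c0 by (simp add: S_def)
  have "V q < Z / 2 + \<epsilon> * S\<^sup>2 / 4 + 2 * \<epsilon> * (1 + Z) + 1" if "\<not> V' q < 0" for q
  proof -
    define x z where "x = fst q" "z = lz q"
    have "0 \<le> \<epsilon> * (- z\<^sup>2 / (2 * (1 + x\<^sup>2)) - x^8 / 20 + c)"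
      using V'_bound[of q] that by (simp add: c_def x_z_def)
    then have "0 \<le> - z\<^sup>2 / (2 * (1 + x\<^sup>2)) - x^8 / 20 + c"
      using eps by (simp add: zero_le_mult_iff)
    moreover have "z\<^sup>2 / (2 * (1 + x\<^sup>2)) \<ge> 0" by (intro divide_nonneg_nonneg) auto
    moreover have "x^8 \<ge> 0" by simp
    ultimately have x8: "x^8 \<le> 20 * c" and zz: "z\<^sup>2 / (2 * (1 + x\<^sup>2)) \<le> c"
      unfolding minus_divide_left[symmetric] by linarith+
    have xS: "x\<^sup>2 \<le> S"
    proof (rule ccontr)
      assume "\<not> x\<^sup>2 \<le> S"
      then have "x\<^sup>2 > S" by simp
      then have "(x\<^sup>2)^1 \<le> (x\<^sup>2)^4" using S1 by (intro power_increasing) auto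
      then have "x\<^sup>2 \<le> x^8" by (simp add: power_mult[symmetric])
      then show False using x8 \<open>x\<^sup>2 > S\<close> by (simp add: S_def)
    qed
    have "1 + x\<^sup>2 > 0" by (simp add: add_pos_nonneg)
    then have "z\<^sup>2 \<le> c * (2 * (1 + x\<^sup>2))" using zz by (simp add: pos_divide_le_eq)
    also have "\<dots> \<le> c * (2 * (1 + S))" using xS c0 by (intro mult_left_mono) auto
    finally have zZ: "z\<^sup>2 \<le> Z" by (simp add: Z_def algebra_simps)
    have "x^4 = (x\<^sup>2)\<^sup>2" by (simp add: power_mult[symmetric])
    also have "\<dots> \<le> S\<^sup>2" using xS by (intro power_mono) auto
    finally have "\<epsilon> * x^4 / 4 \<le> \<epsilon> * S\<^sup>2 / 4" using eps by simp
    moreover have "- (arctan x * z) \<le> 2 * (1 + Z)"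
    proof -
      have "\<bar>arctan x\<bar> \<le> 2" using arctan_bounded[of x] pi_less_4 by (auto simp: abs_le_iff)
      moreover have "\<bar>z\<bar> \<le> 1 + Z"
      proof -
        have "0 \<le> (\<bar>z\<bar> - 1)\<^sup>2" by simp
        then have "2 * \<bar>z\<bar> \<le> 1 + z\<^sup>2" by (simp add: power2_eq_square algebra_simps)
        then show ?thesis using zZ zero_le_power2[of z] by linarith
      qed
      ultimately have "\<bar>arctan x\<bar> * \<bar>z\<bar> \<le> 2 * (1 + Z)" by (intro mult_mono) auto
      then show ?thesis by (metis abs_ge_minus_self abs_mult order_trans)
    qed
    then have "\<epsilon> * - (arctan x * z) \<le> \<epsilon> * (2 * (1 + Z))" using eps by (intro mult_left_mono) auto
    ultimately show ?thesis using zZ unfolding V_def x_z_def[symmetric] by (simp add: algebra_simps)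
  qed
  then show ?thesis by (meson not_le)
qed

lemma continuous_V: "continuous_on S V"
  unfolding V_def lz_def
  by (intro continuous_intros continuous_on_compose2[OF continuous_F[of UNIV]]) auto

text \<open>The cross term is at most linear in \<open>z\<close> and is absorbed by \<open>2 *
  \<epsilon> * \<bar>z\<bar> \<le> z^2 / 4 + 4 * \<epsilon>^2\<close>. What is left of
  \<open>V\<close> bounds \<open>x\<close> and \<open>z\<close>, and then
  \<open>y = z - F x\<close>.\<close>

lemma V_coercive: "\<exists>R. \<forall>q. V q \<le> c \<longrightarrow> norm q < R"
proof -
  define d where "d = 4 * (c + 4 * \<epsilon>\<^sup>2)"
  define A where "A = 1 + d / \<epsilon>"
  have "norm q < A + (1 + d + (A^5 / 5 + A^3 / 3 + \<mu> * A)) + 1" if "V q \<le> c" for q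
  proof -
    define x z where "x = fst q" "z = lz q"
    have "\<bar>arctan x\<bar> * \<bar>z\<bar> \<le> 2 * \<bar>z\<bar>"
      using arctan_bounded[of x] pi_less_4 by (intro mult_right_mono) (auto simp: abs_le_iff)
    then have "arctan x * z \<le> 2 * \<bar>z\<bar>" by (metis abs_ge_self abs_mult order_trans)
    then have "\<epsilon> * (arctan x * z) \<le> \<epsilon> * (2 * \<bar>z\<bar>)" using eps by (intro mult_left_mono) auto
    moreover have "0 \<le> (\<bar>z\<bar> - 4 * \<epsilon>)\<^sup>2" by simp
    then have "\<epsilon> * (2 * \<bar>z\<bar>) \<le> z\<^sup>2 / 4 + 4 * \<epsilon>\<^sup>2" by (simp add: power2_eq_square algebra_simps)
    ultimately have "z\<^sup>2 / 4 + \<epsilon> * x^4 / 4 \<le> c + 4 * \<epsilon>\<^sup>2"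
      using that unfolding V_def x_z_def[symmetric] by (simp add: mult.assoc)
    then have e: "z\<^sup>2 + \<epsilon> * x^4 \<le> d" by (simp add: d_def)
    have x4: "\<epsilon> * x^4 \<ge> 0" using eps by simp
    have d0: "d \<ge> 0" using e x4 by (smt (verit) zero_le_power2)
    then have A1: "A \<ge> 1" using eps by (simp add: A_def)
    have "x^4 \<le> d / \<epsilon>" using e eps by (simp add: pos_le_divide_eq mult.commute) (smt (verit) zero_le_power2)
    have xA: "\<bar>x\<bar> \<le> A"
    proof (rule ccontr)
      assume "\<not> \<bar>x\<bar> \<le> A"
      then have "\<bar>x\<bar> > A" by simp
      then have "\<bar>x\<bar>^1 \<le> \<bar>x\<bar>^4" using A1 by (intro power_increasing) auto
      then have "\<bar>x\<bar> \<le> x^4" by (simp add: power_abs)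
      then show False using \<open>x^4 \<le> d / \<epsilon>\<close> \<open>\<bar>x\<bar> > A\<close> by (simp add: A_def)
    qed
    have zB: "\<bar>z\<bar> \<le> 1 + d"
    proof -
      have "0 \<le> (\<bar>z\<bar> - 1)\<^sup>2" by simp
      then have "2 * \<bar>z\<bar> \<le> 1 + z\<^sup>2" by (simp add: power2_eq_square algebra_simps)
      then show ?thesis using e x4 d0 by linarith
    qed
    have pw: "\<bar>x\<bar>^n \<le> A^n" for n using xA by (intro power_mono) auto
    have "\<bar>F x\<bar> \<le> \<bar>x\<bar>^5 / 5 + \<bar>x\<bar>^3 / 3 + \<mu> * \<bar>x\<bar>"
    proof -
      have "\<bar>a - b - c\<bar> \<le> \<bar>a\<bar> + \<bar>b\<bar> + \<bar>c\<bar>" for a b c :: real by linarith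
      from this[of "x^5 / 5" "x^3 / 3" "\<mu> * x"] show ?thesis
        using mu by (simp add: F_def abs_mult power_abs)
    qed
    also have "\<dots> \<le> A^5 / 5 + A^3 / 3 + \<mu> * A"
      using pw[of 5] pw[of 3] xA mu by (intro add_mono mult_left_mono) auto
    finally have "\<bar>snd q\<bar> \<le> 1 + d + (A^5 / 5 + A^3 / 3 + \<mu> * A)"
      using zB by (auto simp: x_z_def lz_def)
    moreover have "norm q \<le> \<bar>x\<bar> + \<bar>snd q\<bar>"
      unfolding x_z_def using norm_Pair_le[of "fst q" "snd q"] by simp
    ultimately show ?thesis using xA by linarith
  qed
  then show ?thesis by (intro exI) blast
qed

text \<open>Sublevel sets of \<open>V\<close> from level \<open>C\<close> upwards are forward
  invariant. As \<open>f\<close> has to agree with \<open>field\<close> only on the sublevel set,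
  this covers the system itself and also its truncation to a ball, whose solutions thereby turn out
  to solve the system.\<close>

lemma V_stays_below:
  obtains C where "\<And>c f X t. C \<le> c \<Longrightarrow> (\<And>t. 0 \<le> t \<Longrightarrow> (X has_vector_derivative f (X t)) (at t within {0..})) \<Longrightarrow>
    (\<And>q. V q \<le> c \<Longrightarrow> f q = field q) \<Longrightarrow> V (X 0) \<le> c \<Longrightarrow> 0 \<le> t \<Longrightarrow> V (X t) \<le> c"
proof -
  obtain C where C: "\<And>q. V q \<ge> C \<Longrightarrow> V' q < 0" using V'_neg by blast
  show ?thesis
  proof (rule that[of C])
    fix c f X and t :: real
    assume c: "C \<le> c" and X: "\<And>t. 0 \<le> t \<Longrightarrow> (X has_vector_derivative f (X t)) (at t within {0..})"
      and f: "\<And>q. V q \<le> c \<Longrightarrow> f q = field q" and init: "V (X 0) \<le> c" and t: "0 \<le> t"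
    have contX: "continuous_on {0..} X"
      unfolding continuous_on_eq_continuous_within
      using X has_vector_derivative_continuous by fastforce
    show "V (X t) \<le> c"
    proof (rule stays_below_level[of "\<lambda>t. V (X t)"])
      show "continuous_on {0..} (\<lambda>t. V (X t))"
        by (rule continuous_on_compose2[OF continuous_V[of UNIV] contX]) auto
      fix s :: real assume s: "0 \<le> s" "V (X s) = c"
      then have "(X has_vector_derivative field (X s)) (at s within {0..})" using X[of s] f[of "X s"] by simp
      then have "((\<lambda>s. V (X s)) has_real_derivative V' (X s)) (at s within {0..})"
        by (rule has_real_derivative_V)
      moreover have "V' (X s) < 0" using C[of "X s"] s c by simp
      ultimately show "\<exists>l<0. ((\<lambda>t. V (X t)) has_real_derivative l) (at s within {0..})"
        by (intro exI[of _ "V' (X s)"]) simp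
    qed (use init t in auto)
  qed
qed

lemma V_bounded_cball: "\<exists>c\<ge>C. \<forall>q. norm q \<le> R \<longrightarrow> V q \<le> c"
proof -
  have "bounded (V ` cball 0 R)"
    by (intro compact_imp_bounded compact_continuous_image continuous_V) auto
  then obtain b where "\<forall>v\<in>V ` cball 0 R. norm v \<le> b"
    unfolding bounded_iff by (elim exE)
  then have "\<And>q. norm q \<le> R \<Longrightarrow> \<bar>V q\<bar> \<le> b" by (simp add: ball_simps)
  then show ?thesis
    by (intro exI[of _ "max b C"]) (force simp: le_max_iff_disj)
qed

lemma forward_bounded:
  obtains R' where "\<And>X t. norm (X 0) \<le> R \<Longrightarrow> solution_on field {0..} X \<Longrightarrow> 0 \<le> t \<Longrightarrow> norm (X t) \<le> R'"
proof (rule V_stays_below)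
  fix C assume C: "\<And>c f X t. C \<le> c \<Longrightarrow> (\<And>t. 0 \<le> t \<Longrightarrow> (X has_vector_derivative f (X t)) (at t within {0..})) \<Longrightarrow>
    (\<And>q. V q \<le> c \<Longrightarrow> f q = field q) \<Longrightarrow> V (X 0) \<le> c \<Longrightarrow> 0 \<le> t \<Longrightarrow> V (X t) \<le> c"
  obtain c where c: "c \<ge> C" "\<And>q. norm q \<le> R \<Longrightarrow> V q \<le> c" using V_bounded_cball by blast
  obtain R' where R': "\<And>q. V q \<le> c \<Longrightarrow> norm q < R'" using V_coercive by blast
  show ?thesis
  proof (rule that[of R'])
    fix X and t :: real assume X: "norm (X 0) \<le> R" "solution_on field {0..} X" "0 \<le> t"
    have "V (X t) \<le> c"
      by (rule C[of c X field]) (use X c in \<open>auto simp: solution_on_def\<close>)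
    then show "norm (X t) \<le> R'" using R' by (simp add: less_imp_le)
  qed
qed

text \<open>Composing \<open>field\<close> with the nearest-point projection onto a ball makes it
  globally Lipschitz. The ball contains a forward invariant sublevel set of \<open>V\<close> with
  \<open>q\<close> in it, and there the two fields agree.\<close>

lemma forward_solution_exists:
  obtains X where "solution_on field {0..} X" "X 0 = q"
proof (rule V_stays_below)
  fix C assume C: "\<And>c f X t. C \<le> c \<Longrightarrow> (\<And>t. 0 \<le> t \<Longrightarrow> (X has_vector_derivative f (X t)) (at t within {0..})) \<Longrightarrow>
    (\<And>q. V q \<le> c \<Longrightarrow> f q = field q) \<Longrightarrow> V (X 0) \<le> c \<Longrightarrow> 0 \<le> t \<Longrightarrow> V (X t) \<le> c"
  define c where "c = max C (V q)"
  obtain R where R: "\<And>q. V q \<le> c \<Longrightarrow> norm q < R" using V_coercive by blast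
  have "norm q < R" using R[of q] by (simp add: c_def)
  then have "R \<ge> 0" using norm_ge_zero[of q] by linarith
  obtain L where L: "L-lipschitz_on (cball 0 R) field" using lipschitz_field_cball by blast
  define f where "f = (\<lambda>q. field (closest_point (cball 0 R) q))"
  have ne: "cball (0 :: real \<times> real) R \<noteq> {}" using \<open>R \<ge> 0\<close> by simp
  have cp: "closest_point (cball 0 R) q \<in> cball (0 :: real \<times> real) R" for q
    by (rule closest_point_in_set[OF closed_cball ne])
  have "L-lipschitz_on UNIV f"
  proof (rule lipschitz_onI)
    fix p q :: "real \<times> real"
    have "dist (f p) (f q) \<le> L * dist (closest_point (cball 0 R) p) (closest_point (cball 0 R) q)"
      unfolding f_def by (rule lipschitz_onD[OF L cp cp])
    also have "\<dots> \<le> L * dist p q"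
      by (intro mult_left_mono closest_point_lipschitz ne lipschitz_on_nonneg[OF L]) auto
    finally show "dist (f p) (f q) \<le> L * dist p q" .
  qed (rule lipschitz_on_nonneg[OF L])
  from lipschitz_global_solution[OF this, of q] obtain X
    where X: "X 0 = q" "\<forall>t\<ge>0. (X has_vector_derivative f (X t)) (at t within {0..})"
    by (elim exE conjE)
  have f: "f q = field q" if "V q \<le> c" for q
    using R[OF that] by (simp add: f_def closest_point_self)
  have "V (X t) \<le> c" if "t \<ge> 0" for t
    by (rule C[of c X f]) (use that X f in \<open>auto simp: c_def\<close>)
  then have "solution_on field {0..} X"
    using X(2) f by (simp add: solution_on_def)
  then show ?thesis using X(1) by (rule that)
qed

text \<open>Forward solutions that start within radius \<open>R\<close> stay in one common ball,
  whose Lipschitz constant \<open>L\<close> gives \<open>C = exp (L * T)\<close>. The uniformity in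
  starting points and times is what the shadowing arguments rely on.\<close>

lemma continuous_dependence:
  obtains C where "C > 0" "\<And>X Y t. solution_on field {0..} X \<Longrightarrow> solution_on field {0..} Y \<Longrightarrow>
    norm (X 0) \<le> R \<Longrightarrow> norm (Y 0) \<le> R \<Longrightarrow> t \<in> {0..T} \<Longrightarrow> dist (X t) (Y t) \<le> C * dist (X 0) (Y 0)"
proof (rule forward_bounded[of R])
  fix R' assume R': "\<And>X t. norm (X 0) \<le> R \<Longrightarrow> solution_on field {0..} X \<Longrightarrow> 0 \<le> t \<Longrightarrow> norm (X t) \<le> R'"
  obtain L where L: "L-lipschitz_on (cball 0 R') field" using lipschitz_field_cball by blast
  have L0: "L \<ge> 0" using L by (rule lipschitz_on_nonneg)
  show ?thesis
  proof (rule that[of "exp (L * T)"])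
    fix X Y t
    assume X: "solution_on field {0..} X" and Y: "solution_on field {0..} Y" "norm (X 0) \<le> R" "norm (Y 0) \<le> R"
      and t: "t \<in> {0..T}"
    have "dist (X t) (Y t) \<le> exp (L * t) * dist (X 0) (Y 0)"
    proof (rule gronwall_uniqueness[OF L, of t])
      show "\<And>s. s \<in> {0..t} \<Longrightarrow> (X has_vector_derivative field (X s)) (at s within {0..t})"
        using X by (auto simp: solution_on_def intro: has_vector_derivative_within_subset)
      show "\<And>s. s \<in> {0..t} \<Longrightarrow> (Y has_vector_derivative field (Y s)) (at s within {0..t})"
        using Y(1) by (auto simp: solution_on_def intro: has_vector_derivative_within_subset)
    qed (use R'[of X] R'[of Y] X Y t in auto)
    also have "\<dots> \<le> exp (L * T) * dist (X 0) (Y 0)"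
      using t L0 by (intro mult_right_mono) (auto intro: mult_left_mono)
    finally show "dist (X t) (Y t) \<le> exp (L * T) * dist (X 0) (Y 0)" .
  qed simp
qed

lemma forward_unique:
  assumes X: "solution_on field {0..} X" and Y: "solution_on field {0..} Y" and eq: "X 0 = Y 0" and t: "t \<ge> 0"
  shows "X t = Y t"
proof (rule continuous_dependence[of "norm (X 0)" t])
  fix C assume "\<And>X' Y' s. solution_on field {0..} X' \<Longrightarrow> solution_on field {0..} Y' \<Longrightarrow>
    norm (X' 0) \<le> norm (X 0) \<Longrightarrow> norm (Y' 0) \<le> norm (X 0) \<Longrightarrow> s \<in> {0..t} \<Longrightarrow> dist (X' s) (Y' s) \<le> C * dist (X' 0) (Y' 0)"
  from this[OF X Y, of t] show ?thesis using eq t by simp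
qed

section \<open>Time shift, reflection and time reversal of solutions\<close>

lemma solution_on_shift:
  assumes "solution_on f {0..} X" "s \<ge> 0"
  shows "solution_on f {0..} (\<lambda>t. X (t + s))"
  unfolding solution_on_def
proof
  fix t :: real assume t: "t \<in> {0..}"
  have "((\<lambda>t. t + s) has_vector_derivative 1) (at t within {0..})"
    by (auto intro!: derivative_eq_intros)
  moreover have "(X has_vector_derivative f (X (t + s))) (at (t + s) within (\<lambda>t. t + s) ` {0..})"
    by (rule has_vector_derivative_within_subset[of _ _ _ "{0..}"]) (use assms t in \<open>auto simp: solution_on_def\<close>)
  ultimately have "(X \<circ> (\<lambda>t. t + s) has_vector_derivative 1 *\<^sub>R f (X (t + s))) (at t within {0..})"
    by (rule vector_diff_chain_within)
  then show "((\<lambda>t. X (t + s)) has_vector_derivative f (X (t + s))) (at t within {0..})"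
    by (simp add: o_def)
qed

lemma solution_on_minus:
  assumes "solution_on field {0..} X"
  shows "solution_on field {0..} (\<lambda>t. - X t)"
  using assms by (auto simp: solution_on_def field_minus intro!: has_vector_derivative_minus)

text \<open>Read backwards from the meeting point, both curves solve the negated field inside a
  common ball, so the Gronwall estimate applies with initial distance 0. The clock times
  \<open>a\<close> and \<open>b\<close> may differ, because orbits are to be compared wherever they
  meet; the conclusion reaches back only as far as both pasts are given.\<close>

lemma backward_unique:
  assumes X: "solution_on field {0..} X" and Y: "solution_on field {0..} Y"
    and eq: "X a = Y b" and s: "0 \<le> s" "s \<le> a" "s \<le> b"
  shows "X (a - s) = Y (b - s)"
proof -
  have bd: "\<exists>R. \<forall>t\<ge>0. norm (Z t) \<le> R" if Z: "solution_on field {0..} Z" for Z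
  proof (rule forward_bounded[of "norm (Z 0)"])
    fix R assume "\<And>X t. norm (X 0) \<le> norm (Z 0) \<Longrightarrow> solution_on field {0..} X \<Longrightarrow> 0 \<le> t \<Longrightarrow> norm (X t) \<le> R"
    from this[OF order_refl Z] show ?thesis by (intro exI[of _ R]) simp
  qed
  obtain R1 R2 where R1: "\<forall>t\<ge>0. norm (X t) \<le> R1" and R2: "\<forall>t\<ge>0. norm (Y t) \<le> R2"
    using bd[OF X] bd[OF Y] by (elim exE) (rule that)
  obtain L where L: "L-lipschitz_on (cball 0 (max R1 R2)) field" using lipschitz_field_cball by blast
  then have L': "L-lipschitz_on (cball 0 (max R1 R2)) (\<lambda>q. - field q)"
    unfolding lipschitz_on_def dist_minus .
  have rev: "((\<lambda>t. Z (c - t)) has_vector_derivative - field (Z (c - t))) (at t within {0..s})"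
    if "solution_on field {0..} Z" "s \<le> c" "t \<in> {0..s}" for Z c t
  proof -
    have "((\<lambda>t. c - t) has_vector_derivative -1) (at t within {0..s})"
      by (auto intro!: derivative_eq_intros)
    moreover have "(Z has_vector_derivative field (Z (c - t))) (at (c - t) within (\<lambda>t. c - t) ` {0..s})"
      by (rule has_vector_derivative_within_subset[of _ _ _ "{0..}"]) (use that in \<open>auto simp: solution_on_def\<close>)
    ultimately have "(Z \<circ> (\<lambda>t. c - t) has_vector_derivative - 1 *\<^sub>R field (Z (c - t))) (at t within {0..s})"
      by (rule vector_diff_chain_within)
    then show ?thesis by (simp add: o_def)
  qed
  have "dist (X (a - s)) (Y (b - s)) \<le> exp (L * s) * dist (X (a - 0)) (Y (b - 0))"
  proof (rule gronwall_uniqueness[OF L', where T = s])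
    show "(\<lambda>t. X (a - t)) ` {0..s} \<subseteq> cball 0 (max R1 R2)" "(\<lambda>t. Y (b - t)) ` {0..s} \<subseteq> cball 0 (max R1 R2)"
      using R1 R2 s by (auto simp: le_max_iff_disj)
    show "((\<lambda>t. X (a - t)) has_vector_derivative - field (X (a - t))) (at t within {0..s})" if "t \<in> {0..s}" for t
      using rev[OF X s(2) that] .
    show "((\<lambda>t. Y (b - t)) has_vector_derivative - field (Y (b - t))) (at t within {0..s})" if "t \<in> {0..s}" for t
      using rev[OF Y s(3) that] .
  qed (use s in auto)
  then show ?thesis using eq by simp
qed

end

section \<open>Arcs in the right half plane\<close>

lemma first_zero:
  fixes \<phi> :: "real \<Rightarrow> real"
  assumes cont: "continuous_on {0..} \<phi>" and d: "d > 0" "\<And>t. 0 < t \<Longrightarrow> t < d \<Longrightarrow> \<phi> t > 0"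
    and T: "T > 0" "\<phi> T \<le> 0"
  shows "\<exists>\<tau>>0. \<phi> \<tau> = 0 \<and> (\<forall>t. 0 < t \<and> t < \<tau> \<longrightarrow> \<phi> t > 0)"
proof -
  \<comment> \<open>Starting at \<open>d/2\<close> leaves out time 0, where \<open>\<phi>\<close>
    may vanish because arcs begin on the line \<open>x = 0\<close>, and still keeps the set
    compact.\<close>
  define A where "A = {t \<in> {d/2..T}. \<phi> t \<le> 0}"
  have "d \<le> T" using d(2)[of T] T by force
  have cA: "continuous_on {d/2..T} \<phi>" by (rule continuous_on_subset[OF cont]) (use d in auto)
  have "closed A" unfolding A_def
    by (intro continuous_on_closed_Collect_le cA continuous_on_const) auto
  moreover have "bounded A" by (rule bounded_subset[of "{d/2..T}"]) (auto simp: A_def)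
  ultimately have "compact A" by (simp add: compact_eq_bounded_closed)
  moreover have "T \<in> A" using T \<open>d \<le> T\<close> d by (auto simp: A_def)
  ultimately obtain \<tau> where \<tau>: "\<tau> \<in> A" "\<And>t. t \<in> A \<Longrightarrow> \<tau> \<le> t" using compact_attains_inf[of A] by blast
  have pos: "\<phi> t > 0" if "0 < t" "t < \<tau>" for t
  proof (cases "t < d")
    case False
    then have "t \<notin> A" using \<tau>(2) that by force
    then show ?thesis using False that \<tau>(1) d by (auto simp: A_def)
  qed (use d that in auto)
  have "\<phi> \<tau> = 0"
  proof (rule ccontr)
    assume "\<phi> \<tau> \<noteq> 0"
    then have neg: "\<phi> \<tau> < 0" using \<tau>(1) by (auto simp: A_def)
    have "d \<le> \<tau>" using d(2)[of \<tau>] neg \<tau>(1) d(1) by (force simp: A_def)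
    have "\<phi> (d/2) > 0" using d by auto
    then have 1: "0 \<le> \<phi> (d/2)" by simp
    have 2: "continuous_on {d/2..\<tau>} \<phi>" by (rule continuous_on_subset[OF cont]) (use d in auto)
    obtain r where r: "d/2 \<le> r" "r \<le> \<tau>" "\<phi> r = 0"
      using IVT2'[of \<phi> \<tau> 0 "d/2"] 1 2 neg d \<open>d \<le> \<tau>\<close> by auto
    then have "r < \<tau>" using neg by (cases "r = \<tau>") auto
    then show False using pos[of r] r d by auto
  qed
  then show ?thesis using \<tau>(1) pos d by (intro exI[of _ \<tau>]) (auto simp: A_def)
qed

lemma no_linear_decay:
  fixes u :: "real \<Rightarrow> real"
  assumes der: "\<And>t. t > T \<Longrightarrow> (u has_real_derivative u' t) (at t)" and dec: "\<And>t. t > T \<Longrightarrow> u' t \<le> - k"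
    and k: "k > 0" and bnd: "\<And>t. t > T \<Longrightarrow> u t \<ge> B"
  shows False
proof -
  \<comment> \<open>By this time a descent at rate \<open>k\<close> has closed the gap to
    \<open>B\<close> with one unit to spare. It is measured from \<open>T + 1\<close> since the
    hypotheses hold only after \<open>T\<close>.\<close>
  define t where "t = T + 1 + (\<bar>u (T + 1) - B\<bar> + 1) / k"
  have tT: "t > T + 1" using k by (simp add: t_def add_nonneg_pos)
  have "u t + k * t \<le> u (T + 1) + k * (T + 1)"
  proof (rule DERIV_nonpos_imp_nonincreasing[of _ _ "\<lambda>t. u t + k * t"])
    show "T + 1 \<le> t" using tT by simp
    fix r assume "T + 1 \<le> r" "r \<le> t"
    then have "r > T" by simp
    then have "((\<lambda>t. u t + k * t) has_real_derivative u' r + k) (at r)"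
      by (auto intro!: derivative_eq_intros der)
    then show "\<exists>y. ((\<lambda>t. u t + k * t) has_real_derivative y) (at r) \<and> y \<le> 0"
      using dec[OF \<open>r > T\<close>] by (intro exI[of _ "u' r + k"]) auto
  qed
  moreover have "k * (t - (T + 1)) = \<bar>u (T + 1) - B\<bar> + 1" using k by (simp add: t_def)
  moreover have "u t \<ge> B" using bnd tT by simp
  ultimately show False by (simp add: algebra_simps)
qed

text \<open>Replaces time by a strictly monotone coordinate \<open>p\<close>; the slope is the
  quotient of the speeds. At the end points only continuity is required, because the speed may
  vanish there: on a half arc \<open>z' = - \<epsilon> * x^3\<close> is zero at both ends.\<close>

lemma graph_over_increasing:
  fixes p q :: "real \<Rightarrow> real"
  assumes st: "s < t" and cont: "continuous_on {s..t} p" "continuous_on {s..t} q"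
    and der: "\<And>r. s < r \<Longrightarrow> r < t \<Longrightarrow> (p has_real_derivative p' r) (at r)"
      "\<And>r. s < r \<Longrightarrow> r < t \<Longrightarrow> p' r > 0"
      "\<And>r. s < r \<Longrightarrow> r < t \<Longrightarrow> (q has_real_derivative q' r) (at r)"
  obtains h where "continuous_on {p s..p t} h" "\<And>r. s \<le> r \<Longrightarrow> r \<le> t \<Longrightarrow> h (p r) = q r"
    "\<And>u. p s < u \<Longrightarrow> u < p t \<Longrightarrow> \<exists>r. s < r \<and> r < t \<and> p r = u \<and> (h has_real_derivative q' r / p' r) (at u)"
proof -
  have mono: "p r < p r'" if "s \<le> r" "r < r'" "r' \<le> t" for r r'
  proof (rule DERIV_pos_imp_increasing_open[OF that(2)])
    show "continuous_on {r..r'} p" by (rule continuous_on_subset[OF cont(1)]) (use that in auto)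
  qed (use der(1,2) that in force)
  have inj: "inj_on p {s..t}"
    by (rule linorder_inj_onI) (use mono in force)+
  define g where "g = the_inv_into {s..t} p"
  have g: "g (p r) = r" if "s \<le> r" "r \<le> t" for r
    unfolding g_def by (rule the_inv_into_f_f[OF inj]) (use that in auto)
  have im: "p ` {s..t} = {p s..p t}"
  proof (intro equalityI subsetI)
    fix u assume "u \<in> p ` {s..t}"
    then obtain r where r: "s \<le> r" "r \<le> t" "u = p r" by auto
    then show "u \<in> {p s..p t}" using mono[of s r] mono[of r t] by (cases "r = s"; cases "r = t") (auto simp: less_imp_le)
  next
    fix u assume "u \<in> {p s..p t}"
    then obtain r where "s \<le> r" "r \<le> t" "p r = u" using IVT'[of p s u t] cont st by auto
    then show "u \<in> p ` {s..t}" by auto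
  qed
  have contg: "continuous_on {p s..p t} g"
    unfolding g_def im[symmetric] by (rule continuous_on_inv_into[OF cont(1) _ inj]) auto
  have gmem: "g u \<in> {s..t}" "p (g u) = u" if "u \<in> {p s..p t}" for u
    using that g unfolding im[symmetric] by auto
  show ?thesis
  proof (rule that[of "\<lambda>u. q (g u)"])
    show "continuous_on {p s..p t} (\<lambda>u. q (g u))"
      by (rule continuous_on_compose2[OF cont(2) contg]) (use gmem in auto)
    show "q (g (p r)) = q r" if "s \<le> r" "r \<le> t" for r
      using g that by simp
    fix u assume u: "p s < u" "u < p t"
    define r where "r = g u"
    have r: "s \<le> r" "r \<le> t" "p r = u" using gmem[of u] u by (auto simp: r_def)
    then have sr: "s < r" "r < t" using u by (auto simp: less_le)
    have "(g has_real_derivative inverse (p' r)) (at u)"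
    proof (rule DERIV_inverse_function[where f = p, OF _ _ u])
      show "(p has_real_derivative p' r) (at (g u))" using der(1)[OF sr] by (simp add: r_def)
      show "p' r \<noteq> 0" using der(2)[OF sr] by simp
      show "p (g y) = y" if "p s < y" "y < p t" for y using gmem[of y] that by auto
      show "isCont g u"
        by (rule continuous_on_interior[OF contg]) (use u in auto)
    qed
    from DERIV_chain2[OF _ this, of q "q' r"] der(3)[OF sr]
    have "((\<lambda>u. q (g u)) has_real_derivative q' r / p' r) (at u)"
      by (simp add: r_def divide_inverse)
    then show "\<exists>r. s < r \<and> r < t \<and> p r = u \<and> ((\<lambda>u. q (g u)) has_real_derivative q' r / p' r) (at u)"
      using sr r by (intro exI[of _ r]) simp
  qed
qed

lemma graph_over_decreasing:
  fixes p q :: "real \<Rightarrow> real"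
  assumes st: "s < t" and cont: "continuous_on {s..t} p" "continuous_on {s..t} q"
    and der: "\<And>r. s < r \<Longrightarrow> r < t \<Longrightarrow> (p has_real_derivative p' r) (at r)"
      "\<And>r. s < r \<Longrightarrow> r < t \<Longrightarrow> p' r < 0"
      "\<And>r. s < r \<Longrightarrow> r < t \<Longrightarrow> (q has_real_derivative q' r) (at r)"
  obtains h where "continuous_on {p t..p s} h" "\<And>r. s \<le> r \<Longrightarrow> r \<le> t \<Longrightarrow> h (p r) = q r"
    "\<And>u. p t < u \<Longrightarrow> u < p s \<Longrightarrow> \<exists>r. s < r \<and> r < t \<and> p r = u \<and> (h has_real_derivative q' r / p' r) (at u)"
proof (rule graph_over_increasing[of s t "\<lambda>r. - p r" q "\<lambda>r. - p' r" q'])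
  fix h assume h: "continuous_on {- p s..- p t} h" "\<And>r. s \<le> r \<Longrightarrow> r \<le> t \<Longrightarrow> h (- p r) = q r"
    "\<And>u. - p s < u \<Longrightarrow> u < - p t \<Longrightarrow> \<exists>r. s < r \<and> r < t \<and> - p r = u \<and> (h has_real_derivative q' r / - p' r) (at u)"
  show ?thesis
  proof (rule that[of "\<lambda>u. h (- u)"])
    show "continuous_on {p t..p s} (\<lambda>u. h (- u))"
      by (rule continuous_on_compose2[OF h(1)]) (auto intro!: continuous_intros)
    fix u assume "p t < u" "u < p s"
    then obtain r where r: "s < r" "r < t" "- p r = - u" "(h has_real_derivative q' r / - p' r) (at (- u))"
      using h(3)[of "- u"] by auto
    have "((\<lambda>u. h (- u)) has_real_derivative (q' r / - p' r) * (- 1)) (at u)"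
      by (rule DERIV_chain2[where f = h and g = uminus and x = u, OF r(4)]) (auto intro!: derivative_eq_intros)
    then show "\<exists>r. s < r \<and> r < t \<and> p r = u \<and> ((\<lambda>u. h (- u)) has_real_derivative q' r / p' r) (at u)"
      using r by (intro exI[of _ r]) simp
  qed (use h(2) in simp)
qed (use assms in \<open>auto intro!: continuous_intros derivative_intros\<close>)

text \<open>Splitting \<open>Z = (Z - F) + F\<close> gives
  \<open>(Z^2)' = - 2 * g - 2 * g * F / (Z - F)\<close>. The terms \<open>- 2 * g\<close> cancel in
  the difference, and the rest has a sign as soon as both graphs lie on the same side of
  \<open>F\<close>. So the statement covers the upper limbs of two arcs and, with the roles of inner
  and outer arc exchanged, the lower ones.\<close>

lemma strip_compare:
  fixes Z1 Z2 F g :: "real \<Rightarrow> real"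
  assumes a: "0 \<le> a" and cont: "continuous_on {0..a} Z1" "continuous_on {0..a} Z2"
    and der: "\<And>x. 0 < x \<Longrightarrow> x < a \<Longrightarrow> (Z1 has_real_derivative - g x / (Z1 x - F x)) (at x)"
      "\<And>x. 0 < x \<Longrightarrow> x < a \<Longrightarrow> (Z2 has_real_derivative - g x / (Z2 x - F x)) (at x)"
    and side: "\<And>x. 0 < x \<Longrightarrow> x < a \<Longrightarrow> (Z1 x - F x) * (Z2 x - F x) > 0"
    and less: "\<And>x. 0 < x \<Longrightarrow> x < a \<Longrightarrow> Z1 x < Z2 x"
    and F: "\<And>x. 0 < x \<Longrightarrow> x < a \<Longrightarrow> F x \<le> 0" and g: "\<And>x. 0 < x \<Longrightarrow> x < a \<Longrightarrow> g x \<ge> 0"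
  shows "(Z2 a)\<^sup>2 - (Z1 a)\<^sup>2 \<le> (Z2 0)\<^sup>2 - (Z1 0)\<^sup>2"
proof (rule DERIV_nonpos_imp_decreasing_open[OF a, of "\<lambda>x. (Z2 x)\<^sup>2 - (Z1 x)\<^sup>2"])
  fix x assume x: "0 < x" "x < a"
  define A B where "A = Z1 x - F x" "B = Z2 x - F x"
  have AB: "A * B > 0" "A \<noteq> 0" "B \<noteq> 0" using side[OF x] by (auto simp: A_B_def)
  have Z: "Z1 x = A + F x" "Z2 x = B + F x" by (simp_all add: A_B_def)
  have "((\<lambda>x. (Z2 x)\<^sup>2 - (Z1 x)\<^sup>2) has_real_derivative 2 * Z2 x * (- g x / B) - 2 * Z1 x * (- g x / A)) (at x)"
    unfolding A_B_def
    by (rule DERIV_cong[OF DERIV_diff[OF DERIV_power[OF der(2)[OF x]] DERIV_power[OF der(1)[OF x]]]]) (simp add: mult_ac)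
  moreover have "2 * Z2 x * (- g x / B) - 2 * Z1 x * (- g x / A) = 2 * g x * F x * (B - A) / (A * B)"
    unfolding Z using AB by (simp add: field_simps)
  moreover have "2 * g x * F x * (B - A) / (A * B) \<le> 0"
    using AB(1) F[OF x] g[OF x] less[OF x]
    by (intro divide_nonpos_pos mult_nonpos_nonneg mult_nonneg_nonpos) (auto simp: A_B_def)
  ultimately show "\<exists>y. ((\<lambda>x. (Z2 x)\<^sup>2 - (Z1 x)\<^sup>2) has_real_derivative y) (at x) \<and> y \<le> 0" by (intro exI[of _ "2 * g x * F x * (B - A) / (A * B)"]) simp
qed (intro continuous_intros cont)

section \<open>Zero, sign and monotonicity of \<open>F\<close>\<close>

context lienard begin

text \<open>The positive zero of \<open>F\<close>: as
  \<open>F x = x * (s^2 / 5 - s / 3 - \<mu>)\<close> with \<open>s = x^2\<close>, its square is the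
  larger root of that quadratic in \<open>s\<close>.\<close>

definition a0 :: real where
  "a0 = sqrt (5 / 2 * (1 / 3 + sqrt (1 / 9 + 4 * \<mu> / 5)))"

lemma a0_pos: "a0 > 0"
  using mu by (simp add: a0_def add_pos_nonneg)

text \<open>The lower bound 5/3 is where \<open>\<mu> \<ge> 0\<close> shapes \<open>F\<close>: it
  makes the cofactor in the factorisation of \<open>F\<close> positive for every
  \<open>x > 0\<close>, so that \<open>a0\<close> is the only positive zero.\<close>

lemma a0_root: "(a0\<^sup>2)\<^sup>2 / 5 - a0\<^sup>2 / 3 - \<mu> = 0" and a0_ge: "a0\<^sup>2 \<ge> 5 / 3"
proof -
  define w where "w = sqrt (1 / 9 + 4 * \<mu> / 5)"
  have w: "w\<^sup>2 = 1 / 9 + 4 * \<mu> / 5" using mu by (simp add: w_def)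
  have w3: "w \<ge> 1 / 3"
    unfolding w_def by (rule real_le_rsqrt) (use mu in \<open>simp add: power2_eq_square\<close>)
  have s: "a0\<^sup>2 = 5 / 2 * (1 / 3 + w)"
    using w3 unfolding a0_def w_def[symmetric] by simp
  show "(a0\<^sup>2)\<^sup>2 / 5 - a0\<^sup>2 / 3 - \<mu> = 0"
  proof -
    have "(a0\<^sup>2)\<^sup>2 / 5 - a0\<^sup>2 / 3 - \<mu> = 5 / 4 * w\<^sup>2 - 5 / 36 - \<mu>"
      unfolding s by (simp add: power2_eq_square field_simps)
    then show ?thesis unfolding w by (simp add: field_simps)
  qed
  show "a0\<^sup>2 \<ge> 5 / 3" unfolding s using w3 by simp
qed

text \<open>Subtracting the equation of \<open>a0\<close> splits off \<open>x^2 - a0^2\<close>.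
  Beyond \<open>a0\<close> all factors are nonnegative and increasing, so sign and monotonicity of
  \<open>F\<close> follow without a derivative.\<close>

lemma F_factor: "F x = x * ((x\<^sup>2 - a0\<^sup>2) * ((x\<^sup>2 + a0\<^sup>2) / 5 - 1 / 3))"
proof -
  have "F x = x * ((x\<^sup>2)\<^sup>2 / 5 - x\<^sup>2 / 3 - \<mu>)"
    by (simp add: F_def algebra_simps power2_eq_square power3_eq_cube numeral_eq_Suc)
  also have "(x\<^sup>2)\<^sup>2 / 5 - x\<^sup>2 / 3 - \<mu> = ((x\<^sup>2)\<^sup>2 / 5 - x\<^sup>2 / 3 - \<mu>) - ((a0\<^sup>2)\<^sup>2 / 5 - a0\<^sup>2 / 3 - \<mu>)"
    using a0_root by simp
  also have "\<dots> = (x\<^sup>2 - a0\<^sup>2) * ((x\<^sup>2 + a0\<^sup>2) / 5 - 1 / 3)"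
    by (simp add: field_simps power2_eq_square)
  finally show ?thesis .
qed

lemma F_a0 [simp]: "F a0 = 0"
  by (simp add: F_factor)

lemma F_neg: assumes "0 < x" "x < a0" shows "F x < 0"
proof -
  have "x\<^sup>2 < a0\<^sup>2" using assms by (intro power_strict_mono) auto
  moreover have "x\<^sup>2 > 0" using assms(1) by simp
  then have "x\<^sup>2 + a0\<^sup>2 > 5 / 3" using a0_ge by linarith
  then have "(x\<^sup>2 + a0\<^sup>2) / 5 - 1 / 3 > 0" by simp
  ultimately have "(x\<^sup>2 - a0\<^sup>2) * ((x\<^sup>2 + a0\<^sup>2) / 5 - 1 / 3) < 0" by (intro mult_neg_pos) auto
  then show ?thesis unfolding F_factor by (rule mult_pos_neg[OF assms(1)])
qed

lemma F_nonpos: assumes "0 \<le> x" "x \<le> a0" shows "F x \<le> 0"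
  using F_neg[of x] assms by (cases "x = 0"; cases "x = a0") auto

lemma F_strict_mono: assumes "a0 \<le> x" "x < y" shows "F x < F y"
proof -
  have x: "x > 0" using assms a0_pos by simp
  have "a0\<^sup>2 \<le> x\<^sup>2" using assms a0_pos by (intro power_mono) auto
  moreover have xy: "x\<^sup>2 < y\<^sup>2" using assms x by (intro power_strict_mono) auto
  ultimately have "(x\<^sup>2 - a0\<^sup>2) * ((x\<^sup>2 + a0\<^sup>2) / 5 - 1 / 3) \<le> (y\<^sup>2 - a0\<^sup>2) * ((y\<^sup>2 + a0\<^sup>2) / 5 - 1 / 3)"
    using a0_ge by (intro mult_mono) auto
  then have 1: "F x \<le> x * ((y\<^sup>2 - a0\<^sup>2) * ((y\<^sup>2 + a0\<^sup>2) / 5 - 1 / 3))"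
    unfolding F_factor[of x] using x by (intro mult_left_mono) auto
  have "(y\<^sup>2 - a0\<^sup>2) * ((y\<^sup>2 + a0\<^sup>2) / 5 - 1 / 3) > 0"
    using \<open>a0\<^sup>2 \<le> x\<^sup>2\<close> xy a0_ge by (intro mult_pos_pos) auto
  then have "x * ((y\<^sup>2 - a0\<^sup>2) * ((y\<^sup>2 + a0\<^sup>2) / 5 - 1 / 3)) < F y"
    unfolding F_factor[of y] using assms by (intro mult_strict_right_mono) auto
  then show ?thesis using 1 by simp
qed

lemma F_nonneg: assumes "a0 \<le> x" shows "F x \<ge> 0"
  using F_strict_mono[of a0 x] assms by (cases "x = a0") auto

section \<open>Signs along a solution and its return to the line \<open>x = 0\<close>\<close>

lemma solution_continuous: assumes "solution_on field {0..} X" shows "continuous_on {0..} X"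
  unfolding continuous_on_eq_continuous_within
  using assms has_vector_derivative_continuous unfolding solution_on_def by blast

lemma solution_continuous_components:
  assumes "solution_on field {0..} X" "S \<subseteq> {0..}"
  shows "continuous_on S (\<lambda>t. fst (X t))" "continuous_on S (\<lambda>t. snd (X t))" "continuous_on S (\<lambda>t. lz (X t))"
proof -
  have "continuous_on S X" using continuous_on_subset[OF solution_continuous] assms by blast
  then show "continuous_on S (\<lambda>t. fst (X t))" "continuous_on S (\<lambda>t. snd (X t))" "continuous_on S (\<lambda>t. lz (X t))"
    unfolding lz_def by (auto intro!: continuous_intros continuous_on_compose2[OF continuous_F[of UNIV]])
qed

lemma solution_DERIV:
  assumes "solution_on field {0..} X" "t > 0"
  shows "((\<lambda>s. fst (X s)) has_real_derivative snd (X t)) (at t)"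
    and "((\<lambda>s. snd (X s)) has_real_derivative
       (\<mu> + (fst (X t))^2 - (fst (X t))^4) * snd (X t) - \<epsilon> * (fst (X t))^3) (at t)"
    and "((\<lambda>s. lz (X s)) has_real_derivative - \<epsilon> * (fst (X t))^3) (at t)"
proof -
  have "at t within {0..} = at t" by (rule at_within_interior) (use assms in simp)
  moreover have "(X has_vector_derivative field (X t)) (at t within {0..})"
    using assms by (simp add: solution_on_def)
  ultimately have "(X has_vector_derivative field (X t)) (at t)" by simp
  from field_components[OF this] show
    "((\<lambda>s. fst (X s)) has_real_derivative snd (X t)) (at t)"
    "((\<lambda>s. snd (X s)) has_real_derivative
       (\<mu> + (fst (X t))^2 - (fst (X t))^4) * snd (X t) - \<epsilon> * (fst (X t))^3) (at t)"
    "((\<lambda>s. lz (X s)) has_real_derivative - \<epsilon> * (fst (X t))^3) (at t)" .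
qed

text \<open>With the integrating factor \<open>exp A\<close>, \<open>A' = x\<^sup>4 - x\<^sup>2 - \<mu>\<close>, one has
  \<open>(y exp A)' = - \<epsilon> x\<^sup>3 exp A < 0\<close> in the right half plane.\<close>

lemma velocity_sign:
  assumes X: "solution_on field {0..} X" and st: "0 \<le> s" "s < t"
    and pos: "\<And>r. s < r \<Longrightarrow> r < t \<Longrightarrow> fst (X r) > 0" and y: "snd (X s) \<le> 0"
  shows "snd (X t) < 0"
proof -
  \<comment> \<open>The absolute value extends the coefficient continuously to the whole line, where
    an antiderivative is available; \<open>X\<close> is controlled for nonnegative times
    only.\<close>
  define f where "f = (\<lambda>r. (fst (X \<bar>r\<bar>))^4 - (fst (X \<bar>r\<bar>))^2 - \<mu>)"
  have "continuous_on UNIV f"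
    unfolding f_def
    by (intro continuous_intros continuous_on_compose2[OF solution_continuous_components(1)[OF X order_refl]]) auto
  then have "\<exists>A. \<forall>r::real. -\<infinity> < ereal r \<longrightarrow> ereal r < \<infinity> \<longrightarrow> (A has_vector_derivative f r) (at r)"
    by (intro einterval_antiderivative) (auto simp: continuous_on_eq_continuous_at)
  then obtain A where A: "\<And>r::real. (A has_real_derivative f r) (at r)"
    by (auto simp: has_real_derivative_iff_has_vector_derivative)
  have "snd (X t) * exp (A t) < snd (X s) * exp (A s)"
  proof (rule DERIV_neg_imp_decreasing_open[OF st(2), of "\<lambda>r. snd (X r) * exp (A r)"])
    fix r assume r: "s < r" "r < t"
    have "((\<lambda>r. snd (X r) * exp (A r)) has_real_derivative
      ((\<mu> + (fst (X r))^2 - (fst (X r))^4) * snd (X r) - \<epsilon> * (fst (X r))^3) * exp (A r) + exp (A r) * f r * snd (X r)) (at r)"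
      using r st by (intro DERIV_mult solution_DERIV(2)[OF X] DERIV_fun_exp A) auto
    moreover have "((\<mu> + (fst (X r))^2 - (fst (X r))^4) * snd (X r) - \<epsilon> * (fst (X r))^3) * exp (A r) + exp (A r) * f r * snd (X r)
      = - (\<epsilon> * (fst (X r))^3) * exp (A r)"
      using r st by (simp add: f_def algebra_simps)
    moreover have "- (\<epsilon> * (fst (X r))^3) * exp (A r) < 0" using pos[OF r] eps by simp
    ultimately show "\<exists>y. ((\<lambda>r. snd (X r) * exp (A r)) has_real_derivative y) (at r) \<and> y < 0"
      by (intro exI[of _ "- (\<epsilon> * (fst (X r))^3) * exp (A r)"]) simp
  next
    show "continuous_on {s..t} (\<lambda>r. snd (X r) * exp (A r))"
      using st A by (intro continuous_intros solution_continuous_components(2)[OF X] DERIV_continuous_on[of _ A f])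
        (auto intro: has_field_derivative_at_within)
  qed
  also have "snd (X s) * exp (A s) \<le> 0" using y by (simp add: mult_nonpos_nonneg)
  finally show ?thesis by (simp add: mult_less_0_iff)
qed

lemma lz_strict_decreasing:
  assumes X: "solution_on field {0..} X" and st: "0 \<le> s" "s < t"
    and pos: "\<And>r. s < r \<Longrightarrow> r < t \<Longrightarrow> fst (X r) > 0"
  shows "lz (X t) < lz (X s)"
proof (rule DERIV_neg_imp_decreasing_open[OF st(2), of "\<lambda>r. lz (X r)"])
  fix r assume r: "s < r" "r < t"
  have "((\<lambda>r. lz (X r)) has_real_derivative - \<epsilon> * (fst (X r))^3) (at r)"
    using r st by (intro solution_DERIV(3)[OF X]) auto
  moreover have "- \<epsilon> * (fst (X r))^3 < 0" using pos[OF r] eps by simp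
  ultimately show "\<exists>y. ((\<lambda>r. lz (X r)) has_real_derivative y) (at r) \<and> y < 0"
    by (intro exI[of _ "- \<epsilon> * (fst (X r))^3"]) simp
qed (use st in \<open>intro solution_continuous_components(3)[OF X], auto\<close>)

lemma solution_bounded:
  assumes X: "solution_on field {0..} X"
  shows "\<exists>B. \<forall>t\<ge>0. norm (X t) \<le> B \<and> \<bar>lz (X t)\<bar> \<le> B"
proof (rule forward_bounded[of "norm (X 0)"])
  fix R assume "\<And>Z t. norm (Z 0) \<le> norm (X 0) \<Longrightarrow> solution_on field {0..} Z \<Longrightarrow> 0 \<le> t \<Longrightarrow> norm (Z t) \<le> R"
  from this[OF order_refl X] have R: "norm (X t) \<le> R" if "0 \<le> t" for t using that by simp
  have "continuous_on (cball 0 R) lz"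
    unfolding lz_def by (intro continuous_intros continuous_on_compose2[OF continuous_F[of UNIV]]) auto
  then have "bounded (lz ` cball 0 R)"
    by (intro compact_imp_bounded compact_continuous_image) auto
  then obtain b where b: "\<forall>v\<in>lz ` cball 0 R. norm v \<le> b"
    unfolding bounded_iff by (elim exE)
  show ?thesis
  proof (intro exI[of _ "max R b"] allI impI conjI)
    fix t :: real assume t: "0 \<le> t"
    show "norm (X t) \<le> max R b" using R[OF t] by simp
    have "lz (X t) \<in> lz ` cball 0 R" using R[OF t] by simp
    then show "\<bar>lz (X t)\<bar> \<le> max R b" using b by (metis max.coboundedI2 real_norm_def)
  qed
qed

text \<open>If \<open>x\<close> stayed above some \<open>b > 0\<close>, then \<open>z\<close> would
  fall linearly, against boundedness. Hence \<open>y\<close> becomes negative, remains so, and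
  \<open>x\<close> decreases to 0. But then \<open>z\<close> is already below a negative constant
  while \<open>F x\<close> tends to 0, so \<open>y\<close> is bounded away from 0 and
  \<open>x\<close> falls linearly below 0.\<close>

lemma not_always_right:
  assumes X: "solution_on field {0..} X" and pos: "\<And>t. t > 0 \<Longrightarrow> fst (X t) > 0"
  shows False
proof -
  obtain B where B: "\<And>t. 0 \<le> t \<Longrightarrow> \<bar>lz (X t)\<bar> \<le> B"
    using solution_bounded[OF X] by auto
  have not_away: False if T: "T \<ge> 0" and b: "b > 0" "\<And>t. t > T \<Longrightarrow> fst (X t) \<ge> b" for b T
  proof (rule no_linear_decay[of T "\<lambda>t. lz (X t)" "\<lambda>t. - \<epsilon> * (fst (X t))^3" "\<epsilon> * b^3" "- B"])
    fix t assume t: "t > T"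
    show "((\<lambda>t. lz (X t)) has_real_derivative - \<epsilon> * (fst (X t))^3) (at t)"
      using solution_DERIV(3)[OF X] T t by auto
    have "b^3 \<le> (fst (X t))^3" using b t by (intro power_mono) auto
    then show "- \<epsilon> * (fst (X t))^3 \<le> - (\<epsilon> * b^3)" using eps by simp
    show "- B \<le> lz (X t)" using B[of t] T t by (auto simp: abs_le_iff)
  qed (use b eps in simp)
  have "\<exists>t>0. snd (X t) < 0"
  proof (rule ccontr)
    assume "\<not> (\<exists>t>0. snd (X t) < 0)"
    then have y: "snd (X t) \<ge> 0" if "t > 0" for t using that by (meson not_le)
    have "fst (X 1) \<le> fst (X t)" if "t > 1" for t
    proof (rule DERIV_nonneg_imp_nondecreasing[of 1 t "\<lambda>t. fst (X t)"])
      fix r assume "1 \<le> r" "r \<le> t"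
      then show "\<exists>y. ((\<lambda>t. fst (X t)) has_real_derivative y) (at r) \<and> 0 \<le> y"
        using solution_DERIV(1)[OF X, of r] y[of r] by (intro exI[of _ "snd (X r)"]) auto
    qed (use that in simp)
    then show False using not_away[of 1 "fst (X 1)"] pos[of 1] by simp
  qed
  then obtain t0 where t0: "t0 > 0" "snd (X t0) < 0" by blast
  have y: "snd (X t) < 0" if "t > t0" for t
    by (rule velocity_sign[OF X _ that]) (use pos t0 in auto)
  have dec: "fst (X t) \<le> fst (X s)" if "t0 < s" "s \<le> t" for s t
  proof (rule DERIV_nonpos_imp_nonincreasing[OF that(2), of "\<lambda>t. fst (X t)"])
    fix r assume "s \<le> r" "r \<le> t"
    then show "\<exists>y. ((\<lambda>t. fst (X t)) has_real_derivative y) (at r) \<and> y \<le> 0"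
      using solution_DERIV(1)[OF X, of r] y[of r] that t0 by (intro exI[of _ "snd (X r)"]) auto
  qed
  have small: "\<exists>s>T. \<forall>t\<ge>s. fst (X t) < b" if b: "b > 0" and T: "T \<ge> t0" for b T
  proof -
    obtain s where s: "s > T" "fst (X s) < b"
      using not_away[of T b] b T t0 by (meson less_imp_le not_le order_trans)
    then have "fst (X t) < b" if "t \<ge> s" for t using dec[of s t] that T by simp
    then show ?thesis using s by (intro exI[of _ s]) simp
  qed
  obtain t1 where t1: "t1 > t0" "\<And>t. t \<ge> t1 \<Longrightarrow> fst (X t) < a0" using small[OF a0_pos order_refl] by auto
  \<comment> \<open>With \<open>0 < x < a0\<close> and \<open>y < 0\<close>, both summands of
    \<open>z = y + F x\<close> are negative; since \<open>z\<close> keeps decreasing,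
    \<open>- c\<close> bounds it from then on.\<close>
  define c where "c = - lz (X t1)"
  have c: "c > 0"
    using F_neg[of "fst (X t1)"] t1(2)[of t1] pos[of t1] y[OF t1(1)] t1(1) t0 by (simp add: c_def lz_def)
  have lzc: "lz (X t) \<le> - c" if "t \<ge> t1" for t
    using lz_strict_decreasing[OF X, of t1 t] that pos t1 t0 by (cases "t = t1") (auto simp: c_def)
  have "isCont F 0" using continuous_F[of UNIV] by (simp add: continuous_on_eq_continuous_at)
  then obtain d where d: "d > 0" "\<And>x. \<bar>x\<bar> < d \<Longrightarrow> \<bar>F x\<bar> < c / 2"
    using c unfolding continuous_at_eps_delta by (force simp: dist_real_def dest: spec[of _ "c/2"])
  obtain t2 where t2: "t2 > t1" "\<And>t. t \<ge> t2 \<Longrightarrow> fst (X t) < d" using small[OF d(1), of t1] t1 by auto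
  have pos': "t > 0" if "t > t2" for t using that t2 t1 t0 by simp
  show False
  proof (rule no_linear_decay[of t2 "\<lambda>t. fst (X t)" "\<lambda>t. snd (X t)" "c / 2" 0])
    fix t assume t: "t > t2"
    show "((\<lambda>t. fst (X t)) has_real_derivative snd (X t)) (at t)"
      using solution_DERIV(1)[OF X] pos'[OF t] by simp
    have "\<bar>F (fst (X t))\<bar> < c / 2" using d(2) t2(2)[of t] t pos[OF pos'[OF t]] by simp
    then show "snd (X t) \<le> - (c / 2)" using lzc[of t] t t2 by (simp add: lz_def abs_less_iff)
    show "0 \<le> fst (X t)" using pos[OF pos'[OF t]] by simp
  qed (use c in simp)
qed

lemma solution_zero: "solution_on field {0..} (\<lambda>_. 0)"
  by (simp add: solution_on_def field_eq zero_prod_def[symmetric])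

lemma first_return:
  assumes X: "solution_on field {0..} X" and init: "fst (X 0) > 0 \<or> (fst (X 0) = 0 \<and> snd (X 0) > 0)"
  shows "\<exists>\<tau>>0. (\<forall>t. 0 < t \<and> t < \<tau> \<longrightarrow> fst (X t) > 0) \<and> fst (X \<tau>) = 0 \<and> snd (X \<tau>) < 0"
proof -
  note cont = solution_continuous_components[OF X order_refl]
  have "\<exists>d>0. \<forall>t. 0 < t \<and> t < d \<longrightarrow> fst (X t) > 0"
    using init
  proof
    assume "fst (X 0) > 0"
    moreover have "((\<lambda>t. fst (X t)) \<longlongrightarrow> fst (X 0)) (at 0 within {0..})"
      using cont(1) by (auto simp: continuous_on_def)
    ultimately have "eventually (\<lambda>t. fst (X t) > 0) (at 0 within {0..})" by (intro order_tendstoD)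
    then show ?thesis by (auto simp: eventually_at dist_real_def)
  next
    assume i: "fst (X 0) = 0 \<and> snd (X 0) > 0"
    have "(X has_vector_derivative field (X 0)) (at 0 within {0..})" using X by (simp add: solution_on_def)
    from has_real_derivative_pos_inc_right[OF field_components(1)[OF this]] i
    show ?thesis by auto
  qed
  then obtain d where d: "d > 0" "\<And>t. 0 < t \<Longrightarrow> t < d \<Longrightarrow> fst (X t) > 0" by blast
  obtain T where T: "T > 0" "fst (X T) \<le> 0" using not_always_right[OF X] by (force simp: not_less)
  obtain \<tau> where \<tau>: "\<tau> > 0" "fst (X \<tau>) = 0" "\<And>t. 0 < t \<Longrightarrow> t < \<tau> \<Longrightarrow> fst (X t) > 0"
    using first_zero[OF cont(1) d T] by auto
  \<comment> \<open>Otherwise the solution would reach the equilibrium in finite time, and backward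
    uniqueness would make it rest there before, where \<open>x > 0\<close>.\<close>
  have "snd (X \<tau>) \<noteq> 0"
  proof
    assume "snd (X \<tau>) = 0"
    then have "X \<tau> = 0" using \<tau>(2) by (simp add: prod_eq_iff)
    have "X (\<tau> - \<tau> / 2) = (\<lambda>_. 0) (\<tau> - \<tau> / 2)"
      by (rule backward_unique[OF X solution_zero, where b = \<tau>]) (use \<open>X \<tau> = 0\<close> \<tau>(1) in auto)
    moreover have "\<tau> - \<tau> / 2 = \<tau> / 2" by simp
    ultimately have "X (\<tau> / 2) = 0" by (rule subst[rotated])
    then show False using \<tau>(3)[of "\<tau> / 2"] \<tau>(1) by simp
  qed
  moreover have "\<not> snd (X \<tau>) > 0"
  proof
    assume "snd (X \<tau>) > 0"
    from DERIV_pos_inc_left[OF solution_DERIV(1)[OF X \<tau>(1)] this]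
    obtain e where e: "e > 0" "\<And>h. h > 0 \<Longrightarrow> h < e \<Longrightarrow> fst (X (\<tau> - h)) < fst (X \<tau>)" by blast
    define h where "h = min (e / 2) (\<tau> / 2)"
    have "h > 0" "h < e" "h < \<tau>" using e(1) \<tau>(1) by (auto simp: h_def)
    then show False using e(2)[of h] \<tau>(2) \<tau>(3)[of "\<tau> - h"] by simp
  qed
  ultimately show ?thesis using \<tau> by (intro exI[of _ \<tau>]) auto
qed

end

section \<open>The half-return map\<close>

context lienard begin

text \<open>Forward uniqueness determines this choice at nonnegative times; at negative ones it is
  unspecified, which is why later time sets lie in \<open>{0..}\<close>.\<close>

definition sol :: "real \<Rightarrow> real \<Rightarrow> real \<times> real" where
  "sol z = (SOME X. solution_on field {0..} X \<and> X 0 = (0, z))"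

abbreviation "px z t \<equiv> fst (sol z t)"
abbreviation "py z t \<equiv> snd (sol z t)"
abbreviation "pz z t \<equiv> lz (sol z t)"

definition ret :: "real \<Rightarrow> real" where
  "ret z = (SOME \<tau>. \<tau> > 0 \<and> (\<forall>t. 0 < t \<and> t < \<tau> \<longrightarrow> px z t > 0) \<and> px z \<tau> = 0 \<and> py z \<tau> < 0)"

text \<open>On the line \<open>x = 0\<close> the coordinates \<open>y\<close> and \<open>z\<close>
  agree. The minus sign makes \<open>P\<close> a self-map of the positive reals, so that by symmetry
  the same map also describes the turn through the left half plane.\<close>

definition P :: "real \<Rightarrow> real" where
  "P z = - py z (ret z)"

lemma sol: "solution_on field {0..} (sol z)" and sol_0: "sol z 0 = (0, z)"
proof -
  have "\<exists>X. solution_on field {0..} X \<and> X 0 = (0, z)"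
  proof (rule forward_solution_exists)
    fix X assume "solution_on field {0..} X" "X 0 = (0, z)"
    then show ?thesis by (intro exI[of _ X]) simp
  qed
  from someI_ex[OF this] show "solution_on field {0..} (sol z)" "sol z 0 = (0, z)"
    unfolding sol_def by auto
qed

lemma ret:
  assumes "z > 0"
  shows "ret z > 0" "\<And>t. 0 < t \<Longrightarrow> t < ret z \<Longrightarrow> px z t > 0" "sol z (ret z) = (0, - P z)" "P z > 0"
proof -
  have "\<exists>\<tau>>0. (\<forall>t. 0 < t \<and> t < \<tau> \<longrightarrow> px z t > 0) \<and> px z \<tau> = 0 \<and> py z \<tau> < 0"
    by (rule first_return[OF sol]) (use assms in \<open>simp add: sol_0\<close>)
  from someI_ex[OF this] have *: "ret z > 0 \<and> (\<forall>t. 0 < t \<and> t < ret z \<longrightarrow> px z t > 0) \<and> px z (ret z) = 0 \<and> py z (ret z) < 0"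
    unfolding ret_def .
  then show "ret z > 0" "\<And>t. 0 < t \<Longrightarrow> t < ret z \<Longrightarrow> px z t > 0" "sol z (ret z) = (0, - P z)" "P z > 0"
    by (auto simp: P_def prod_eq_iff)
qed

lemma px_nonneg: assumes "z > 0" "0 \<le> t" "t \<le> ret z" shows "px z t \<ge> 0"
  using ret(2)[OF assms(1), of t] ret(3)[OF assms(1)] assms sol_0[of z]
  by (cases "t = 0"; cases "t = ret z") auto

lemma pz_0: "pz z 0 = z" and pz_ret: "z > 0 \<Longrightarrow> pz z (ret z) = - P z"
  using sol_0 ret(3) by (auto simp: lz_def)

lemmas sol_DERIV = solution_DERIV[OF sol]
lemmas sol_continuous = solution_continuous_components[OF sol]

lemma pz_decreasing:
  assumes "z > 0" "0 \<le> s" "s < t" "t \<le> ret z" shows "pz z t < pz z s"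
  by (rule lz_strict_decreasing[OF sol]) (use assms ret(2) in auto)

lemma py_sign:
  assumes "z > 0" "0 \<le> s" "s < t" "t \<le> ret z" "py z s \<le> 0" shows "py z t < 0"
  by (rule velocity_sign[OF sol, of s]) (use assms ret(2) in auto)

text \<open>Run both arcs backwards from a common point until the one with less elapsed time is at
  its start \<open>(0, z1)\<close>. That point lies on the other arc, which has \<open>x > 0\<close>
  inside and ends at a negative height, so it must be the other start too.\<close>

lemma arcs_disjoint:
  assumes z: "0 < z1" "0 < z2" "z1 \<noteq> z2" and t: "0 \<le> t1" "t1 \<le> ret z1" "0 \<le> t2" "t2 \<le> ret z2"
  shows "sol z1 t1 \<noteq> sol z2 t2"
proof
  have aux: False if z: "0 < z1" "0 < z2" "z1 \<noteq> z2" and t: "0 \<le> t1" "t1 \<le> t2" "t2 \<le> ret z2" and eq: "sol z1 t1 = sol z2 t2" for z1 z2 t1 t2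
  proof -
    have "sol z1 (t1 - t1) = sol z2 (t2 - t1)"
      by (rule backward_unique[OF sol sol eq]) (use t in auto)
    then have e: "sol z2 (t2 - t1) = (0, z1)" by (simp add: sol_0)
    have "t2 - t1 < ret z2 \<or> (t1 = 0 \<and> t2 = ret z2)" using t by auto
    then show False
    proof
      assume "t2 - t1 < ret z2"
      then have "t2 = t1" using ret(2)[OF z(2), of "t2 - t1"] e t by fastforce
      then show False using e z by (simp add: sol_0)
    next
      assume "t1 = 0 \<and> t2 = ret z2"
      then show False using e ret(3,4)[OF z(2)] z by simp
    qed
  qed
  assume eq: "sol z1 t1 = sol z2 t2"
  show False
  proof (cases "t1 \<le> t2")
    case True
    then show ?thesis using aux[of z1 z2 t1 t2] z t eq by simp
  next
    case False
    then show ?thesis using aux[of z2 z1 t2 t1] z t eq by simp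
  qed
qed

section \<open>Half arcs as graphs over \<open>z\<close>, and monotonicity of
  \<open>P\<close>\<close>

lemma graph_in_z:
  assumes z: "z > 0"
  shows "\<exists>h. continuous_on {- P z..z} h \<and> (\<forall>t. 0 \<le> t \<and> t \<le> ret z \<longrightarrow> h (pz z t) = px z t) \<and>
    (\<forall>u. - P z \<le> u \<and> u \<le> z \<longrightarrow> (\<exists>t. 0 \<le> t \<and> t \<le> ret z \<and> pz z t = u \<and> px z t = h u)) \<and>
    (\<forall>u. - P z < u \<and> u < z \<longrightarrow> h u > 0 \<and> (h has_real_derivative (F (h u) - u) / (\<epsilon> * (h u)^3)) (at u))"
proof -
  note z_ret = ret[OF z]
  define Q where "Q = (\<lambda>h. continuous_on {- P z..z} h \<and> (\<forall>t. 0 \<le> t \<and> t \<le> ret z \<longrightarrow> h (pz z t) = px z t) \<and>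
    (\<forall>u. - P z < u \<and> u < z \<longrightarrow> (\<exists>r. 0 < r \<and> r < ret z \<and> pz z r = u \<and> (h has_real_derivative py z r / (- \<epsilon> * (px z r)^3)) (at u))))"
  \<comment> \<open>Over \<open>z\<close> one graph describes the entire half arc, including the
    turning point \<open>y = 0\<close>; its slope is
    \<open>y / (- \<epsilon> * x^3)\<close>.\<close>
  have "\<exists>h. Q h"
  proof (rule graph_over_decreasing[of 0 "ret z" "pz z" "px z" "\<lambda>r. - \<epsilon> * (px z r)^3" "py z"])
    show "0 < ret z" by (rule z_ret)
    show "continuous_on {0..ret z} (pz z)" "continuous_on {0..ret z} (px z)" by (auto intro!: sol_continuous)
    fix r assume r: "0 < r" "r < ret z"
    show "(pz z has_real_derivative - \<epsilon> * (px z r)^3) (at r)" "(px z has_real_derivative py z r) (at r)"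
      using sol_DERIV r by auto
    show "- \<epsilon> * (px z r)^3 < 0" using z_ret(2) r eps by simp
  next
    fix h assume "continuous_on {pz z (ret z)..pz z 0} h" "\<And>r. 0 \<le> r \<Longrightarrow> r \<le> ret z \<Longrightarrow> h (pz z r) = px z r"
      "\<And>u. pz z (ret z) < u \<Longrightarrow> u < pz z 0 \<Longrightarrow> \<exists>r>0. r < ret z \<and> pz z r = u \<and> (h has_real_derivative py z r / (- \<epsilon> * (px z r)^3)) (at u)"
    then show ?thesis unfolding Q_def pz_0 pz_ret[OF z] by (intro exI[of _ h]) simp
  qed
  then obtain h where h: "Q h" ..
  have sur: "\<exists>t. 0 \<le> t \<and> t \<le> ret z \<and> pz z t = u \<and> px z t = h u" if u: "- P z \<le> u" "u \<le> z" for u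
  proof -
    have "continuous_on {0..ret z} (pz z)" by (auto intro!: sol_continuous)
    then obtain t where "0 \<le> t" "t \<le> ret z" "pz z t = u"
      using IVT2'[of "pz z" "ret z" u 0] u z_ret(1) pz_0 pz_ret[OF z] by auto
    then show ?thesis using h by (auto simp: Q_def)
  qed
  have der: "h u > 0 \<and> (h has_real_derivative (F (h u) - u) / (\<epsilon> * (h u)^3)) (at u)" if u: "- P z < u" "u < z" for u
  proof -
    obtain r where r: "0 < r" "r < ret z" "pz z r = u" "(h has_real_derivative py z r / (- \<epsilon> * (px z r)^3)) (at u)"
      using h u by (auto simp: Q_def)
    have hu: "h u = px z r" using h r by (auto simp: Q_def)
    have "py z r / (- \<epsilon> * (px z r)^3) = (F (h u) - u) / (\<epsilon> * (h u)^3)"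
    proof -
      have "F (px z r) - u = - py z r" using r(3) by (simp add: lz_def)
      then show ?thesis unfolding hu by simp
    qed
    then show ?thesis using r z_ret(2)[of r] hu by simp
  qed
  show ?thesis using h sur der by (intro exI[of _ h]) (auto simp: Q_def)
qed

definition hz :: "real \<Rightarrow> real \<Rightarrow> real" where
  "hz z = (SOME h. continuous_on {- P z..z} h \<and> (\<forall>t. 0 \<le> t \<and> t \<le> ret z \<longrightarrow> h (pz z t) = px z t) \<and>
    (\<forall>u. - P z \<le> u \<and> u \<le> z \<longrightarrow> (\<exists>t. 0 \<le> t \<and> t \<le> ret z \<and> pz z t = u \<and> px z t = h u)) \<and>
    (\<forall>u. - P z < u \<and> u < z \<longrightarrow> h u > 0 \<and> (h has_real_derivative (F (h u) - u) / (\<epsilon> * (h u)^3)) (at u)))"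

lemma hz:
  assumes z: "z > 0"
  shows "continuous_on {- P z..z} (hz z)"
    and "\<And>t. 0 \<le> t \<Longrightarrow> t \<le> ret z \<Longrightarrow> hz z (pz z t) = px z t"
    and "\<And>u. - P z \<le> u \<Longrightarrow> u \<le> z \<Longrightarrow> \<exists>t. 0 \<le> t \<and> t \<le> ret z \<and> pz z t = u \<and> px z t = hz z u"
    and "\<And>u. - P z < u \<Longrightarrow> u < z \<Longrightarrow> hz z u > 0"
    and "\<And>u. - P z < u \<Longrightarrow> u < z \<Longrightarrow> (hz z has_real_derivative (F (hz z u) - u) / (\<epsilon> * (hz z u)^3)) (at u)"
  using someI_ex[OF graph_in_z[OF z]] unfolding hz_def[symmetric] by auto

lemma hz_ends: assumes z: "z > 0" shows "hz z z = 0" "hz z (- P z) = 0"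
  using hz(2)[OF z, of 0] hz(2)[OF z, of "ret z"] ret[OF z] sol_0 pz_0 pz_ret[OF z] by auto

lemma hz_neq:
  assumes z: "0 < z1" "0 < z2" "z1 \<noteq> z2" and u: "- P z1 \<le> u" "u \<le> z1" "- P z2 \<le> u" "u \<le> z2"
  shows "hz z1 u \<noteq> hz z2 u"
proof
  assume eq: "hz z1 u = hz z2 u"
  obtain t1 where t1: "0 \<le> t1" "t1 \<le> ret z1" "pz z1 t1 = u" "px z1 t1 = hz z1 u" using hz(3)[OF z(1) u(1,2)] by blast
  obtain t2 where t2: "0 \<le> t2" "t2 \<le> ret z2" "pz z2 t2 = u" "px z2 t2 = hz z2 u" using hz(3)[OF z(2) u(3,4)] by blast
  have "sol z1 t1 = sol z2 t2"
    using t1(3,4) t2(3,4) eq by (simp add: prod_eq_iff lz_def)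
  then show False using arcs_disjoint[OF z t1(1,2) t2(1,2)] by simp
qed

text \<open>Disjoint arcs keep their order. At height \<open>z1\<close> the inner arc is at
  \<open>x = 0\<close> and the outer one strictly to the right, so it stays to the right on the
  common range of heights. If the outer arc came back to \<open>x = 0\<close> first, the inner one
  would have to be at negative \<open>x\<close> there.\<close>

lemma P_strict_mono:
  assumes z: "0 < z1" "z1 < z2"
  shows "P z1 < P z2" and "\<And>u. - P z1 \<le> u \<Longrightarrow> u \<le> z1 \<Longrightarrow> hz z1 u < hz z2 u"
proof -
  have z2: "0 < z2" using z by simp
  define D where "D = (\<lambda>u. hz z2 u - hz z1 u)"
  \<comment> \<open>Lower end of the common range of heights; which of the two is larger is part of
    the claim.\<close>
  define m where "m = max (- P z1) (- P z2)"
  have m: "m < 0" "- P z1 \<le> m" "- P z2 \<le> m" using ret(4)[OF z(1)] ret(4)[OF z2] by (auto simp: m_def)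
  have cont: "continuous_on {m..z1} D"
    unfolding D_def using m z
    by (intro continuous_intros continuous_on_subset[OF hz(1)[OF z(1)]] continuous_on_subset[OF hz(1)[OF z2]]) auto
  have ne: "D u \<noteq> 0" if "m \<le> u" "u \<le> z1" for u
    using hz_neq[of z2 z1 u] that z z2 m by (auto simp: D_def)
  have Dz: "D z1 > 0"
    using hz(4)[OF z2, of z1] hz_ends[OF z(1)] m z by (auto simp: D_def)
  have Dpos: "D u > 0" if u: "m \<le> u" "u \<le> z1" for u
  proof (rule ccontr)
    assume "\<not> D u > 0"
    moreover have "continuous_on {u..z1} D" by (rule continuous_on_subset[OF cont]) (use u in auto)
    ultimately obtain v where "u \<le> v" "v \<le> z1" "D v = 0"
      using IVT'[of D u 0 z1] Dz u by auto
    then show False using ne[of v] u by simp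
  qed
  show lt: "P z1 < P z2"
  proof (rule ccontr)
    assume "\<not> P z1 < P z2"
    then have le: "m = - P z2" by (simp add: m_def)
    have "D m > 0" using Dpos[of m] m z by simp
    then have "hz z1 (- P z2) < 0" using hz_ends[OF z2] le by (simp add: D_def)
    moreover have "hz z1 (- P z2) \<ge> 0"
      using hz(4)[OF z(1), of "- P z2"] hz_ends[OF z(1)] m le z by (cases "P z2 = P z1") auto
    ultimately show False by simp
  qed
  then show "hz z1 u < hz z2 u" if "- P z1 \<le> u" "u \<le> z1" for u
    using Dpos[of u] that by (simp add: m_def D_def)
qed

section \<open>Energy of an arc, and its passage through the strip \<open>x \<le> a0\<close>\<close>

definition En :: "real \<times> real \<Rightarrow> real" where
  "En q = (lz q)\<^sup>2 / 2 + \<epsilon> * (fst q)^4 / 4"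

lemma En_DERIV:
  assumes "t > 0"
  shows "((\<lambda>t. En (sol z t)) has_real_derivative - \<epsilon> * (px z t)^3 * F (px z t)) (at t)"
proof -
  have "((\<lambda>t. En (sol z t)) has_real_derivative
     pz z t * (- \<epsilon> * (px z t)^3) + \<epsilon> * (px z t)^3 * py z t) (at t)"
    unfolding En_def by (auto intro!: derivative_eq_intros sol_DERIV assms)
  then show ?thesis by (rule DERIV_cong) (simp add: lz_def algebra_simps)
qed

lemma En_continuous: assumes "S \<subseteq> {0..}" shows "continuous_on S (\<lambda>t. En (sol z t))"
  unfolding En_def by (intro continuous_intros sol_continuous assms) auto

lemma P_greater:
  assumes z: "z > 0" and left: "\<And>t. 0 \<le> t \<Longrightarrow> t \<le> ret z \<Longrightarrow> px z t \<le> a0"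
  shows "P z > z"
proof -
  define E where "E = (\<lambda>t. En (sol z t))"
  note R = ret[OF z]
  have "eventually (\<lambda>t. px z t < a0) (at 0 within {0..})"
  proof (rule order_tendstoD)
    have "(px z \<longlongrightarrow> px z 0) (at 0 within {0..})"
      using sol_continuous(1)[of "{0..}" z] unfolding continuous_on_def by simp
    then show "(px z \<longlongrightarrow> 0) (at 0 within {0..})" by (simp add: sol_0)
  qed (rule a0_pos)
  then obtain d where d: "d > 0" "\<And>t. 0 < t \<Longrightarrow> t < d \<Longrightarrow> px z t < a0"
    by (auto simp: eventually_at dist_real_def)
  \<comment> \<open>The arc may touch \<open>x = a0\<close>, where \<open>F\<close> vanishes and
    energy is only weakly gained. The strict gain comes from an initial stretch on which
    \<open>x < a0\<close>.\<close>
  define m where "m = min d (ret z) / 2"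
  have m: "0 < m" "m < d" "m < ret z" using d R by (auto simp: m_def min_def)
  have "E 0 < E m"
  proof (rule DERIV_pos_imp_increasing_open[OF m(1), of E])
    fix t assume t: "0 < t" "t < m"
    have x: "px z t > 0" "px z t < a0" using R(2)[of t] d(2)[of t] t m by auto
    have "- \<epsilon> * (px z t)^3 * F (px z t) > 0"
      using F_neg[OF x] x eps by (intro mult_neg_neg) auto
    then show "\<exists>y. (E has_real_derivative y) (at t) \<and> 0 < y"
      unfolding E_def using En_DERIV[OF t(1)] by blast
  qed (unfold E_def, rule En_continuous, auto)
  also have "E m \<le> E (ret z)"
  proof (rule DERIV_nonneg_imp_increasing_open[of m "ret z" E])
    fix t assume t: "m < t" "t < ret z"
    have x: "px z t > 0" "px z t \<le> a0" using R(2)[of t] left[of t] t m by auto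
    have "- \<epsilon> * (px z t)^3 * F (px z t) \<ge> 0"
      using F_nonpos[of "px z t"] x eps by (intro mult_nonpos_nonpos) auto
    then show "\<exists>y. (E has_real_derivative y) (at t) \<and> 0 \<le> y"
      unfolding E_def using En_DERIV[of t] t m by fastforce
  qed (use m in \<open>auto simp: E_def intro!: En_continuous\<close>)
  finally have "z\<^sup>2 < (P z)\<^sup>2"
    using R(3) sol_0 by (simp add: E_def En_def lz_def)
  then show ?thesis using R(4) by (simp add: power2_less_imp_less)
qed

text \<open>Cuts the arc at \<open>x = a0\<close>: up to \<open>ta\<close> and from
  \<open>tb\<close> on the velocity has one sign, so these pieces are graphs over \<open>x\<close>,
  while the excursion in between is treated over \<open>z\<close>. The last conjunct says that the
  arc lies beyond \<open>a0\<close> during that excursion only.\<close>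

definition crosses :: "real \<Rightarrow> real \<Rightarrow> real \<Rightarrow> bool" where
  "crosses z ta tb \<longleftrightarrow> 0 < ta \<and> ta < tb \<and> tb < ret z \<and> px z ta = a0 \<and> px z tb = a0 \<and>
    (\<forall>t. 0 \<le> t \<and> t \<le> ta \<longrightarrow> py z t > 0) \<and> (\<forall>t. tb \<le> t \<and> t \<le> ret z \<longrightarrow> py z t < 0) \<and>
    (\<forall>t. ta < t \<and> t < tb \<longrightarrow> px z t > a0) \<and>
    (\<forall>t. 0 \<le> t \<and> t \<le> ret z \<and> px z t > a0 \<longrightarrow> ta < t \<and> t < tb)"

lemma crossesD:
  assumes "crosses z ta tb"
  shows "0 < ta" "ta < tb" "tb < ret z" "px z ta = a0" "px z tb = a0"
    and "\<And>t. 0 \<le> t \<Longrightarrow> t \<le> ta \<Longrightarrow> py z t > 0" and "\<And>t. tb \<le> t \<Longrightarrow> t \<le> ret z \<Longrightarrow> py z t < 0"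
    and "\<And>t. ta < t \<Longrightarrow> t < tb \<Longrightarrow> px z t > a0"
    and "\<And>t. 0 \<le> t \<Longrightarrow> t \<le> ret z \<Longrightarrow> px z t > a0 \<Longrightarrow> ta < t \<and> t < tb"
  using assms unfolding crosses_def by blast+

text \<open>By \<open>py_sign\<close> the velocity cannot turn positive again, so \<open>x\<close>
  rises and then falls. A level strictly between 0 and the maximum is met exactly once on each
  limb.\<close>

lemma crossing_structure:
  assumes z: "z > 0" and t1: "0 \<le> t1" "t1 \<le> ret z" "px z t1 > a0"
  shows "\<exists>ta tb. crosses z ta tb"
proof -
  note R = ret[OF z]
  have inc: "px z s < px z t" if "0 \<le> s" "s < t" "t \<le> ret z" "py z t \<ge> 0" for s t
  proof (rule DERIV_pos_imp_increasing_open[OF that(2), of "px z"])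
    fix r assume r: "s < r" "r < t"
    then have "py z r > 0" using py_sign[OF z, of r t] that by fastforce
    then show "\<exists>y. (px z has_real_derivative y) (at r) \<and> y > 0"
      using sol_DERIV(1)[of r z] r that by (intro exI[of _ "py z r"]) auto
  qed (use that in \<open>auto intro!: sol_continuous\<close>)
  have dec: "px z t < px z s" if "0 \<le> s" "s < t" "t \<le> ret z" "py z s \<le> 0" for s t
  proof (rule DERIV_neg_imp_decreasing_open[OF that(2), of "px z"])
    fix r assume r: "s < r" "r < t"
    then have "py z r < 0" using py_sign[OF z, of s r] that by fastforce
    then show "\<exists>y. (px z has_real_derivative y) (at r) \<and> y < 0"
      using sol_DERIV(1)[of r z] r that by (intro exI[of _ "py z r"]) auto
  qed (use that in \<open>auto intro!: sol_continuous\<close>)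
  have c: "continuous_on {0..t1} (px z)" "continuous_on {t1..ret z} (px z)"
    using t1 by (auto intro!: sol_continuous)
  obtain ta where ta: "0 \<le> ta" "ta \<le> t1" "px z ta = a0"
    using IVT'[of "px z" 0 a0 t1] c t1 sol_0 a0_pos by auto
  obtain tb where tb: "t1 \<le> tb" "tb \<le> ret z" "px z tb = a0"
    using IVT2'[of "px z" "ret z" a0 t1] c t1 R(3) a0_pos by auto
  have ne: "0 \<noteq> ta" "ta \<noteq> t1" "t1 \<noteq> tb" "tb \<noteq> ret z"
    using ta tb t1 sol_0 R(3) a0_pos by auto
  then have order: "0 < ta" "ta < t1" "t1 < tb" "tb < ret z" using ta tb by auto
  have ya: "py z ta > 0"
  proof (rule ccontr)
    assume "\<not> py z ta > 0"
    then show False using dec[of ta t1] order t1 ta by auto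
  qed
  have yb: "py z tb < 0"
  proof (rule ccontr)
    assume "\<not> py z tb < 0"
    then show False using inc[of t1 tb] order t1 tb by auto
  qed
  have top: "py z t > 0" if "0 \<le> t" "t \<le> ta" for t
    using py_sign[OF z, of t ta] ya that order by (cases "t = ta") force+
  have bot: "py z t < 0" if "tb \<le> t" "t \<le> ret z" for t
    using py_sign[OF z, of tb t] yb that order by (cases "t = tb") force+
  have mid: "px z t > a0" if "ta < t" "t < tb" for t
  proof (cases "py z t \<ge> 0")
    case True
    then show ?thesis using inc[of ta t] that order ta by auto
  next
    case False
    then show ?thesis using dec[of t tb] that order tb by auto
  qed
  have out: "ta < t \<and> t < tb" if "0 \<le> t" "t \<le> ret z" "px z t > a0" for t
  proof (rule ccontr)
    assume "\<not> (ta < t \<and> t < tb)"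
    then consider "t < ta" | "t = ta" | "t = tb" | "tb < t" by linarith
    then show False
    proof cases
      case 1 then show False using inc[of t ta] ya ta that order by auto
    next
      case 4 then show False using dec[of tb t] yb tb that order by auto
    qed (use that ta tb in auto)
  qed
  have 1: "\<forall>t. 0 \<le> t \<and> t \<le> ta \<longrightarrow> py z t > 0" by (intro allI impI top) (elim conjE; assumption)+
  have 2: "\<forall>t. tb \<le> t \<and> t \<le> ret z \<longrightarrow> py z t < 0" by (intro allI impI bot) (elim conjE; assumption)+
  have 3: "\<forall>t. ta < t \<and> t < tb \<longrightarrow> px z t > a0" by (intro allI impI mid) (elim conjE; assumption)+
  have 4: "\<forall>t. 0 \<le> t \<and> t \<le> ret z \<and> px z t > a0 \<longrightarrow> ta < t \<and> t < tb" by (intro allI impI out) (elim conjE; assumption)+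
  have "ta < tb" using order by simp
  with 1 2 3 4 order(1,4) ta(3) tb(3) have "crosses z ta tb"
    unfolding crosses_def by (intro conjI)
  then show ?thesis by (intro exI)
qed

lemma F_bounded_strip: "\<exists>k>0. \<forall>x. 0 \<le> x \<and> x \<le> a0 \<longrightarrow> \<bar>F x\<bar> \<le> k"
proof -
  have "bounded (F ` {0..a0})"
    by (intro compact_imp_bounded compact_continuous_image continuous_F) auto
  then obtain b where b: "b > 0" "\<forall>v\<in>F ` {0..a0}. norm v \<le> b"
    unfolding bounded_pos by blast
  then show ?thesis by (intro exI[of _ b]) auto
qed

text \<open>Reaching \<open>x = a0\<close> costs a fixed amount \<open>e\<close> of potential
  energy, which a small \<open>z\<close> cannot pay. So small arcs stay in the strip and
  \<open>P_greater\<close> applies; \<open>z0\<close> is chosen to make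
  \<open>z * (z + k) \<le> e / 2\<close>.\<close>

lemma P_greater_small: "\<exists>z0>0. \<forall>z. 0 < z \<and> z \<le> z0 \<longrightarrow> P z > z"
proof -
  obtain k where k: "k > 0" "\<And>x. 0 \<le> x \<Longrightarrow> x \<le> a0 \<Longrightarrow> \<bar>F x\<bar> \<le> k" using F_bounded_strip by blast
  define e where "e = \<epsilon> * a0^4 / 4"
  have e: "e > 0" using eps a0_pos by (simp add: e_def)
  define z0 where "z0 = min 1 (e / (2 * (1 + k)))"
  have z0: "z0 > 0" using e k by (simp add: z0_def)
  have "P z > z" if z: "0 < z" "z \<le> z0" for z
  proof (rule P_greater[OF z(1)], rule ccontr)
    fix t assume t: "0 \<le> t" "t \<le> ret z" "\<not> px z t \<le> a0"
    then have "px z t > a0" by simp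
    from crossing_structure[OF z(1) t(1,2) this] obtain ta tb where c: "crosses z ta tb" by (elim exE)
    note ta = crossesD(1-4)[OF c] and top = crossesD(6)[OF c] and out = crossesD(9)[OF c]
    \<comment> \<open>In the strip \<open>y \<le> z + k\<close>, so potential energy grows no faster
      than \<open>z + k\<close> times the rate at which the height falls; hence this combination
      does not increase.\<close>
    define \<Psi> where "\<Psi> = (\<lambda>t. pz z t * (z + k) + \<epsilon> * (px z t)^4 / 4)"
    have "\<Psi> ta \<le> \<Psi> 0"
    proof (rule DERIV_nonpos_imp_decreasing_open[of 0 ta \<Psi>])
      fix r assume r: "0 < r" "r < ta"
      have x: "px z r > 0" "px z r \<le> a0" using ret(2)[OF z(1), of r] out[of r] r ta by force+
      have "(\<Psi> has_real_derivative (- \<epsilon> * (px z r)^3) * (z + k) + \<epsilon> * (px z r)^3 * py z r) (at r)"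
        unfolding \<Psi>_def by (auto intro!: derivative_eq_intros sol_DERIV r)
      moreover have "(- \<epsilon> * (px z r)^3) * (z + k) + \<epsilon> * (px z r)^3 * py z r = (\<epsilon> * (px z r)^3) * (py z r - z - k)"
        by (simp add: algebra_simps)
      moreover have "py z r - z - k \<le> 0"
        using pz_decreasing[OF z(1), of 0 r] k(2)[of "px z r"] x r ta pz_0[of z] by (simp add: lz_def abs_le_iff)
      then have "(\<epsilon> * (px z r)^3) * (py z r - z - k) \<le> 0" using x eps by (intro mult_nonneg_nonpos) auto
      ultimately show "\<exists>y. (\<Psi> has_real_derivative y) (at r) \<and> y \<le> 0" by (intro exI[of _ "(\<epsilon> * (px z r)^3) * (py z r - z - k)"]) simp
    qed (use ta in \<open>auto simp: \<Psi>_def intro!: continuous_intros sol_continuous\<close>)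
    then have "py z ta * (z + k) + e \<le> z * (z + k)"
      using ta sol_0[of z] by (simp add: \<Psi>_def e_def lz_def)
    moreover have "py z ta * (z + k) > 0" using top[of ta] ta z k by simp
    ultimately have "e < z * (z + k)" by simp
    also have "\<dots> \<le> (e / (2 * (1 + k))) * (1 + k)"
      using z k e by (intro mult_mono) (auto simp: z0_def)
    also have "\<dots> = e / 2" using k by (simp add: field_simps)
    finally show False using e by simp
  qed
  then show ?thesis using z0 by blast
qed

text \<open>On the line \<open>x = 0\<close> the cross term of \<open>V\<close> vanishes and
  \<open>V = z^2 / 2\<close>. Forward invariance of the sublevel set through the starting point
  therefore bounds the return point. The choice of \<open>z\<close> ensures
  \<open>z^2 \<ge> z \<ge> 2 * C\<close>.\<close>

lemma P_le_large: "\<exists>z>Z. P z \<le> z"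
proof (rule V_stays_below)
  fix C assume C: "\<And>c f X t. C \<le> c \<Longrightarrow> (\<And>t. 0 \<le> t \<Longrightarrow> (X has_vector_derivative f (X t)) (at t within {0..})) \<Longrightarrow>
    (\<And>q. V q \<le> c \<Longrightarrow> f q = field q) \<Longrightarrow> V (X 0) \<le> c \<Longrightarrow> 0 \<le> t \<Longrightarrow> V (X t) \<le> c"
  define z where "z = max 1 (max (Z + 1) (2 * C))"
  have z: "z \<ge> 1" "z > Z" "z \<ge> 2 * C" by (auto simp: z_def)
  have "z * 1 \<le> z * z" using z by (intro mult_left_mono) auto
  then have "C \<le> z\<^sup>2 / 2" using z unfolding power2_eq_square by linarith
  have "V (sol z (ret z)) \<le> z\<^sup>2 / 2"
  proof (rule C[of "z\<^sup>2 / 2" "sol z" field])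
    show "(sol z has_vector_derivative field (sol z t)) (at t within {0..})" if "0 \<le> t" for t
      using sol[of z] that by (simp add: solution_on_def)
    show "V (sol z 0) \<le> z\<^sup>2 / 2" by (simp add: sol_0 V_def lz_def)
    show "0 \<le> ret z" using ret(1)[of z] z by simp
  qed (rule \<open>C \<le> z\<^sup>2 / 2\<close> refl)+
  then have "(P z)\<^sup>2 \<le> z\<^sup>2" using ret(3)[of z] z by (simp add: V_def lz_def)
  then have "P z \<le> z" by (rule power2_le_imp_le) (use z in simp)
  then show ?thesis using z by blast
qed

end

section \<open>Contraction of the half-return map\<close>

context lienard begin

text \<open>The time \<open>t\<close> is kept in the conclusion because it places the points of the
  graph on the orbit, which is what separates two such graphs through
  \<open>arcs_disjoint\<close>.\<close>

lemma top_graph: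
  assumes z: "z > 0" and c: "crosses z ta tb"
  shows "\<exists>Z. continuous_on {0..a0} Z \<and> Z 0 = z \<and> Z a0 = pz z ta \<and>
    (\<forall>x. 0 < x \<and> x < a0 \<longrightarrow> (\<exists>t. 0 \<le> t \<and> t \<le> ret z \<and> px z t = x \<and> pz z t = Z x) \<and> Z x - F x > 0 \<and>
      (Z has_real_derivative - (\<epsilon> * x^3) / (Z x - F x)) (at x))"
proof -
  note C = crossesD[OF c]
  define Q where "Q = (\<lambda>Z. continuous_on {0..a0} Z \<and> (\<forall>t. 0 \<le> t \<and> t \<le> ta \<longrightarrow> Z (px z t) = pz z t) \<and>
    (\<forall>u. 0 < u \<and> u < a0 \<longrightarrow> (\<exists>r. 0 < r \<and> r < ta \<and> px z r = u \<and> (Z has_real_derivative (- \<epsilon> * (px z r)^3) / py z r) (at u))))"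
  have "\<exists>Z. Q Z"
  proof (rule graph_over_increasing[of 0 ta "px z" "pz z" "py z" "\<lambda>r. - \<epsilon> * (px z r)^3"])
    show "0 < ta" by (rule C)
    show "continuous_on {0..ta} (pz z)" "continuous_on {0..ta} (px z)" by (auto intro!: sol_continuous)
    fix r assume r: "0 < r" "r < ta"
    show "(pz z has_real_derivative - \<epsilon> * (px z r)^3) (at r)" "(px z has_real_derivative py z r) (at r)"
      using sol_DERIV r by auto
    show "py z r > 0" using C(6) r by simp
  next
    fix h assume "continuous_on {px z 0..px z ta} h" "\<And>r. 0 \<le> r \<Longrightarrow> r \<le> ta \<Longrightarrow> h (px z r) = pz z r"
      "\<And>u. px z 0 < u \<Longrightarrow> u < px z ta \<Longrightarrow> \<exists>r>0. r < ta \<and> px z r = u \<and> (h has_real_derivative (- \<epsilon> * (px z r)^3) / py z r) (at u)"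
    then show ?thesis unfolding Q_def C(4) by (intro exI[of _ h]) (simp add: sol_0)
  qed
  then obtain Z where Z: "Q Z" ..
  have Zp: "Z (px z t) = pz z t" if "0 \<le> t" "t \<le> ta" for t using Z that by (auto simp: Q_def)
  have "(\<exists>t. 0 \<le> t \<and> t \<le> ret z \<and> px z t = x \<and> pz z t = Z x) \<and> Z x - F x > 0 \<and>
      (Z has_real_derivative - (\<epsilon> * x^3) / (Z x - F x)) (at x)" if x: "0 < x" "x < a0" for x
  proof -
    obtain r where r: "0 < r" "r < ta" "px z r = x" "(Z has_real_derivative (- \<epsilon> * (px z r)^3) / py z r) (at x)"
      using Z x by (auto simp: Q_def)
    have Zx: "Z x = pz z r" using Zp[of r] r by simp
    have y: "py z r = Z x - F x" using r(3) by (simp add: Zx lz_def)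
    have "py z r > 0" using C(6)[of r] r by simp
    then show ?thesis
      using r C(2,3) Zx by (intro conjI exI[of _ r]) (simp_all add: y)
  qed
  moreover have "Z 0 = z" using Zp[of 0] C(1) sol_0 pz_0 by simp
  moreover have "Z a0 = pz z ta" using Zp[of ta] C(1,4) by simp
  ultimately show ?thesis using Z unfolding Q_def by (intro exI[of _ Z]) simp
qed

lemma bottom_graph:
  assumes z: "z > 0" and c: "crosses z ta tb"
  shows "\<exists>Z. continuous_on {0..a0} Z \<and> Z 0 = - P z \<and> Z a0 = pz z tb \<and>
    (\<forall>x. 0 < x \<and> x < a0 \<longrightarrow> (\<exists>t. 0 \<le> t \<and> t \<le> ret z \<and> px z t = x \<and> pz z t = Z x) \<and> Z x - F x < 0 \<and>
      (Z has_real_derivative - (\<epsilon> * x^3) / (Z x - F x)) (at x))"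
proof -
  note C = crossesD[OF c]
  define Q where "Q = (\<lambda>Z. continuous_on {0..a0} Z \<and> (\<forall>t. tb \<le> t \<and> t \<le> ret z \<longrightarrow> Z (px z t) = pz z t) \<and>
    (\<forall>u. 0 < u \<and> u < a0 \<longrightarrow> (\<exists>r. tb < r \<and> r < ret z \<and> px z r = u \<and> (Z has_real_derivative (- \<epsilon> * (px z r)^3) / py z r) (at u))))"
  have tb0: "tb > 0" using C(1,2) by simp
  have "\<exists>Z. Q Z"
  proof (rule graph_over_decreasing[of tb "ret z" "px z" "pz z" "py z" "\<lambda>r. - \<epsilon> * (px z r)^3"])
    show "tb < ret z" by (rule C)
    show "continuous_on {tb..ret z} (pz z)" "continuous_on {tb..ret z} (px z)" using tb0 by (auto intro!: sol_continuous)
    fix r assume r: "tb < r" "r < ret z"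
    show "(pz z has_real_derivative - \<epsilon> * (px z r)^3) (at r)" "(px z has_real_derivative py z r) (at r)"
      using sol_DERIV r tb0 by auto
    show "py z r < 0" using C(7) r by simp
  next
    fix h assume "continuous_on {px z (ret z)..px z tb} h" "\<And>r. tb \<le> r \<Longrightarrow> r \<le> ret z \<Longrightarrow> h (px z r) = pz z r"
      "\<And>u. px z (ret z) < u \<Longrightarrow> u < px z tb \<Longrightarrow> \<exists>r>tb. r < ret z \<and> px z r = u \<and> (h has_real_derivative (- \<epsilon> * (px z r)^3) / py z r) (at u)"
    then show ?thesis unfolding Q_def C(5) by (intro exI[of _ h]) (simp add: ret(3)[OF z])
  qed
  then obtain Z where Z: "Q Z" ..
  have Zp: "Z (px z t) = pz z t" if "tb \<le> t" "t \<le> ret z" for t using Z that by (auto simp: Q_def)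
  have "(\<exists>t. 0 \<le> t \<and> t \<le> ret z \<and> px z t = x \<and> pz z t = Z x) \<and> Z x - F x < 0 \<and>
      (Z has_real_derivative - (\<epsilon> * x^3) / (Z x - F x)) (at x)" if x: "0 < x" "x < a0" for x
  proof -
    obtain r where r: "tb < r" "r < ret z" "px z r = x" "(Z has_real_derivative (- \<epsilon> * (px z r)^3) / py z r) (at x)"
      using Z x by (auto simp: Q_def)
    have Zx: "Z x = pz z r" using Zp[of r] r by simp
    have y: "py z r = Z x - F x" using r(3) by (simp add: Zx lz_def)
    have "py z r < 0" using C(7)[of r] r by simp
    then show ?thesis
      using r tb0 Zx by (intro conjI exI[of _ r]) (simp_all add: y)
  qed
  moreover have "Z 0 = - P z" using Zp[of "ret z"] C(3) ret(3)[OF z] pz_ret[OF z] by simp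
  moreover have "Z a0 = pz z tb" using Zp[of tb] C(3,5) by simp
  ultimately show ?thesis using Z unfolding Q_def by (intro exI[of _ Z]) simp
qed

lemma En_decreasing:
  assumes c: "crosses z ta tb" and t: "ta \<le> s" "s \<le> t" "t \<le> tb"
  shows "En (sol z t) \<le> En (sol z s)"
proof (rule DERIV_nonpos_imp_decreasing_open[OF t(2), of "\<lambda>t. En (sol z t)"])
  note C = crossesD[OF c]
  fix r assume r: "s < r" "r < t"
  have x: "px z r > a0" using C(8)[of r] r t by simp
  have "- \<epsilon> * (px z r)^3 * F (px z r) \<le> 0"
    using x a0_pos eps F_nonneg[of "px z r"] by (intro mult_nonpos_nonneg) auto
  moreover have "r > 0" using r t C(1) by simp
  ultimately show "\<exists>y. ((\<lambda>t. En (sol z t)) has_real_derivative y) (at r) \<and> y \<le> 0"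
    using En_DERIV[of r z] by (intro exI[of _ "- \<epsilon> * (px z r)^3 * F (px z r)"]) simp
next
  show "continuous_on {s..t} (\<lambda>t. En (sol z t))"
    using crossesD(1)[OF c] t by (intro En_continuous) auto
qed

text \<open>Halfway through the excursion of the inner arc, the outer arc is even farther to the
  right at the same height.\<close>

lemma crosses_larger:
  assumes z: "0 < z1" "z1 < z2" and c: "crosses z1 ta tb"
  shows "\<exists>ta tb. crosses z2 ta tb"
proof -
  note C = crossesD[OF c]
  have z2: "z2 > 0" using z by simp
  define t where "t = (ta + tb) / 2"
  have t: "ta < t" "t < tb" using C(2) by (auto simp: t_def)
  have t': "0 < t" "t < ret z1" using t C(1,3) by auto
  define u where "u = pz z1 t"
  have u: "- P z1 \<le> u" "u \<le> z1"
    using pz_decreasing[OF z(1), of 0 t] pz_decreasing[OF z(1), of t "ret z1"] t' pz_0 pz_ret[OF z(1)]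
    by (auto simp: u_def)
  have "a0 < px z1 t" using C(8) t by simp
  also have "\<dots> = hz z1 u" using hz(2)[OF z(1), of t] t' by (simp add: u_def)
  also have "\<dots> < hz z2 u" by (rule P_strict_mono(2)[OF z u])
  finally have a: "a0 < hz z2 u" .
  have "- P z2 \<le> u" "u \<le> z2" using u P_strict_mono(1)[OF z] z by auto
  then obtain t2 where "0 \<le> t2" "t2 \<le> ret z2" "px z2 t2 = hz z2 u" using hz(3)[OF z2, of u] by auto
  then show ?thesis using crossing_structure[OF z2, of t2] a by simp
qed

text \<open>At \<open>x = a0\<close> and at \<open>x = 0\<close> two arcs have equal potential
  energy, so differences of energy there are differences of \<open>z^2 / 2\<close> and the three
  pieces can be added up. The strict inequality comes from the middle piece alone, where
  \<open>F\<close> is strictly increasing.\<close>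

lemma P_contraction:
  assumes z: "0 < z1" "z1 < z2" and c1: "crosses z1 ta1 tb1"
  shows "(P z2)\<^sup>2 - (P z1)\<^sup>2 < z2\<^sup>2 - z1\<^sup>2"
proof -
  have z2: "z2 > 0" and ne: "z1 \<noteq> z2" using z by auto
  obtain ta2 tb2 where c2: "crosses z2 ta2 tb2" using crosses_larger[OF z c1] by blast
  note C1 = crossesD[OF c1] and C2 = crossesD[OF c2]
  note mono = P_strict_mono[OF z]
  obtain T1 where T1: "continuous_on {0..a0} T1" "T1 0 = z1" "T1 a0 = pz z1 ta1"
    "\<And>x. 0 < x \<Longrightarrow> x < a0 \<Longrightarrow> (\<exists>t. 0 \<le> t \<and> t \<le> ret z1 \<and> px z1 t = x \<and> pz z1 t = T1 x) \<and> T1 x - F x > 0 \<and>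
      (T1 has_real_derivative - (\<epsilon> * x^3) / (T1 x - F x)) (at x)"
    using top_graph[OF z(1) c1] by (elim exE conjE) simp
  obtain T2 where T2: "continuous_on {0..a0} T2" "T2 0 = z2" "T2 a0 = pz z2 ta2"
    "\<And>x. 0 < x \<Longrightarrow> x < a0 \<Longrightarrow> (\<exists>t. 0 \<le> t \<and> t \<le> ret z2 \<and> px z2 t = x \<and> pz z2 t = T2 x) \<and> T2 x - F x > 0 \<and>
      (T2 has_real_derivative - (\<epsilon> * x^3) / (T2 x - F x)) (at x)"
    using top_graph[OF z2 c2] by (elim exE conjE) simp
  obtain B1 where B1: "continuous_on {0..a0} B1" "B1 0 = - P z1" "B1 a0 = pz z1 tb1"
    "\<And>x. 0 < x \<Longrightarrow> x < a0 \<Longrightarrow> (\<exists>t. 0 \<le> t \<and> t \<le> ret z1 \<and> px z1 t = x \<and> pz z1 t = B1 x) \<and> B1 x - F x < 0 \<and>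
      (B1 has_real_derivative - (\<epsilon> * x^3) / (B1 x - F x)) (at x)"
    using bottom_graph[OF z(1) c1] by (elim exE conjE) simp
  obtain B2 where B2: "continuous_on {0..a0} B2" "B2 0 = - P z2" "B2 a0 = pz z2 tb2"
    "\<And>x. 0 < x \<Longrightarrow> x < a0 \<Longrightarrow> (\<exists>t. 0 \<le> t \<and> t \<le> ret z2 \<and> px z2 t = x \<and> pz z2 t = B2 x) \<and> B2 x - F x < 0 \<and>
      (B2 has_real_derivative - (\<epsilon> * x^3) / (B2 x - F x)) (at x)"
    using bottom_graph[OF z2 c2] by (elim exE conjE) simp
  have disj: "Y2 \<noteq> Y1" if e: "\<exists>t. 0 \<le> t \<and> t \<le> ret z1 \<and> px z1 t = x \<and> pz z1 t = Y1"
      "\<exists>t. 0 \<le> t \<and> t \<le> ret z2 \<and> px z2 t = x \<and> pz z2 t = Y2" for x Y1 Y2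
  proof
    assume eq: "Y2 = Y1"
    obtain t1 where t1: "0 \<le> t1" "t1 \<le> ret z1" "px z1 t1 = x" "pz z1 t1 = Y1" using e(1) by blast
    obtain t2 where t2: "0 \<le> t2" "t2 \<le> ret z2" "px z2 t2 = x" "pz z2 t2 = Y2" using e(2) by blast
    have "sol z1 t1 = sol z2 t2" using t1(3,4) t2(3,4) eq by (simp add: prod_eq_iff lz_def)
    then show False using arcs_disjoint[OF z(1) z2 ne t1(1,2) t2(1,2)] by simp
  qed
  have above: "0 < D x" if D: "continuous_on {0..a0} D" "D 0 > 0" "\<And>x. 0 < x \<Longrightarrow> x < a0 \<Longrightarrow> D x \<noteq> 0" and x: "0 < x" "x < a0"
    for D :: "real \<Rightarrow> real" and x
  proof (rule ccontr)
    assume n: "\<not> 0 < D x"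
    have "continuous_on {0..x} D" by (rule continuous_on_subset[OF D(1)]) (use x in auto)
    then obtain v where v: "0 \<le> v" "v \<le> x" "D v = 0" using IVT2'[of D x 0 0] n D(2) x by auto
    then have "v \<noteq> 0" using D(2) by auto
    then show False using D(3)[of v] v x by simp
  qed
  have T12: "T1 x < T2 x" if x: "0 < x" "x < a0" for x
  proof -
    have "0 < (\<lambda>x. T2 x - T1 x) x"
    proof (rule above[OF _ _ _ x])
      show "continuous_on {0..a0} (\<lambda>x. T2 x - T1 x)" by (intro continuous_intros T1 T2)
      show "0 < T2 0 - T1 0" using T1(2) T2(2) z by simp
      fix y assume y: "0 < y" "y < a0"
      show "T2 y - T1 y \<noteq> 0" using disj[of y "T1 y" "T2 y"] T1(4)[OF y] T2(4)[OF y] by simp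
    qed
    then show ?thesis by simp
  qed
  have B12: "B2 x < B1 x" if x: "0 < x" "x < a0" for x
  proof -
    have "0 < (\<lambda>x. B1 x - B2 x) x"
    proof (rule above[OF _ _ _ x])
      show "continuous_on {0..a0} (\<lambda>x. B1 x - B2 x)" by (intro continuous_intros B1 B2)
      show "0 < B1 0 - B2 0" using B1(2) B2(2) mono(1) by simp
      fix y assume y: "0 < y" "y < a0"
      show "B1 y - B2 y \<noteq> 0" using disj[of y "B1 y" "B2 y"] B1(4)[OF y] B2(4)[OF y] by simp
    qed
    then show ?thesis by simp
  qed
  have top: "(T2 a0)\<^sup>2 - (T1 a0)\<^sup>2 \<le> z2\<^sup>2 - z1\<^sup>2"
  proof -
    have "(T2 a0)\<^sup>2 - (T1 a0)\<^sup>2 \<le> (T2 0)\<^sup>2 - (T1 0)\<^sup>2"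
    proof (rule strip_compare[where F = F and g = "\<lambda>x. \<epsilon> * x^3"])
      fix x assume x: "0 < x" "x < a0"
      show "0 < (T1 x - F x) * (T2 x - F x)" using T1(4)[OF x] T2(4)[OF x] by (intro mult_pos_pos) simp_all
      show "0 \<le> \<epsilon> * x^3" using eps x by simp
      show "F x \<le> 0" using F_neg[OF x] by simp
      show "T1 x < T2 x" by (rule T12[OF x])
      show "(T1 has_real_derivative - (\<epsilon> * x^3) / (T1 x - F x)) (at x)" using T1(4)[OF x] by simp
      show "(T2 has_real_derivative - (\<epsilon> * x^3) / (T2 x - F x)) (at x)" using T2(4)[OF x] by simp
    qed (use a0_pos T1(1) T2(1) in simp_all)
    then show ?thesis using T1(2) T2(2) by simp
  qed
  have bot: "(P z2)\<^sup>2 - (P z1)\<^sup>2 \<le> (B2 a0)\<^sup>2 - (B1 a0)\<^sup>2"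
  proof -
    have "(B1 a0)\<^sup>2 - (B2 a0)\<^sup>2 \<le> (B1 0)\<^sup>2 - (B2 0)\<^sup>2"
    \<comment> \<open>On the lower limbs the outer arc \<open>B2\<close> is the smaller graph, so it
      takes the place of \<open>Z1\<close>.\<close>
    proof (rule strip_compare[where F = F and g = "\<lambda>x. \<epsilon> * x^3"])
      fix x assume x: "0 < x" "x < a0"
      show "0 < (B2 x - F x) * (B1 x - F x)" using B1(4)[OF x] B2(4)[OF x] by (intro mult_neg_neg) simp_all
      show "0 \<le> \<epsilon> * x^3" using eps x by simp
      show "F x \<le> 0" using F_neg[OF x] by simp
      show "B2 x < B1 x" by (rule B12[OF x])
      show "(B1 has_real_derivative - (\<epsilon> * x^3) / (B1 x - F x)) (at x)" using B1(4)[OF x] by simp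
      show "(B2 has_real_derivative - (\<epsilon> * x^3) / (B2 x - F x)) (at x)" using B2(4)[OF x] by simp
    qed (use a0_pos B1(1) B2(1) in simp_all)
    then show ?thesis using B1(2) B2(2) by simp
  qed
  \<comment> \<open>Heights at which the inner arc enters and leaves \<open>x > a0\<close>. The
    outer arc is beyond \<open>a0\<close> at all heights between them, so both can be compared over
    this interval.\<close>
  define \<zeta> \<theta> where "\<zeta> = pz z1 ta1" "\<theta> = pz z1 tb1"
  have \<theta>\<zeta>: "\<theta> < \<zeta>" "- P z1 < \<theta>" "\<zeta> < z1"
    using pz_decreasing[OF z(1), of ta1 tb1] pz_decreasing[OF z(1), of 0 ta1] pz_decreasing[OF z(1), of tb1 "ret z1"]
      C1(1-3) pz_0 pz_ret[OF z(1)] by (auto simp: \<zeta>_\<theta>_def)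
  have h1: "hz z1 u \<ge> a0" if u: "\<theta> \<le> u" "u \<le> \<zeta>" for u
  proof -
    obtain t where t: "0 \<le> t" "t \<le> ret z1" "pz z1 t = u" "px z1 t = hz z1 u"
      using hz(3)[OF z(1), of u] u \<theta>\<zeta> by auto
    have "ta1 \<le> t" using pz_decreasing[OF z(1), of t ta1] t u C1(1-3) by (force simp: \<zeta>_\<theta>_def)
    moreover have "t \<le> tb1" using pz_decreasing[OF z(1), of tb1 t] t u C1(1-3) by (force simp: \<zeta>_\<theta>_def)
    ultimately show ?thesis using C1(4,5) C1(8)[of t] t(4) by (cases "t = ta1"; cases "t = tb1") auto
  qed
  have hend: "hz z1 \<zeta> = a0" "hz z1 \<theta> = a0"
    using hz(2)[OF z(1), of ta1] hz(2)[OF z(1), of tb1] C1(1-5) by (auto simp: \<zeta>_\<theta>_def)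
  \<comment> \<open>At equal height the kinetic parts agree, so this is the energy difference of the
    two arcs. Since \<open>\<epsilon> * x^3 * dx/dz = F x - z\<close>, the height drops out of its
    derivative, which is \<open>F q - F p > 0\<close>. Time runs from \<zeta> down to \<theta>, so
    the outer arc loses more.\<close>
  define D where "D = (\<lambda>u. \<epsilon> * (hz z2 u)^4 / 4 - \<epsilon> * (hz z1 u)^4 / 4)"
  have "D \<theta> < D \<zeta>"
  proof (rule DERIV_pos_imp_increasing_open[OF \<theta>\<zeta>(1), of D])
    fix u assume u: "\<theta> < u" "u < \<zeta>"
    have u1: "- P z1 < u" "u < z1" and u2: "- P z2 < u" "u < z2" using u \<theta>\<zeta> mono(1) z by auto
    define p q where "p = hz z1 u" "q = hz z2 u"
    have pq: "p > 0" "q > 0" "a0 \<le> p" "p < q"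
      using hz(4)[OF z(1) u1] hz(4)[OF z2 u2] h1[of u] u mono(2)[of u] u1 by (auto simp: p_q_def)
    have "(D has_real_derivative (\<epsilon> * q^3 * ((F q - u) / (\<epsilon> * q^3)) - \<epsilon> * p^3 * ((F p - u) / (\<epsilon> * p^3)))) (at u)"
    proof -
      have "((\<lambda>u. \<epsilon> * (h u)^4 / 4) has_real_derivative \<epsilon> * (h u)^3 * d) (at u)"
        if "(h has_real_derivative d) (at u)" for h d
        by (rule DERIV_cong[OF DERIV_cdivide[OF DERIV_cmult[OF DERIV_power[OF that]]]]) simp
      from DERIV_diff[OF this[OF hz(5)[OF z2 u2]] this[OF hz(5)[OF z(1) u1]]]
      show ?thesis unfolding D_def p_q_def .
    qed
    moreover have "\<epsilon> * q^3 * ((F q - u) / (\<epsilon> * q^3)) - \<epsilon> * p^3 * ((F p - u) / (\<epsilon> * p^3)) = F q - F p"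
      using pq eps by simp
    moreover have "F q - F p > 0" using F_strict_mono[OF pq(3,4)] by simp
    ultimately show "\<exists>y. (D has_real_derivative y) (at u) \<and> 0 < y" by (intro exI[of _ "F q - F p"]) simp
  next
    show "continuous_on {\<theta>..\<zeta>} D"
      unfolding D_def
      by (intro continuous_intros continuous_on_subset[OF hz(1)[OF z(1)]] continuous_on_subset[OF hz(1)[OF z2]])
        (use \<theta>\<zeta> mono(1) z in auto)
  qed
  have arc2: "\<exists>t. ta2 \<le> t \<and> t \<le> tb2 \<and> En (sol z2 t) = u\<^sup>2 / 2 + \<epsilon> * (hz z2 u)^4 / 4"
    if u: "\<theta> \<le> u" "u \<le> \<zeta>" for u
  proof -
    have "- P z2 \<le> u" "u \<le> z2" using u \<theta>\<zeta> mono(1) z by auto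
    then obtain t where t: "0 \<le> t" "t \<le> ret z2" "pz z2 t = u" "px z2 t = hz z2 u"
      using hz(3)[OF z2, of u] by auto
    have "hz z2 u > a0" using h1[OF u] mono(2)[of u] u \<theta>\<zeta> by simp
    then have "ta2 < t \<and> t < tb2" using C2(9)[of t] t by simp
    then show ?thesis using t(3,4) by (intro exI[of _ t]) (simp add: En_def)
  qed
  obtain s where s: "ta2 \<le> s" "s \<le> tb2" "En (sol z2 s) = \<zeta>\<^sup>2 / 2 + \<epsilon> * (hz z2 \<zeta>)^4 / 4"
    using arc2[of \<zeta>] \<theta>\<zeta> by auto
  obtain r where r: "ta2 \<le> r" "r \<le> tb2" "En (sol z2 r) = \<theta>\<^sup>2 / 2 + \<epsilon> * (hz z2 \<theta>)^4 / 4"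
    using arc2[of \<theta>] \<theta>\<zeta> by auto
  \<comment> \<open>The outer arc's excursion also includes pieces before height \<zeta> and after
    height \<theta>; its energy does not increase there, which only adds to the loss.\<close>
  have "En (sol z2 s) \<le> (T2 a0)\<^sup>2 / 2 + \<epsilon> * a0^4 / 4"
    using En_decreasing[OF c2 order_refl s(1,2)] C2(4) T2(3) by (simp add: En_def)
  moreover have "(B2 a0)\<^sup>2 / 2 + \<epsilon> * a0^4 / 4 \<le> En (sol z2 r)"
    using En_decreasing[OF c2 r(1,2) order_refl] C2(5) B2(3) by (simp add: En_def)
  moreover have "T1 a0 = \<zeta>" "B1 a0 = \<theta>" using T1(3) B1(3) by (simp_all add: \<zeta>_\<theta>_def)
  ultimately have "(B2 a0)\<^sup>2 - (B1 a0)\<^sup>2 < (T2 a0)\<^sup>2 - (T1 a0)\<^sup>2"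
    using \<open>D \<theta> < D \<zeta>\<close> s(3) r(3) by (simp add: D_def hend)
  then show ?thesis using top bot by simp
qed

section \<open>Continuity of the half-return map\<close>

lemma ret_near:
  assumes z: "z > 0" and \<eta>: "\<eta> > 0"
  shows "\<exists>r>0. \<forall>w. \<bar>w - z\<bar> < r \<longrightarrow> w > 0 \<and> \<bar>ret w - ret z\<bar> < \<eta>"
proof -
  note R = ret[OF z]
  have "py z (ret z) < 0" using R(3,4) by simp
  \<comment> \<open>The return is transversal, so shortly after it \<open>x\<close> is strictly
    negative, a property that survives small perturbations.\<close>
  from DERIV_neg_dec_right[OF sol_DERIV(1)[OF R(1)] this]
  obtain e where e: "e > 0" "\<And>h. h > 0 \<Longrightarrow> h < e \<Longrightarrow> px z (ret z + h) < px z (ret z)" by blast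
  define h where "h = min (e / 2) (min (\<eta> / 2) (ret z / 2))"
  have h: "h > 0" "h < e" "h < \<eta>" "h < ret z" using e(1) \<eta> R(1) by (auto simp: h_def)
  have neg: "px z (ret z + h) < 0" using e(2)[OF h(1,2)] R(3) by simp
  define s where "s = ret z - h"
  have s: "s > 0" "s < ret z" using h by (auto simp: s_def)
  have "eventually (\<lambda>t. py z t > z / 2) (at 0 within {0..})"
  proof (rule order_tendstoD)
    have "(py z \<longlongrightarrow> py z 0) (at 0 within {0..})"
      using sol_continuous(2)[of "{0..}" z] unfolding continuous_on_def by simp
    then show "(py z \<longlongrightarrow> z) (at 0 within {0..})" by (simp add: sol_0)
  qed (use z in simp)
  then obtain d where d: "d > 0" "\<And>t. 0 < t \<Longrightarrow> t < d \<Longrightarrow> py z t > z / 2"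
    by (auto simp: eventually_at dist_real_def)
  define \<delta> where "\<delta> = min (d / 2) s"
  have \<delta>: "0 < \<delta>" "\<delta> < d" "\<delta> \<le> s" using d s by (auto simp: \<delta>_def)
  have "\<exists>x\<in>{\<delta>..s}. \<forall>y\<in>{\<delta>..s}. px z x \<le> px z y"
    by (rule continuous_attains_inf) (use \<delta> in \<open>auto intro!: sol_continuous\<close>)
  then obtain xm where xm: "xm \<in> {\<delta>..s}" "\<And>y. y \<in> {\<delta>..s} \<Longrightarrow> px z xm \<le> px z y" by blast
  define m where "m = px z xm"
  have m: "m > 0" using R(2)[of xm] xm(1) \<delta> s by (simp add: m_def)
  \<comment> \<open>A margin for three phases. Up to \<delta>, where \<open>x\<close> itself is too
    close to 0, closeness of \<open>y\<close> keeps \<open>x\<close> increasing; up to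
    \<open>s\<close>, \<open>x\<close> is at least \<open>m\<close>; at \<open>ret z + h\<close> it
    is negative. The perturbed return time is thus caught between \<open>s\<close> and
    \<open>ret z + h\<close>.\<close>
  define \<kappa> where "\<kappa> = min (z / 2) (min m (- px z (ret z + h)))"
  have \<kappa>: "\<kappa> > 0" "\<kappa> \<le> z / 2" "\<kappa> \<le> m" "\<kappa> \<le> - px z (ret z + h)" using z m neg by (auto simp: \<kappa>_def)
  show ?thesis
  proof (rule continuous_dependence[of "z + 1" "ret z + h"])
    fix C :: real assume C: "C > 0" "\<And>X Y t. solution_on field {0..} X \<Longrightarrow> solution_on field {0..} Y \<Longrightarrow>
      norm (X 0) \<le> z + 1 \<Longrightarrow> norm (Y 0) \<le> z + 1 \<Longrightarrow> t \<in> {0..ret z + h} \<Longrightarrow> dist (X t) (Y t) \<le> C * dist (X 0) (Y 0)"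
    define r where "r = min (min 1 z) (\<kappa> / C)"
    have r: "r > 0" using z \<kappa> C by (simp add: r_def)
    have "w > 0 \<and> \<bar>ret w - ret z\<bar> < \<eta>" if w: "\<bar>w - z\<bar> < r" for w
    proof -
      have w0: "w > 0" "\<bar>w\<bar> \<le> z + 1" using w by (auto simp: r_def)
      have close: "dist (sol w t) (sol z t) < \<kappa>" if "0 \<le> t" "t \<le> ret z + h" for t
      proof -
        have "dist (sol w t) (sol z t) \<le> C * dist (sol w 0) (sol z 0)"
          by (rule C(2)[OF sol sol]) (use w0 z that in \<open>auto simp: sol_0 norm_Pair\<close>)
        also have "\<dots> = C * \<bar>w - z\<bar>" by (simp add: sol_0 dist_Pair_Pair dist_real_def)
        also have "\<dots> < C * (\<kappa> / C)" using C(1) w by (intro mult_strict_left_mono) (auto simp: r_def)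
        finally show ?thesis using C(1) by simp
      qed
      have cx: "\<bar>px w t - px z t\<bar> < \<kappa>" and cy: "\<bar>py w t - py z t\<bar> < \<kappa>" if "0 \<le> t" "t \<le> ret z + h" for t
        using close[OF that] dist_fst_le[of "sol w t" "sol z t"] dist_snd_le[of "sol w t" "sol z t"]
        by (auto simp: dist_real_def)
      have early: "px w t > 0" if t: "0 < t" "t \<le> \<delta>" for t
      proof -
        have "px w 0 < px w t"
        proof (rule DERIV_pos_imp_increasing_open[OF t(1), of "px w"])
          fix v assume v: "0 < v" "v < t"
          have "py w v > 0" using cy[of v] d(2)[of v] v t \<delta> s h \<kappa> by simp
          then show "\<exists>y. (px w has_real_derivative y) (at v) \<and> 0 < y"
            using sol_DERIV(1)[OF v(1)] by (intro exI[of _ "py w v"]) simp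
        qed (auto intro!: sol_continuous)
        then show ?thesis by (simp add: sol_0)
      qed
      have mid: "px w t > 0" if t: "\<delta> \<le> t" "t \<le> s" for t
        using cx[of t] xm(2)[of t] t \<delta> s h \<kappa> by (simp add: m_def)
      have late: "px w (ret z + h) < 0" using cx[of "ret z + h"] R(1) h \<kappa> by simp
      note Rw = ret[OF w0(1)]
      have "ret w > s"
      proof (rule ccontr)
        assume "\<not> s < ret w"
        then have "px w (ret w) > 0" using early[of "ret w"] mid[of "ret w"] Rw(1) by (cases "ret w \<le> \<delta>") auto
        then show False using Rw(3) by simp
      qed
      moreover have "ret w < ret z + h"
      proof (rule ccontr)
        assume "\<not> ret w < ret z + h"
        then show False using px_nonneg[OF w0(1), of "ret z + h"] late R(1) h by simp
      qed
      ultimately show ?thesis using w0 h by (auto simp: s_def)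
    qed
    then show ?thesis using r by blast
  qed
qed

lemma isCont_ret: "z > 0 \<Longrightarrow> isCont ret z"
  unfolding continuous_at_eps_delta using ret_near by (fastforce simp: dist_real_def)

lemma isCont_P:
  assumes z: "z > 0"
  shows "isCont P z"
proof (rule continuous_dependence[of "z + 1" "ret z + 1"])
  fix C :: real assume C: "C > 0" "\<And>X Y t. solution_on field {0..} X \<Longrightarrow> solution_on field {0..} Y \<Longrightarrow>
      norm (X 0) \<le> z + 1 \<Longrightarrow> norm (Y 0) \<le> z + 1 \<Longrightarrow> t \<in> {0..ret z + 1} \<Longrightarrow> dist (X t) (Y t) \<le> C * dist (X 0) (Y 0)"
  obtain r where r: "r > 0" "\<And>w. \<bar>w - z\<bar> < r \<Longrightarrow> w > 0 \<and> \<bar>ret w - ret z\<bar> < 1" using ret_near[OF z, of 1] by auto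
  have "isCont (py z) (ret z)" using sol_DERIV(2)[OF ret(1)[OF z]] by (rule DERIV_isCont)
  then have lim: "((\<lambda>w. py z (ret w)) \<longlongrightarrow> py z (ret z)) (at z)"
    using isCont_ret[OF z, unfolded isCont_def] by (rule isCont_tendsto_compose)
  \<comment> \<open>Both the solution and the evaluation time depend on \<open>w\<close>. Here the
    time is the same in both terms, and the Lipschitz bound is uniform up to
    \<open>ret z + 1\<close>; the change of time within the fixed solution is
    \<open>lim\<close>.\<close>
  have "((\<lambda>w. py w (ret w) - py z (ret w)) \<longlongrightarrow> 0) (at z)"
  proof (rule Lim_null_comparison)
    show "((\<lambda>w. C * \<bar>w - z\<bar>) \<longlongrightarrow> 0) (at z)" by (auto intro!: tendsto_eq_intros)
    show "\<forall>\<^sub>F w in at z. norm (py w (ret w) - py z (ret w)) \<le> C * \<bar>w - z\<bar>"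
      unfolding eventually_at
    proof (intro exI[of _ "min r 1"] conjI ballI impI)
      fix w assume "w \<noteq> z \<and> dist w z < min r 1"
      then have w: "\<bar>w - z\<bar> < r" "\<bar>w - z\<bar> < 1" by (auto simp: dist_real_def)
      have w0: "w > 0" "\<bar>ret w - ret z\<bar> < 1" using r(2)[OF w(1)] by auto
      have "\<bar>py w (ret w) - py z (ret w)\<bar> \<le> dist (sol w (ret w)) (sol z (ret w))"
        using dist_snd_le[of "sol w (ret w)" "sol z (ret w)"] by (simp add: dist_real_def)
      also have "\<dots> \<le> C * dist (sol w 0) (sol z 0)"
        by (rule C(2)[OF sol sol]) (use w w0 z ret(1)[OF w0(1)] in \<open>auto simp: sol_0 norm_Pair\<close>)
      finally show "norm (py w (ret w) - py z (ret w)) \<le> C * \<bar>w - z\<bar>"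
        by (simp add: sol_0 dist_Pair_Pair dist_real_def)
    qed (use r in simp)
  qed
  from tendsto_add[OF this lim] have "((\<lambda>w. py w (ret w)) \<longlongrightarrow> py z (ret z)) (at z)" by simp
  from tendsto_minus[OF this] show ?thesis unfolding isCont_def P_def .
qed

section \<open>Fixed point and iterates of the half-return map\<close>

lemma fixed_point_exists: "\<exists>p>0. P p = p"
proof -
  obtain z0 where z0: "z0 > 0" "\<And>z. 0 < z \<Longrightarrow> z \<le> z0 \<Longrightarrow> P z > z" using P_greater_small by blast
  obtain z1 where z1: "z1 > z0" "P z1 \<le> z1" using P_le_large by blast
  have "\<exists>x\<ge>z0. x \<le> z1 \<and> (\<lambda>z. P z - z) x = 0"
  proof (rule IVT2'[of "\<lambda>z. P z - z"])
    show "continuous_on {z0..z1} (\<lambda>z. P z - z)"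
      by (rule continuous_at_imp_continuous_on) (use isCont_P z0 in \<open>auto intro!: continuous_intros\<close>)
  qed (use z0 z1 in \<open>auto simp: less_imp_le\<close>)
  then obtain x where "z0 \<le> x" "P x - x = 0" by auto
  then show ?thesis using z0(1) by (intro exI[of _ x]) simp
qed

definition pf :: real where "pf = (SOME p. p > 0 \<and> P p = p)"

lemma pf_pos: "pf > 0" and P_pf: "P pf = pf"
  using someI_ex[OF fixed_point_exists] unfolding pf_def by auto

lemma not_crosses_P_greater:
  assumes z: "z > 0" and n: "\<nexists>ta tb. crosses z ta tb"
  shows "P z > z"
proof (rule P_greater[OF z], rule ccontr)
  fix t assume t: "0 \<le> t" "t \<le> ret z" "\<not> px z t \<le> a0"
  then have "px z t > a0" by simp
  from crossing_structure[OF z t(1,2) this] n show False by simp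
qed

lemma P_below: assumes "0 < z" "z < pf" shows "z < P z" "P z < pf"
proof -
  show "P z < pf" using P_strict_mono(1)[OF assms] by (simp add: P_pf)
  show "z < P z"
  \<comment> \<open>The contraction estimate asks the inner arc, here that of \<open>z\<close>, to
    pass beyond \<open>a0\<close>; an arc that does not do so gains energy outright.\<close>
  proof (cases "\<exists>ta tb. crosses z ta tb")
    case True
    then obtain ta tb where "crosses z ta tb" by blast
    from P_contraction[OF assms this] have "z\<^sup>2 < (P z)\<^sup>2" by (simp add: P_pf)
    then show ?thesis using ret(4)[OF assms(1)] by (simp add: power2_less_imp_less)
  next
    case False
    then show ?thesis using not_crosses_P_greater[OF assms(1)] by simp
  qed
qed

lemma P_above: assumes "pf < z" shows "pf < P z" "P z < z"
proof -
  show "pf < P z" using P_strict_mono(1)[OF pf_pos assms] by (simp add: P_pf)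
  \<comment> \<open>Now the inner arc is that of \<open>pf\<close>. It must pass beyond
    \<open>a0\<close>, as otherwise \<open>P pf > pf\<close>.\<close>
  have "\<exists>ta tb. crosses pf ta tb"
    using not_crosses_P_greater[OF pf_pos] P_pf by fastforce
  then obtain ta tb where "crosses pf ta tb" by blast
  from P_contraction[OF pf_pos assms this] have "(P z)\<^sup>2 < z\<^sup>2" by (simp add: P_pf)
  then show "P z < z" by (rule power2_less_imp_less) (use assms pf_pos in simp)
qed

lemma P_fixed_unique: assumes "z > 0" "P z = z" shows "z = pf"
  using P_below[of z] P_above[of z] assms by (cases z pf rule: linorder_cases) auto

text \<open>Keeps successive section points inside a given neighbourhood of \<open>pf\<close> in the
  stability argument; convergence is a separate matter.\<close>

lemma P_closer: assumes "z > 0" shows "P z > 0" "\<bar>P z - pf\<bar> \<le> \<bar>z - pf\<bar>"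
proof -
  show "P z > 0" by (rule ret(4)[OF assms])
  show "\<bar>P z - pf\<bar> \<le> \<bar>z - pf\<bar>"
    using P_below[of z] P_above[of z] P_pf assms by (cases z pf rule: linorder_cases) auto
qed

lemma iterates_pos: "z > 0 \<Longrightarrow> (P ^^ n) z > 0"
  by (induction n) (auto intro: P_closer)

lemma iterates_limit:
  assumes l: "l > 0" "(\<lambda>n. (P ^^ n) z) \<longlonglongrightarrow> l"
  shows "l = pf"
proof (rule P_fixed_unique[OF l(1)])
  have "(\<lambda>n. P ((P ^^ n) z)) \<longlonglongrightarrow> P l"
    by (rule isCont_tendsto_compose[OF isCont_P[OF l(1)] l(2)])
  moreover have "(\<lambda>n. P ((P ^^ n) z)) \<longlonglongrightarrow> l"
    using LIMSEQ_Suc[OF l(2)] by simp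
  ultimately show "P l = l" by (rule LIMSEQ_unique)
qed

text \<open>\<open>P\<close> preserves each side of \<open>pf\<close> and moves points towards it,
  so the iterates are monotone and bounded; by continuity their limit is a positive fixed
  point.\<close>

lemma iterates_tendsto:
  assumes z: "z > 0"
  shows "(\<lambda>n. (P ^^ n) z) \<longlonglongrightarrow> pf"
proof (cases "z \<le> pf")
  case True
  have le: "(P ^^ n) z \<le> pf" for n
  proof (induction n)
    case (Suc n)
    then show ?case using P_below[of "(P ^^ n) z"] P_pf iterates_pos[OF z, of n] by (cases "(P ^^ n) z = pf") auto
  qed (use True in simp)
  have inc: "incseq (\<lambda>n. (P ^^ n) z)"
  proof (rule incseq_SucI)
    fix n show "(P ^^ n) z \<le> (P ^^ Suc n) z"
      using le[of n] P_below[of "(P ^^ n) z"] P_pf iterates_pos[OF z, of n] by (cases "(P ^^ n) z = pf") auto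
  qed
  obtain l where l: "(\<lambda>n. (P ^^ n) z) \<longlonglongrightarrow> l" "\<forall>n. (P ^^ n) z \<le> l"
    by (rule incseq_convergent[OF inc, of pf]) (use le in auto)
  have "l > 0" using l(2)[rule_format, of 0] z by simp
  then show ?thesis using iterates_limit[OF _ l(1)] l(1) by simp
next
  case False
  have ge: "(P ^^ n) z \<ge> pf" for n
  proof (induction n)
    case (Suc n)
    then show ?case using P_above[of "(P ^^ n) z"] P_pf by (cases "(P ^^ n) z = pf") auto
  qed (use False in simp)
  have dec: "decseq (\<lambda>n. (P ^^ n) z)"
  proof (rule decseq_SucI)
    fix n show "(P ^^ Suc n) z \<le> (P ^^ n) z"
      using ge[of n] P_above[of "(P ^^ n) z"] P_pf by (cases "(P ^^ n) z = pf") auto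
  qed
  obtain l where l: "(\<lambda>n. (P ^^ n) z) \<longlonglongrightarrow> l" "\<forall>n. l \<le> (P ^^ n) z"
    by (rule decseq_convergent[OF dec, of pf]) (use ge in auto)
  have "l \<ge> pf" by (rule LIMSEQ_le_const[OF l(1)]) (use ge in auto)
  then have "l > 0" using pf_pos by simp
  then show ?thesis using iterates_limit[OF _ l(1)] l(1) by simp
qed

end

section \<open>The limit cycle\<close>

lemma periodic_multiple:
  fixes X :: "real \<Rightarrow> 'a"
  assumes "\<And>t. X (t + T) = X t"
  shows "X (t + real n * T) = X t"
proof (induction n)
  case (Suc n)
  have "X (t + real (Suc n) * T) = X ((t + real n * T) + T)" by (simp add: algebra_simps)
  then show ?case using Suc assms by simp
qed simp

lemma infdist_uminus:
  fixes S :: "'a::{real_normed_vector, heine_borel} set"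
  assumes S: "closed S" "S \<noteq> {}" "\<And>q. q \<in> S \<Longrightarrow> - q \<in> S"
  shows "infdist (- q) S = infdist q S"
proof -
  have "infdist (- q) S \<le> infdist q S" for q
  proof -
    obtain g where "g \<in> S" "infdist q S = dist q g" using infdist_attains_inf[OF S(1,2)] by blast
    then show ?thesis using infdist_le[OF S(3)[of g], of "- q"] by (simp add: dist_minus)
  qed
  from this[of q] this[of "- q"] show ?thesis by simp
qed

context lienard begin

section \<open>The periodic orbit through the fixed point\<close>

abbreviation "Y \<equiv> sol pf"
abbreviation "\<tau> \<equiv> ret pf"

text \<open>A forward orbit suffices, since after one period it has run through all its
  points.\<close>

definition cycle :: "(real \<times> real) set" where
  "cycle = Y ` {0..}"

lemmas tau_pos = ret(1)[OF pf_pos]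

lemma follows_sol:
  assumes X: "solution_on field {0..} X" and s: "s \<ge> 0" and t: "t \<ge> 0"
  shows "X s = (0, z) \<Longrightarrow> X (t + s) = sol z t" and "X s = (0, - z) \<Longrightarrow> X (t + s) = - sol z t"
proof -
  note shift = solution_on_shift[OF X s]
  show "X (t + s) = sol z t" if "X s = (0, z)"
    using forward_unique[OF shift sol[of z] _ t] that by (simp add: sol_0)
  show "X (t + s) = - sol z t" if "X s = (0, - z)"
    using forward_unique[OF shift solution_on_minus[OF sol[of z]] _ t] that by (simp add: sol_0)
qed

text \<open>At time \<open>\<tau>\<close> the solution stands at the reflection of its starting
  point, and the field is odd, so it continues as its own reflection. Two half turns make a
  period.\<close>

lemma Y_half: assumes "t \<ge> 0" shows "Y (t + \<tau>) = - Y t"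
  using follows_sol(2)[OF sol _ assms, of \<tau> pf pf] ret(3)[OF pf_pos] P_pf tau_pos by simp

lemma Y_period: assumes "t \<ge> 0" shows "Y (t + 2 * \<tau>) = Y t"
  using Y_half[of "t + \<tau>"] Y_half[OF assms] assms tau_pos by (simp add: add.assoc)

lemma Y_multiple: assumes "t \<ge> 0" shows "Y (t + real n * (2 * \<tau>)) = Y t"
proof (induction n)
  case (Suc n)
  have "t + real n * (2 * \<tau>) \<ge> 0" using assms tau_pos by simp
  then have "Y ((t + real n * (2 * \<tau>)) + 2 * \<tau>) = Y t" using Y_period Suc by simp
  then show ?case by (simp add: algebra_simps)
qed simp

lemma Y_reduce: assumes "t \<ge> 0" shows "\<exists>s\<in>{0..2 * \<tau>}. Y t = Y s"
proof -
  define n where "n = nat \<lfloor>t / (2 * \<tau>)\<rfloor>"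
  have q: "t / (2 * \<tau>) \<ge> 0" using assms tau_pos by simp
  then have n: "real n \<le> t / (2 * \<tau>)" "t / (2 * \<tau>) < real n + 1"
    unfolding n_def by (simp_all add: of_nat_nat)
  define s where "s = t - real n * (2 * \<tau>)"
  have "real n * (2 * \<tau>) \<le> t" using n(1) tau_pos by (simp add: pos_le_divide_eq)
  moreover have "t < (real n + 1) * (2 * \<tau>)" using n(2) tau_pos by (simp add: pos_divide_less_eq)
  ultimately have s: "0 \<le> s" "s \<le> 2 * \<tau>" by (auto simp: s_def algebra_simps)
  have "Y t = Y s" using Y_multiple[OF s(1), of n] by (simp add: s_def)
  then show ?thesis using s by auto
qed

lemma cycle_eq: "cycle = Y ` {0..2 * \<tau>}"
  using Y_reduce unfolding cycle_def by fastforce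

lemma Y_in_cycle: "t \<ge> 0 \<Longrightarrow> Y t \<in> cycle"
  by (simp add: cycle_def)

lemma compact_cycle: "compact cycle"
  unfolding cycle_eq
  by (intro compact_continuous_image continuous_on_subset[OF solution_continuous[OF sol]]) auto

lemma closed_cycle: "closed cycle" and cycle_nonempty: "cycle \<noteq> {}"
  using compact_cycle compact_imp_closed Y_in_cycle[of 0] by auto

lemma cycle_minus: assumes "q \<in> cycle" shows "- q \<in> cycle"
proof -
  obtain t where t: "t \<ge> 0" "q = Y t" using assms by (auto simp: cycle_def)
  then show ?thesis using Y_half[OF t(1)] Y_in_cycle[of "t + \<tau>"] tau_pos by simp
qed

lemmas infdist_cycle_minus = infdist_uminus[OF closed_cycle cycle_nonempty cycle_minus]

lemma solution_nonzero:
  assumes X: "solution_on field {0..} X" and "X 0 \<noteq> 0" "t \<ge> 0"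
  shows "X t \<noteq> 0"
proof
  assume "X t = 0"
  then have "X (t - t) = (\<lambda>_. 0) (t - t)"
    by (intro backward_unique[OF X solution_zero]) (use assms in auto)
  then show False using assms by simp
qed

lemma zero_notin_cycle: "0 \<notin> cycle"
proof
  assume "0 \<in> cycle"
  then obtain t where "t \<ge> 0" "Y t = 0" by (auto simp: cycle_def)
  then show False using solution_nonzero[OF sol, of pf t] pf_pos by (simp add: sol_0 zero_prod_def)
qed

text \<open>\<open>periodic_orbit\<close> asks for a solution on the whole line. It is built by
  moving each time forward by enough periods to be nonnegative; periodicity makes the value
  independent of how many are taken.\<close>

lemma periodic_orbit_cycle: "periodic_orbit field cycle"
proof -
  define T where "T = 2 * \<tau>"
  have T: "T > 0" using tau_pos by (simp add: T_def)
  define N where "N = (\<lambda>t::real. nat \<lceil>\<bar>t\<bar> / T\<rceil>)"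
  have N: "t + real (N t) * T \<ge> 0" for t
  proof -
    have "\<bar>t\<bar> / T \<le> real (N t)" unfolding N_def by (rule real_nat_ceiling_ge)
    then have "\<bar>t\<bar> \<le> real (N t) * T" using T by (simp add: pos_divide_le_eq)
    then show ?thesis by linarith
  qed
  define X where "X = (\<lambda>t. Y (t + real (N t) * T))"
  have X: "X t = Y (t + real n * T)" if n: "t + real n * T \<ge> 0" for t n
  proof (cases "n \<le> N t")
    case True
    then have e: "t + real (N t) * T = (t + real n * T) + real (N t - n) * T" by (simp add: of_nat_diff algebra_simps)
    show ?thesis unfolding X_def e using Y_multiple[OF n, of "N t - n"] unfolding T_def .
  next
    case False
    then have e: "t + real n * T = (t + real (N t) * T) + real (n - N t) * T" by (simp add: of_nat_diff algebra_simps)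
    show ?thesis unfolding X_def e using Y_multiple[OF N[of t], of "n - N t", symmetric] unfolding T_def .
  qed
  have "(X has_vector_derivative field (X t)) (at t)" for t
  proof -
    \<comment> \<open>One period more than necessary, so that \<open>t + c\<close> is interior to
      \<open>{0..}\<close> and the same shift \<open>c\<close> serves a whole neighbourhood of
      \<open>t\<close>.\<close>
    define c where "c = real (N t + 1) * T"
    have tc: "t + c \<ge> T" using N[of t] by (simp add: c_def algebra_simps)
    have "at (t + c) within {0..} = at (t + c)" by (rule at_within_interior) (use tc T in simp)
    moreover have "(Y has_vector_derivative field (Y (t + c))) (at (t + c) within {0..})"
      using sol[of pf] tc T by (simp add: solution_on_def)
    ultimately have d: "(Y has_vector_derivative field (Y (t + c))) (at (t + c))" by simp
    have "((\<lambda>s. s + c) has_vector_derivative 1) (at t)"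
      by (auto intro!: derivative_eq_intros)
    from vector_diff_chain_at[OF this d]
    have "((\<lambda>s. Y (s + c)) has_vector_derivative field (Y (t + c))) (at t)" by (simp add: o_def)
    moreover have Xc: "X s = Y (s + c)" if "s > t - T" for s
      unfolding c_def by (rule X) (use that tc in \<open>simp add: c_def\<close>)
    ultimately have "(X has_vector_derivative field (Y (t + c))) (at t)"
      using T by (elim has_vector_derivative_transform_within_open[where S = "{t - T<..}"]) auto
    then show ?thesis using Xc[of t] T by simp
  qed
  then have "solution_on field UNIV X" by (simp add: solution_on_def)
  moreover have "\<forall>t. X (t + T) = X t"
  proof
    fix t
    have 1: "t + real (N t + 1) * T \<ge> 0" using N[of t] T by (simp add: algebra_simps)
    have "X (t + T) = Y ((t + T) + real (N t) * T)" by (rule X) (use 1 in \<open>simp add: algebra_simps\<close>)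
    also have "\<dots> = Y (t + real (N t + 1) * T)" by (simp add: algebra_simps)
    also have "\<dots> = X t" using X[OF 1] by simp
    finally show "X (t + T) = X t" .
  qed
  moreover have "\<exists>t. X t \<noteq> X 0"
  proof (rule exI[of _ \<tau>])
    have "X \<tau> = Y \<tau>" "X 0 = Y 0" using X[of \<tau> 0] X[of 0 0] tau_pos by auto
    then show "X \<tau> \<noteq> X 0" using ret(3)[OF pf_pos] sol_0[of pf] P_pf pf_pos by simp
  qed
  moreover have "cycle = range X"
  proof (intro equalityI subsetI)
    fix q assume "q \<in> cycle"
    then obtain t where "t \<ge> 0" "q = Y t" by (auto simp: cycle_def)
    then have "q = X t" using X[of t 0] by simp
    then show "q \<in> range X" by (rule range_eqI)
  next
    fix q assume "q \<in> range X"
    then show "q \<in> cycle" using Y_in_cycle[OF N] by (auto simp: X_def)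
  qed
  ultimately show ?thesis
    unfolding periodic_orbit_def using T by - (rule exI[of _ X], rule exI[of _ T], intro conjI)
qed

text \<open>Started on the section near the cycle, a solution meets the section again after every half
  return, each time no farther from \<open>pf\<close>; in between it shadows the cycle.\<close>

lemma section_stable:
  assumes e: "e > 0"
  shows "\<exists>r>0. \<forall>X z t. solution_on field {0..} X \<longrightarrow> \<bar>z - pf\<bar> < r \<longrightarrow> X 0 = (0, z) \<or> X 0 = (0, - z) \<longrightarrow>
      0 \<le> t \<longrightarrow> infdist (X t) cycle < e"
proof -
  obtain r1 where r1: "r1 > 0" "\<And>w. \<bar>w - pf\<bar> < r1 \<Longrightarrow> w > 0 \<and> \<bar>ret w - \<tau>\<bar> < \<tau> / 2"
    using ret_near[OF pf_pos, of "\<tau> / 2"] tau_pos by auto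
  show ?thesis
  proof (rule continuous_dependence[of "pf + 1" "2 * \<tau>"])
    fix C :: real assume C: "C > 0" "\<And>X Y t. solution_on field {0..} X \<Longrightarrow> solution_on field {0..} Y \<Longrightarrow>
      norm (X 0) \<le> pf + 1 \<Longrightarrow> norm (Y 0) \<le> pf + 1 \<Longrightarrow> t \<in> {0..2 * \<tau>} \<Longrightarrow> dist (X t) (Y t) \<le> C * dist (X 0) (Y 0)"
    \<comment> \<open>The three bounds make \<open>ret z\<close> differ from \<open>\<tau>\<close>
      by less than \<open>\<tau> / 2\<close>, keep \<open>z\<close> below \<open>pf + 1\<close>, and
      hold the deviation \<open>C * \<bar>z - pf\<bar>\<close> below \<open>e\<close>.\<close>
    define r where "r = min r1 (min 1 (e / C))"
    have r: "r > 0" using r1(1) e C(1) by (simp add: r_def)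
    \<comment> \<open>Induction on elapsed time in units of \<open>\<tau> / 2\<close>: each half
      return takes longer than one unit, so restarting the clock at the next section point uses up
      at least one. It also takes less than \<open>2 * \<tau>\<close>, the range in which
      \<open>C\<close> is valid.\<close>
    have ind: "infdist (X t) cycle < e"
      if "solution_on field {0..} X" "\<bar>z - pf\<bar> < r" "X 0 = (0, z) \<or> X 0 = (0, - z)" "0 \<le> t" "t \<le> real n * (\<tau> / 2)"
      for n X z t
      using that
    proof (induction n arbitrary: X z t rule: nat.induct)
      case zero
      have z: "z > 0" using r1(2)[of z] zero(2) by (simp add: r_def)
      have "infdist (sol z 0) cycle < e"
      proof -
        have "infdist (sol z 0) cycle \<le> dist (sol z 0) (Y 0)" by (intro infdist_le Y_in_cycle) simp
        also have "\<dots> \<le> C * dist (sol z 0) (Y 0)"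
          by (rule C(2)[OF sol sol]) (use zero(2) z pf_pos tau_pos in \<open>auto simp: sol_0 norm_Pair r_def\<close>)
        also have "\<dots> = C * \<bar>z - pf\<bar>" by (simp add: sol_0 dist_Pair_Pair dist_real_def)
        also have "\<dots> < C * (e / C)" using zero(2) C(1) by (intro mult_strict_left_mono) (auto simp: r_def)
        finally show ?thesis using C(1) by simp
      qed
      moreover have "t = 0" using zero by simp
      ultimately show ?case using zero(3) infdist_cycle_minus[of "(0, z)"] by (auto simp: sol_0)
    next
      case (Suc n)
      have z: "z > 0" "\<bar>ret z - \<tau>\<bar> < \<tau> / 2" using r1(2)[of z] Suc.prems(2) by (auto simp: r_def)
      have rz: "ret z < 2 * \<tau>" "\<tau> / 2 < ret z" using z(2) unfolding abs_less_iff by linarith+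
      show ?case
      proof (cases "t \<le> ret z")
        case True
        have "infdist (sol z t) cycle \<le> dist (sol z t) (Y t)" by (intro infdist_le Y_in_cycle Suc.prems)
        also have "\<dots> \<le> C * dist (sol z 0) (Y 0)"
          by (rule C(2)[OF sol sol])
            (use Suc.prems(2,4) z(1) rz pf_pos True in \<open>auto simp: sol_0 norm_Pair r_def abs_less_iff\<close>)
        also have "\<dots> = C * \<bar>z - pf\<bar>" by (simp add: sol_0 dist_Pair_Pair dist_real_def)
        also have "\<dots> < C * (e / C)" using Suc.prems(2) C(1) by (intro mult_strict_left_mono) (auto simp: r_def)
        finally have "infdist (sol z t) cycle < e" using C(1) by simp
        moreover have "X t = sol z t \<or> X t = - sol z t"
          using follows_sol[OF Suc.prems(1) order_refl Suc.prems(4), of z] Suc.prems(3) by auto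
        ultimately show ?thesis using infdist_cycle_minus[of "sol z t"] by auto
      next
        case False
        define X' where "X' = (\<lambda>s. X (s + ret z))"
        have "infdist (X' (t - ret z)) cycle < e"
        proof (rule Suc.IH)
          show "solution_on field {0..} X'"
            unfolding X'_def by (rule solution_on_shift[OF Suc.prems(1)]) (use ret(1)[OF z(1)] in simp)
          show "\<bar>P z - pf\<bar> < r" using P_closer(2)[OF z(1)] Suc.prems(2) by simp
          show "X' 0 = (0, P z) \<or> X' 0 = (0, - P z)"
            using follows_sol[OF Suc.prems(1) order_refl, of "ret z" z] Suc.prems(3) ret(1,3)[OF z(1)]
            by (auto simp: X'_def)
          show "0 \<le> t - ret z" using False by simp
          show "t - ret z \<le> real n * (\<tau> / 2)" using Suc.prems(5) rz by (simp add: algebra_simps)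
        qed
        then show ?thesis by (simp add: X'_def)
      qed
    qed
    have "infdist (X t) cycle < e"
      if "solution_on field {0..} X" "\<bar>z - pf\<bar> < r" "X 0 = (0, z) \<or> X 0 = (0, - z)" "0 \<le> t" for X z t
    proof (rule ind[OF that])
      have "t / (\<tau> / 2) \<le> real (nat \<lceil>t / (\<tau> / 2)\<rceil>)" by (rule real_nat_ceiling_ge)
      then show "t \<le> real (nat \<lceil>t / (\<tau> / 2)\<rceil>) * (\<tau> / 2)" using tau_pos by (simp only: pos_divide_le_eq half_gt_zero)
    qed
    then show ?thesis using r by (intro exI[of _ r]) simp
  qed
qed

text \<open>The solution shadows \<open>Y\<close> from the nearest cycle point \<open>Y s0\<close>
  on. Around time \<open>2 * T\<close>, \<open>Y\<close> crosses \<open>x = 0\<close> from left to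
  right at height \<open>pf\<close>, so a close solution changes sign in the same window.\<close>

lemma reaches_section_near_cycle:
  assumes r: "r > 0" and e: "e > 0"
  shows "\<exists>d>0. \<forall>X. solution_on field {0..} X \<longrightarrow> infdist (X 0) cycle < d \<longrightarrow>
    (\<exists>s\<ge>0. \<exists>z. \<bar>z - pf\<bar> < r \<and> X s = (0, z) \<and> (\<forall>t. 0 \<le> t \<and> t \<le> s \<longrightarrow> infdist (X t) cycle < e))"
proof -
  define T where "T = 2 * \<tau>"
  have T: "T > 0" using tau_pos by (simp add: T_def)
  have YT: "Y T = (0, pf)" using Y_period[of 0] by (simp add: T_def sol_0)
  have "isCont (py pf) T" using sol_DERIV(2)[OF T] by (rule DERIV_isCont)
  then obtain d1 where d1: "d1 > 0" "\<And>t. \<bar>t - T\<bar> < d1 \<Longrightarrow> \<bar>py pf t - py pf T\<bar> < r / 2"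
    using r unfolding continuous_at_eps_delta by (metis dist_real_def half_gt_zero)
  define h where "h = min (d1 / 2) (\<tau> / 2)"
  have h: "h > 0" "h < d1" "h < \<tau>" using d1(1) tau_pos by (auto simp: h_def)
  define xr where "xr = px pf h"
  have xr: "xr > 0" using ret(2)[OF pf_pos h(1,3)] by (simp add: xr_def)
  define xl where "xl = px pf (\<tau> - h)"
  have xl: "xl > 0" using ret(2)[OF pf_pos, of "\<tau> - h"] h by (simp add: xl_def)
  have Yr: "px pf (2 * T + h) = xr" using Y_multiple[of h 2] h by (simp add: xr_def T_def algebra_simps)
  have Yl: "px pf (2 * T - h) = - xl"
  proof -
    have "Y (\<tau> - h + \<tau>) = - Y (\<tau> - h)" by (rule Y_half) (use h in simp)
    moreover have "2 * T - h = (\<tau> - h + \<tau>) + real 1 * (2 * \<tau>)" by (simp add: T_def)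
    ultimately show ?thesis using Y_multiple[of "\<tau> - h + \<tau>" 1] h tau_pos by (simp add: xl_def)
  qed
  obtain B where B: "\<And>q. q \<in> cycle \<Longrightarrow> norm q \<le> B"
    using compact_imp_bounded[OF compact_cycle] unfolding bounded_iff by auto
  show ?thesis
  proof (rule continuous_dependence[of "B + 1" "3 * T"])
    fix C :: real assume C: "C > 0" "\<And>X Y t. solution_on field {0..} X \<Longrightarrow> solution_on field {0..} Y \<Longrightarrow>
      norm (X 0) \<le> B + 1 \<Longrightarrow> norm (Y 0) \<le> B + 1 \<Longrightarrow> t \<in> {0..3 * T} \<Longrightarrow> dist (X t) (Y t) \<le> C * dist (X 0) (Y 0)"
    define k where "k = min (min (r / 2) e) (min xr xl)"
    have k: "k > 0" "k \<le> r / 2" "k \<le> e" "k \<le> xr" "k \<le> xl" using r e xr xl by (auto simp: k_def)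
    define d where "d = min 1 (k / C)"
    have d: "d > 0" using k C(1) by (simp add: d_def)
    have "\<exists>s\<ge>0. \<exists>z. \<bar>z - pf\<bar> < r \<and> X s = (0, z) \<and> (\<forall>t. 0 \<le> t \<and> t \<le> s \<longrightarrow> infdist (X t) cycle < e)"
      if X: "solution_on field {0..} X" and near: "infdist (X 0) cycle < d" for X
    proof -
      obtain q where q: "q \<in> cycle" "infdist (X 0) cycle = dist (X 0) q"
        using infdist_attains_inf[OF closed_cycle cycle_nonempty] by blast
      then obtain s0 where s0: "0 \<le> s0" "s0 \<le> T" "q = Y s0" by (auto simp: cycle_eq T_def)
      have dq: "dist (X 0) q < d" using near q by simp
      have nX: "norm (X 0) \<le> B + 1"
      proof -
        have "norm (X 0) \<le> norm q + dist (X 0) q" by norm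
        then show ?thesis using B[OF q(1)] dq by (simp add: d_def)
      qed
      have close: "dist (X t) (Y (t + s0)) < k" if "0 \<le> t" "t \<le> 3 * T" for t
      proof -
        have "dist (X t) (Y (t + s0)) \<le> C * dist (X 0) (Y (0 + s0))"
          by (rule C(2)[OF X solution_on_shift[OF sol s0(1)]]) (use nX B[OF q(1)] s0 that in auto)
        also have "\<dots> < C * (k / C)" using dq s0(3) C(1) by (intro mult_strict_left_mono) (auto simp: d_def)
        finally show ?thesis using C(1) by simp
      qed
      have cx: "\<bar>fst (X t) - px pf (t + s0)\<bar> < k" and cy: "\<bar>snd (X t) - py pf (t + s0)\<bar> < k" if "0 \<le> t" "t \<le> 3 * T" for t
        using close[OF that] dist_fst_le[of "X t" "Y (t + s0)"] dist_snd_le[of "X t" "Y (t + s0)"]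
        by (auto simp: dist_real_def)
      \<comment> \<open>The crossing at \<open>2 * T\<close> is used, not the one at
        \<open>T\<close>, because \<open>s0\<close> may be as large as \<open>T\<close> and the
        window must begin at a nonnegative time.\<close>
      define t1 where "t1 = 2 * T - s0 - h"
      define t2 where "t2 = 2 * T - s0 + h"
      have t12: "0 \<le> t1" "t1 \<le> t2" "t2 \<le> 3 * T" using s0 h tau_pos by (auto simp: t1_def t2_def T_def)
      have "t1 + s0 = 2 * T - h" "t2 + s0 = 2 * T + h" by (auto simp: t1_def t2_def)
      then have "fst (X t1) \<le> 0" "0 \<le> fst (X t2)"
        using cx[of t1] cx[of t2] t12 Yr Yl k by auto
      moreover have "continuous_on {t1..t2} (\<lambda>t. fst (X t))"
        by (rule solution_continuous_components(1)[OF X]) (use t12 in auto)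
      ultimately obtain s where s: "t1 \<le> s" "s \<le> t2" "fst (X s) = 0"
        using IVT'[of "\<lambda>t. fst (X t)" t1 0 t2] t12(2) by auto
      define z where "z = snd (X s)"
      have "\<bar>z - pf\<bar> < r"
      proof -
        \<comment> \<open>The modulus \<open>d1\<close> belongs to time \<open>T\<close>, whereas
          \<open>s + s0\<close> is close to \<open>2 * T\<close>; one period is taken off.\<close>
        define v where "v = s + s0 - T"
        have v: "\<bar>v - T\<bar> < d1" using s h by (auto simp: v_def t1_def t2_def abs_less_iff)
        have v0: "v \<ge> 0" using s s0 h T by (auto simp: v_def t1_def T_def)
        have "Y (s + s0) = Y v" using Y_period[OF v0] by (simp add: v_def T_def)
        then have "\<bar>py pf (s + s0) - pf\<bar> < r / 2" using d1(2)[OF v] YT by simp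
        moreover have "\<bar>z - py pf (s + s0)\<bar> < r / 2" using cy[of s] s t12 k by (simp add: z_def)
        ultimately show ?thesis by linarith
      qed
      moreover have "X s = (0, z)" using s(3) by (simp add: z_def prod_eq_iff)
      moreover have "infdist (X t) cycle < e" if "0 \<le> t" "t \<le> s" for t
      proof -
        have "infdist (X t) cycle \<le> dist (X t) (Y (t + s0))" by (intro infdist_le Y_in_cycle) (use that s0 in simp)
        also have "\<dots> < k" by (rule close) (use that s t12 in auto)
        finally show ?thesis using k by simp
      qed
      moreover have "s \<ge> 0" using s t12 by simp
      ultimately show ?thesis by (intro exI[of _ s] conjI exI[of _ z]) auto
    qed
    then show ?thesis using d by (intro exI[of _ d]) simp
  qed
qed

lemma orbitally_stable_cycle: "orbitally_stable field cycle"
  unfolding orbitally_stable_def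
proof (intro allI impI)
  fix e :: real assume e: "e > 0"
  obtain r where r: "r > 0" "\<forall>X z t. solution_on field {0..} X \<longrightarrow> \<bar>z - pf\<bar> < r \<longrightarrow> X 0 = (0, z) \<or> X 0 = (0, - z) \<longrightarrow>
      0 \<le> t \<longrightarrow> infdist (X t) cycle < e"
    using section_stable[OF e] by (elim exE conjE) (rule that)
  obtain d where d: "d > 0" "\<forall>X. solution_on field {0..} X \<longrightarrow> infdist (X 0) cycle < d \<longrightarrow>
    (\<exists>s\<ge>0. \<exists>z. \<bar>z - pf\<bar> < r \<and> X s = (0, z) \<and> (\<forall>t. 0 \<le> t \<and> t \<le> s \<longrightarrow> infdist (X t) cycle < e))"
    using reaches_section_near_cycle[OF r(1) e] by (elim exE conjE) (rule that)
  have "infdist (X t) cycle < e" if X: "solution_on field {0..} X" "infdist (X 0) cycle < d" and t: "t \<ge> 0" for X t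
  proof -
    obtain s z where s: "s \<ge> 0" "\<bar>z - pf\<bar> < r" "X s = (0, z)" "\<forall>t. 0 \<le> t \<and> t \<le> s \<longrightarrow> infdist (X t) cycle < e"
      using d(2)[rule_format, OF X] by (elim exE conjE) (rule that)
    show ?thesis
    proof (cases "t \<le> s")
      case False
      have "infdist ((\<lambda>u. X (u + s)) (t - s)) cycle < e"
        by (rule r(2)[rule_format, OF solution_on_shift[OF X(1) s(1)] s(2)]) (use s(3) False in auto)
      then show ?thesis by simp
    qed (use s t in simp)
  qed
  then show "\<exists>d>0. \<forall>X. solution_on field {0..} X \<and> infdist (X 0) cycle < d \<longrightarrow> (\<forall>t\<ge>0. infdist (X t) cycle < e)"
    using d(1) by (intro exI[of _ d]) simp
qed

section \<open>Attraction of every nonzero solution, and uniqueness\<close>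

lemma reaches_section:
  assumes X: "solution_on field {0..} X" and ne: "X 0 \<noteq> 0"
  shows "\<exists>s\<ge>0. \<exists>z>0. X s = (0, z) \<or> X s = (0, - z)"
proof (cases "fst (X 0)" "0 :: real" rule: linorder_cases)
  case equal
  then have "snd (X 0) \<noteq> 0" using ne by (simp add: prod_eq_iff)
  then show ?thesis using equal
    by (intro exI[of _ 0] conjI exI[of _ "\<bar>snd (X 0)\<bar>"]) (auto simp: prod_eq_iff abs_if)
next
  case greater
  have "\<exists>\<tau>>0. (\<forall>t. 0 < t \<and> t < \<tau> \<longrightarrow> fst (X t) > 0) \<and> fst (X \<tau>) = 0 \<and> snd (X \<tau>) < 0"
    by (rule first_return[OF X]) (use greater in simp)
  then obtain s where "s > 0" "fst (X s) = 0" "snd (X s) < 0" by auto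
  then show ?thesis
    by (intro exI[of _ s] conjI exI[of _ "- snd (X s)"]) (auto simp: prod_eq_iff)
next
  case less
  have "\<exists>\<tau>>0. (\<forall>t. 0 < t \<and> t < \<tau> \<longrightarrow> fst (- X t) > 0) \<and> fst (- X \<tau>) = 0 \<and> snd (- X \<tau>) < 0"
    by (rule first_return[OF solution_on_minus[OF X]]) (use less in simp)
  then obtain s where "s > 0" "fst (X s) = 0" "snd (X s) > 0" by auto
  then show ?thesis
    by (intro exI[of _ s] conjI exI[of _ "snd (X s)"]) (auto simp: prod_eq_iff)
qed

lemma reaches_iterates:
  assumes X: "solution_on field {0..} X" and s: "s \<ge> 0" and z: "z > 0" "X s = (0, z) \<or> X s = (0, - z)"
  shows "\<exists>s\<ge>0. X s = (0, (P ^^ n) z) \<or> X s = (0, - (P ^^ n) z)"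
proof (induction n)
  case 0
  then show ?case using s z by (intro exI[of _ s]) simp
next
  case (Suc n)
  then obtain u where u: "u \<ge> 0" "X u = (0, (P ^^ n) z) \<or> X u = (0, - (P ^^ n) z)" by blast
  define w where "w = (P ^^ n) z"
  have w: "w > 0" unfolding w_def by (rule iterates_pos[OF z(1)])
  note R = ret(1,3)[OF w]
  have "X (ret w + u) = sol w (ret w) \<or> X (ret w + u) = - sol w (ret w)"
    using follows_sol[OF X u(1), of "ret w" w] R(1) u(2) by (auto simp: w_def)
  then have "X (ret w + u) = (0, P w) \<or> X (ret w + u) = (0, - P w)" using R(2) by auto
  moreover have "(P ^^ Suc n) z = P w" by (simp add: w_def)
  ultimately show ?case using R(1) u(1) by (intro exI[of _ "ret w + u"]) simp
qed

text \<open>The solution reaches the section, its section points are iterates of \<open>P\<close> up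
  to sign, and once one of them is near \<open>pf\<close>, \<open>section_stable\<close> controls
  all later times. Only the origin is excluded, which is what makes the uniqueness of periodic
  orbits a consequence.\<close>

lemma attracted_to_cycle:
  assumes X: "solution_on field {0..} X" and ne: "X 0 \<noteq> 0"
  shows "((\<lambda>t. infdist (X t) cycle) \<longlongrightarrow> 0) at_top"
proof (rule tendstoI)
  fix e :: real assume e: "e > 0"
  obtain r where r: "r > 0" "\<forall>X z t. solution_on field {0..} X \<longrightarrow> \<bar>z - pf\<bar> < r \<longrightarrow> X 0 = (0, z) \<or> X 0 = (0, - z) \<longrightarrow>
      0 \<le> t \<longrightarrow> infdist (X t) cycle < e"
    using section_stable[OF e] by (elim exE conjE) (rule that)
  obtain s0 z where s0: "s0 \<ge> 0" "z > 0" "X s0 = (0, z) \<or> X s0 = (0, - z)"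
    using reaches_section[OF X ne] by blast
  obtain n where n: "\<bar>(P ^^ n) z - pf\<bar> < r"
    using LIMSEQ_D[OF iterates_tendsto[OF s0(2)] r(1)] by auto
  obtain s where s: "s \<ge> 0" "X s = (0, (P ^^ n) z) \<or> X s = (0, - (P ^^ n) z)"
    using reaches_iterates[OF X s0, of n] by blast
  have "infdist (X t) cycle < e" if "t \<ge> s" for t
  proof -
    have "infdist ((\<lambda>u. X (u + s)) (t - s)) cycle < e"
      by (rule r(2)[rule_format, OF solution_on_shift[OF X s(1)] n]) (use s(2) that in auto)
    then show ?thesis by simp
  qed
  then show "\<forall>\<^sub>F t in at_top. dist (infdist (X t) cycle) 0 < e"
    unfolding eventually_at_top_linorder by (intro exI[of _ s]) (simp add: infdist_nonneg)
qed

lemma orbitally_attracting_cycle: "orbitally_attracting field cycle"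
  unfolding orbitally_attracting_def
\<comment> \<open>Any point closer to the cycle than the origin is differs from the origin, and this
  is all that attraction asks for.\<close>
proof (intro exI[of _ "infdist 0 cycle"] conjI allI impI)
  show "0 < infdist 0 cycle"
    using in_closed_iff_infdist_zero[OF closed_cycle cycle_nonempty, of 0] zero_notin_cycle infdist_nonneg[of 0 cycle]
    by (auto simp: less_le)
  fix p assume p: "infdist p cycle < infdist 0 cycle"
  show "\<exists>X. solution_on field {0..} X \<and> X 0 = p"
  proof (rule forward_solution_exists)
    fix X assume "solution_on field {0..} X" "X 0 = p"
    then show ?thesis by (intro exI[of _ X]) simp
  qed
  fix X assume "solution_on field {0..} X \<and> X 0 = p"
  then show "((\<lambda>t. infdist (X t) cycle) \<longlongrightarrow> 0) at_top"
    using p by (intro attracted_to_cycle) auto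
qed

text \<open>A periodic solution comes back to \<open>X 0\<close> at arbitrarily late times, yet its
  distance to \<open>cycle\<close> tends to 0; so \<open>X 0\<close> already lies on it. The
  equilibrium is ruled out because a periodic orbit is not constant.\<close>

lemma periodic_orbit_unique:
  assumes "periodic_orbit field \<Delta>"
  shows "\<Delta> = cycle"
proof -
  obtain X T t1 where X: "solution_on field UNIV X" and T: "T > 0" and per': "\<forall>t. X (t + T) = X t"
    and ne: "X t1 \<noteq> X 0" and \<Delta>: "\<Delta> = range X"
    using assms unfolding periodic_orbit_def by (elim exE conjE) (rule that)
  note per = per'[rule_format]
  have X0: "solution_on field {0..} X"
    using X by (auto simp: solution_on_def intro: has_vector_derivative_at_within)
  have fwd: "\<exists>u\<ge>v. X t = X u" for t v
  proof -
    define n where "n = nat \<lceil>(v - t) / T\<rceil>"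
    have "(v - t) / T \<le> real n" unfolding n_def by (rule real_nat_ceiling_ge)
    then have "v \<le> t + real n * T" using T by (simp add: pos_divide_le_eq algebra_simps)
    then show ?thesis using periodic_multiple[of X T, OF per, of t n] by (intro exI[of _ "t + real n * T"]) simp
  qed
  have "X 0 \<noteq> 0"
  proof
    assume z: "X 0 = 0"
    have "X t = 0" for t
    proof -
      obtain u where u: "u \<ge> 0" "X t = X u" using fwd[of 0 t] by auto
      then show ?thesis using forward_unique[OF X0 solution_zero z u(1)] by simp
    qed
    then show False using ne z by simp
  qed
  note att = attracted_to_cycle[OF X0 this]
  have "infdist (X 0) cycle = 0"
  proof (rule ccontr)
    assume "infdist (X 0) cycle \<noteq> 0"
    then have "infdist (X 0) cycle > 0" using infdist_nonneg[of "X 0" cycle] by simp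
    from order_tendstoD(2)[OF att this] obtain v where v: "\<And>t. t \<ge> v \<Longrightarrow> infdist (X t) cycle < infdist (X 0) cycle"
      unfolding eventually_at_top_linorder by blast
    obtain u where "u \<ge> v" "X 0 = X u" using fwd[of v 0] by auto
    then show False using v[of u] by simp
  qed
  then have "X 0 \<in> cycle" using in_closed_iff_infdist_zero[OF closed_cycle cycle_nonempty] by simp
  then obtain s where s: "s \<ge> 0" "X 0 = Y s" by (auto simp: cycle_def)
  have XY: "X t = Y (t + s)" if "t \<ge> 0" for t
    by (rule forward_unique[OF X0 solution_on_shift[OF sol s(1)] _ that]) (use s in simp)
  show ?thesis
  proof (intro equalityI subsetI)
    fix q assume "q \<in> \<Delta>"
    then obtain t where "q = X t" by (auto simp: \<Delta>)
    then obtain u where "u \<ge> 0" "q = X u" using fwd[of 0 t] by auto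
    then show "q \<in> cycle" using XY[of u] s(1) Y_in_cycle[of "u + s"] by simp
  next
    fix q assume "q \<in> cycle"
    then obtain t where t: "t \<ge> 0" "q = Y t" by (auto simp: cycle_def)
    \<comment> \<open>Since \<open>X\<close> is \<open>Y\<close> delayed by \<open>s\<close>, enough
      periods are added to make the shifted time nonnegative.\<close>
    define n where "n = nat \<lceil>s / (2 * \<tau>)\<rceil>"
    have "s / (2 * \<tau>) \<le> real n" unfolding n_def by (rule real_nat_ceiling_ge)
    then have n: "s \<le> real n * (2 * \<tau>)" using tau_pos by (simp add: pos_divide_le_eq)
    have "q = Y (t + real n * (2 * \<tau>))" using Y_multiple[OF t(1)] t(2) by simp
    also have "\<dots> = X (t + real n * (2 * \<tau>) - s)" using XY[of "t + real n * (2 * \<tau>) - s"] n t(1) by simp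
    finally show "q \<in> \<Delta>" by (simp add: \<Delta>)
  qed
qed

lemma stable_limit_cycle_cycle: "stable_limit_cycle field cycle"
  unfolding stable_limit_cycle_def limit_cycle_def
proof (intro conjI)
  show "\<exists>U. open U \<and> cycle \<subseteq> U \<and> (\<forall>\<Delta>. periodic_orbit field \<Delta> \<and> \<Delta> \<subseteq> U \<longrightarrow> \<Delta> = cycle)"
  \<comment> \<open>Isolation holds with the whole plane as neighbourhood, as there is no other
    periodic orbit at all.\<close>
  proof (intro exI[of _ UNIV] conjI allI impI)
    fix \<Delta> assume "periodic_orbit field \<Delta> \<and> \<Delta> \<subseteq> UNIV"
    then show "\<Delta> = cycle" by (intro periodic_orbit_unique) simp
  qed simp_all
qed (rule periodic_orbit_cycle orbitally_stable_cycle orbitally_attracting_cycle)+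

end

theorem lemma5:
  fixes \<mu> \<beta> \<epsilon> :: real
  assumes "\<epsilon> > 0" and "\<beta> = 0" and "\<mu> \<ge> 0"
  shows "\<exists>\<Gamma>. stable_limit_cycle (system_field \<mu> \<beta> \<epsilon>) \<Gamma> \<and>
             (\<forall>\<Delta>. limit_cycle (system_field \<mu> \<beta> \<epsilon>) \<Delta> \<longrightarrow> \<Delta> = \<Gamma>)"
proof -
  interpret lienard \<mu> \<epsilon> by unfold_locales (use assms in auto)
  show ?thesis
    unfolding \<open>\<beta> = 0\<close>
  proof (intro exI[of _ cycle] conjI allI impI)
    show "stable_limit_cycle field cycle" by (rule stable_limit_cycle_cycle)
    fix \<Delta> assume "limit_cycle field \<Delta>"
    then show "\<Delta> = cycle" by (intro periodic_orbit_unique) (simp add: limit_cycle_def)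
  qed
qed

end
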